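(* Let $\alpha\ge 0$ be a real number and let $r_\alpha(n)=\sqrt[n]{\overline{p}(n)/n^{\alpha}}$ for integers $n\ge 1$, where $\overline{p}(n)$ is the number of overpartitions of $n$. Then $$\lim_{n\to\infty} n^{5/2}\,\Delta^2\log r_\alpha(n)=\frac{3\pi}{4}.$$
   Context: An overpartition of $n$ is a nonincreasing sequence of positive integers whose sum is $n$, in which the first occurrence of each number may be overlined; $\overline{p}(n)$ denotes the number of overpartitions of $n$, with $\overline{p}(0)=1$ (for example $\overline{p}(3)=8$). $\Delta$ is the forward difference operator with respect to $n$, so that $\Delta^2 f(n)=f(n+2)-2f(n+1)+f(n)$. $\log$ is the natural logarithm. *)

theory Defs
  imports Complex_Main
begin

text \<open>
  A part is a pair of its size and a flag that is true iff the part is overlined;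
  only the first occurrence of a size may carry the flag.
\<close>

definition is_overpartition :: "nat \<Rightarrow> (nat \<times> bool) list \<Rightarrow> bool" where
  "is_overpartition n xs \<longleftrightarrow>
     sorted_wrt (\<ge>) (map fst xs) \<and>
     (\<forall>x \<in> set xs. fst x > 0) \<and>
     sum_list (map fst xs) = n \<and>
     (\<forall>i < length xs. snd (xs ! i) \<longrightarrow> (\<forall>j < i. fst (xs ! j) \<noteq> fst (xs ! i)))"

definition overpartitions :: "nat \<Rightarrow> nat" where
  "overpartitions n = card {xs. is_overpartition n xs}"

definition forward_difference :: "(nat \<Rightarrow> real) \<Rightarrow> nat \<Rightarrow> real" where
  "forward_difference f n = f (n + 1) - f n"

definition r_seq :: "real \<Rightarrow> nat \<Rightarrow> real" where
  "r_seq \<alpha> n = root n (real (overpartitions n) / real n powr \<alpha>)"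

lemma forward_difference_2:
  "(forward_difference ^^ 2) f n = f (n + 2) - 2 * f (n + 1) + f n"
  by (simp add: forward_difference_def numeral_2_eq_2)

lemma finite_overpartitions: "finite {xs. is_overpartition n xs}"
proof (rule finite_subset)
  show "{xs. is_overpartition n xs} \<subseteq> {xs. set xs \<subseteq> {..n} \<times> UNIV \<and> length xs \<le> n}"
  proof clarify
    fix xs assume xs: "is_overpartition n xs"
    have len: "length ys \<le> sum_list (map fst ys)"
      if "\<forall>x \<in> set ys. fst x > 0" for ys :: "(nat \<times> bool) list"
      using that by (induction ys) auto
    have sz: "fst x \<le> n" if "x \<in> set xs" for x
      using xs that member_le_sum_list[of "fst x" "map fst xs"]
      by (simp add: is_overpartition_def)
    have "length xs \<le> n"
      using xs len[of xs] by (simp add: is_overpartition_def)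
    moreover have "set xs \<subseteq> {..n} \<times> UNIV"
      using sz by (simp add: subset_iff mem_Times_iff)
    ultimately show "set xs \<subseteq> {..n} \<times> UNIV \<and> length xs \<le> n"
      by simp
  qed
  show "finite {xs :: (nat \<times> bool) list. set xs \<subseteq> {..n} \<times> UNIV \<and> length xs \<le> n}"
    by (rule finite_lists_length_le) simp
qed

lemma overpartitions_0: "overpartitions 0 = 1"
proof -
  have "is_overpartition 0 xs \<longleftrightarrow> xs = []" for xs
    by (cases xs) (simp_all add: is_overpartition_def, linarith)
  then show ?thesis
    by (simp add: overpartitions_def)
qed

end

theory Submission
  imports Defs "HOL-Complex_Analysis.Complex_Analysis" "HOL-Real_Asymp.Real_Asymp"
begin

text \<open>
  Write \<open>G(s)\<close> for the generating function of the overpartition numbers at \<open>q = exp (-s)\<close>, that is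
  the product of the factors \<open>(1 + q^k) / (1 - q^k)\<close>. Then \<open>-s (log G)'(s)\<close> is the sum of
  \<open>u(ns)\<close> over \<open>n \<ge> 1\<close>, where \<open>u(w) = w / sinh w\<close> is even and holomorphic near the real axis.
  The full lattice sum of \<open>u(s(n + z))\<close> over the integers is 1-periodic in \<open>z\<close>, so by Cauchy's
  estimates it is constant in \<open>z\<close> up to any power of \<open>s\<close>; halving \<open>s\<close> repeatedly gives
  \<open>G(s) = c sqrt(s) exp(\<pi>^2 / (4 s)) (1 + O(s^6))\<close> in a sector. Outside the sector \<open>G\<close> is
  exponentially smaller.

  Saddle point integrals are avoided by comparing coefficients: with
  \<open>H(t) = sinh(\<pi> sqrt t) / sqrt t\<close>, an entire function of order 1/2, the generating function of
  the sequence \<open>H'(n)\<close> has, up to a constant factor and a bounded error, the same behaviour in the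
  whole strip. Cauchy's inequality on the circle \<open>Re s = \<pi> / (2 sqrt n)\<close> then shows that the
  number of overpartitions of \<open>n\<close> is \<open>k H'(n) (1 + O(n^-2))\<close>. This precision suffices for the
  second difference, and the constant \<open>k\<close> does not matter.
\<close>

section \<open>Generating function\<close>

text \<open>Cauchy's inequality loses a power of n, but it is applied to a difference that is
  smaller than exp(pi^2/(4 Re s)) by the factor (Re s)^6. At Re s = pi/(2 sqrt n) this factor is of
  order n^(-3), against a main term of size exp(pi sqrt n)/n. What the limit requires is a relative
  error o(n^(-3/2)): the error d(n) of the logarithm enters as d(n)/n, and no cancellation between
  neighbouring n is available for it. The derivative of H is taken because the Laplace transform of
  H behaves like s^(-1/2) exp(pi^2/(4 s)); differentiation in t multiplies by s and so produces the
  factor sqrt s of G. The term (log k)/n has second difference O(n^(-3)), and (log n)/n has O(n^(-3)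
  log n), so neither k nor \<alpha> shows in the limit. The value 3 pi/4 is pi times the coefficient
  of n^(-5/2) in the second derivative of n^(-1/2).\<close>

lemma is_overpartition_Nil [simp]: "is_overpartition n [] \<longleftrightarrow> n = 0"
  by (auto simp: is_overpartition_def)

text \<open>The head is always the first occurrence of its size, so its flag is free; any later part
  of the same size is a repetition and must not be overlined.\<close>

lemma is_overpartition_Cons:
  "is_overpartition n ((h, b) # ys) \<longleftrightarrow>
     0 < h \<and> h \<le> n \<and> (\<forall>y\<in>set ys. fst y \<le> h) \<and> (h, True) \<notin> set ys \<and> is_overpartition (n - h) ys"
proof -
  have "(\<forall>i < length ((h, b) # ys). snd (((h, b) # ys) ! i) \<longrightarrow>
           (\<forall>j < i. fst (((h, b) # ys) ! j) \<noteq> fst (((h, b) # ys) ! i))) \<longleftrightarrow>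
        (h, True) \<notin> set ys \<and>
        (\<forall>i < length ys. snd (ys ! i) \<longrightarrow> (\<forall>j < i. fst (ys ! j) \<noteq> fst (ys ! i)))"
    by (auto simp: All_less_Suc2 in_set_conv_nth) (metis prod.collapse)
  then show ?thesis
    unfolding is_overpartition_def by (auto simp del: length_Cons)
qed

definition bounded_overpartitions :: "nat \<Rightarrow> nat \<Rightarrow> (nat \<times> bool) list set" where
  "bounded_overpartitions m n = {xs. is_overpartition n xs \<and> (\<forall>x\<in>set xs. fst x \<le> m)}"

text \<open>These are the lists that may follow a head of size \<open>m\<close>: the head has used
  up the only occurrence of \<open>m\<close> that can be overlined.\<close>

definition plain_overpartitions :: "nat \<Rightarrow> nat \<Rightarrow> (nat \<times> bool) list set" where
  "plain_overpartitions m n = {xs \<in> bounded_overpartitions m n. (m, True) \<notin> set xs}"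

lemma finite_bounded_overpartitions [simp]: "finite (bounded_overpartitions m n)"
  by (rule finite_subset[OF _ finite_overpartitions[of n]]) (auto simp: bounded_overpartitions_def)

lemma finite_plain_overpartitions [simp]: "finite (plain_overpartitions m n)"
  by (simp add: plain_overpartitions_def)

lemma bounded_overpartitions_0: "bounded_overpartitions 0 n = (if n = 0 then {[]} else {})"
proof -
  have "xs = []" if "xs \<in> bounded_overpartitions 0 n" for xs
    using that by (cases xs) (auto simp: bounded_overpartitions_def is_overpartition_Cons)
  moreover have "[] \<in> bounded_overpartitions 0 n \<longleftrightarrow> n = 0"
    by (auto simp: bounded_overpartitions_def)
  ultimately show ?thesis
    by auto
qed

text \<open>Either no part equals \<open>Suc m\<close>, or the head does; it then carries one of two
  flags and leaves a plain list.\<close>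

lemma bounded_overpartitions_Suc:
  "bounded_overpartitions (Suc m) n = bounded_overpartitions m n \<union>
     (if Suc m \<le> n then Cons (Suc m, False) ` plain_overpartitions (Suc m) (n - Suc m) \<union>
        Cons (Suc m, True) ` plain_overpartitions (Suc m) (n - Suc m) else {})" (is "?L = ?R")
proof (rule set_eqI)
  fix xs
  show "xs \<in> ?L \<longleftrightarrow> xs \<in> ?R"
  proof (cases xs)
    case Nil
    then show ?thesis by (auto simp: bounded_overpartitions_def)
  next
    case (Cons x ys)
    then obtain h b where "xs = (h, b) # ys" by (cases x) auto
    then show ?thesis
      by (cases b)
        (auto simp: bounded_overpartitions_def plain_overpartitions_def is_overpartition_Cons le_Suc_eq)
  qed
qed

text \<open>Only one flag is left for the head, and the tail is again plain. This self-reference is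
  what produces the geometric factor 1/(1 - q^(m+1)).\<close>

lemma plain_overpartitions_Suc:
  "plain_overpartitions (Suc m) n = bounded_overpartitions m n \<union>
     (if Suc m \<le> n then Cons (Suc m, False) ` plain_overpartitions (Suc m) (n - Suc m) else {})"
  unfolding plain_overpartitions_def[of "Suc m" n] bounded_overpartitions_Suc
  by (auto simp: bounded_overpartitions_def plain_overpartitions_def)

lemma card_plain_overpartitions_Suc:
  "card (plain_overpartitions (Suc m) n) = card (bounded_overpartitions m n) +
     (if Suc m \<le> n then card (plain_overpartitions (Suc m) (n - Suc m)) else 0)"
proof -
  have "card (A \<union> Cons (Suc m, False) ` B) = card A + card B"
    if "A = bounded_overpartitions m n" "finite B" for A B
    by (subst card_Un_disjoint) (use that in \<open>auto simp: card_image bounded_overpartitions_def[of m n]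
      intro!: finite_subset[OF _ finite_overpartitions[of n]]\<close>)
  then show ?thesis
    by (subst plain_overpartitions_Suc) auto
qed

lemma card_bounded_overpartitions_Suc:
  "card (bounded_overpartitions (Suc m) n) = card (bounded_overpartitions m n) +
     (if Suc m \<le> n then 2 * card (plain_overpartitions (Suc m) (n - Suc m)) else 0)"
proof -
  have "card (A \<union> (Cons (Suc m, False) ` B \<union> Cons (Suc m, True) ` B)) = card A + 2 * card B"
    if "A = bounded_overpartitions m n" "finite B" for A B
  proof -
    have "card (Cons (Suc m, False) ` B \<union> Cons (Suc m, True) ` B) = 2 * card B"
      by (subst card_Un_disjoint) (use that in \<open>auto simp: card_image\<close>)
    moreover have "A \<inter> (Cons (Suc m, False) ` B \<union> Cons (Suc m, True) ` B) = {}"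
      using that by (auto simp: bounded_overpartitions_def)
    ultimately show ?thesis
      by (subst card_Un_disjoint) (use that in auto)
  qed
  then show ?thesis
    by (subst bounded_overpartitions_Suc) auto
qed

lemma card_bounded_le: "card (bounded_overpartitions m n) \<le> overpartitions n"
  unfolding overpartitions_def
  by (rule card_mono[OF finite_overpartitions]) (auto simp: bounded_overpartitions_def)

lemma card_bounded_eq: "n \<le> m \<Longrightarrow> card (bounded_overpartitions m n) = overpartitions n"
proof -
  assume "n \<le> m"
  have "fst x \<le> n" if "is_overpartition n xs" "x \<in> set xs" for x xs
    using that member_le_sum_list[of "fst x" "map fst xs"] by (simp add: is_overpartition_def)
  then have "bounded_overpartitions m n = {xs. is_overpartition n xs}"
    using \<open>n \<le> m\<close> by (fastforce simp: bounded_overpartitions_def)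
  then show ?thesis by (simp add: overpartitions_def)
qed

lemma sums_shift_power:
  fixes q :: complex
  assumes "(\<lambda>n. f n * q ^ n) sums S"
  shows "(\<lambda>n. (if M \<le> n then f (n - M) else 0) * q ^ n) sums (q ^ M * S)"
proof -
  have "(\<lambda>n. (if M \<le> n + M then f (n + M - M) else 0) * q ^ (n + M)) sums (q ^ M * S)"
    using sums_mult[OF assms, of "q ^ M"] by (simp add: power_add mult_ac)
  then show ?thesis
    by (subst (asm) sums_iff_shift) simp
qed

text \<open>With M = m + 1 and generating functions A (parts at most m), B (plain lists for M) and C
  (parts at most M), the two recursions read B = A + q^M B and C = A + 2 q^M B, hence C = A (1 +
  q^M)/(1 - q^M).\<close>

lemma bounded_overpartitions_sums:
  fixes q :: complex
  assumes "norm q < 1"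
  shows "summable (\<lambda>n. card (bounded_overpartitions m n) * norm q ^ n) \<and>
    (\<lambda>n. of_nat (card (bounded_overpartitions m n)) * q ^ n) sums (\<Prod>k<m. (1 + q ^ Suc k) / (1 - q ^ Suc k))"
proof (induction m)
  case 0
  have *: "(\<lambda>n. of_nat (card (bounded_overpartitions 0 n)) * z ^ n) sums 1" for z :: "'a :: real_normed_field"
    using sums_single[of 0 "\<lambda>n. z ^ n"]
    by (simp add: bounded_overpartitions_0 if_distrib if_distribR cong: if_cong)
  show ?case
    using *[of q] *[of "norm q", THEN sums_summable] by simp
next
  case (Suc m)
  define M where "M = Suc m"
  define x where "x = norm q"
  have x: "0 \<le> x" "x < 1" using assms by (auto simp: x_def)
  have xM: "x ^ M < 1" using x by (simp add: M_def power_less_one_iff del: power_Suc)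
  define a b c :: "nat \<Rightarrow> nat" where
    "a = (\<lambda>n. card (bounded_overpartitions m n))" and
    "b = (\<lambda>n. card (plain_overpartitions M n))" and
    "c = (\<lambda>n. card (bounded_overpartitions M n))"
  have b: "b n = a n + (if M \<le> n then b (n - M) else 0)" for n
    unfolding a_def b_def M_def by (rule card_plain_overpartitions_Suc)
  have c: "c n = a n + (if M \<le> n then 2 * b (n - M) else 0)" for n
    unfolding a_def b_def c_def M_def by (rule card_bounded_overpartitions_Suc)
  have suma: "summable (\<lambda>n. a n * x ^ n)" and
    sumsa: "(\<lambda>n. of_nat (a n) * q ^ n) sums (\<Prod>k<m. (1 + q ^ Suc k) / (1 - q ^ Suc k))"
    using Suc by (auto simp: a_def x_def)
  define S where "S = (\<Sum>n. a n * x ^ n)"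
  \<comment> \<open>Convergence of B must precede solving B = A + q^M B. The recursion bounds the
    partial sums P of \<open>b\<close> by P \<le> S + x^M P, since shifting the index only loses
    terms.\<close>
  have bd: "(\<Sum>n<K. b n * x ^ n) \<le> S / (1 - x ^ M)" for K
  proof -
    have "(\<Sum>n<K. b n * x ^ n) =
      (\<Sum>n<K. a n * x ^ n) + (\<Sum>n<K. (if M \<le> n then b (n - M) else 0) * x ^ n)"
      by (subst b) (simp add: sum.distrib algebra_simps)
    also have "(\<Sum>n<K. (if M \<le> n then b (n - M) else 0) * x ^ n) = (\<Sum>n\<in>{M..<K}. b (n - M) * x ^ n)"
      by (rule sum.mono_neutral_cong_right) auto
    also have "\<dots> = (\<Sum>n<K - M. b n * x ^ (n + M))"
      by (rule sum.reindex_bij_witness[of _ "\<lambda>n. n + M" "\<lambda>n. n - M"]) auto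
    also have "\<dots> \<le> (\<Sum>n<K. b n * x ^ (n + M))"
      by (rule sum_mono2) (use x in auto)
    also have "\<dots> = x ^ M * (\<Sum>n<K. b n * x ^ n)"
      by (simp add: sum_distrib_left power_add mult_ac)
    also have "(\<Sum>n<K. a n * x ^ n) \<le> S"
      unfolding S_def by (rule sum_le_suminf) (use suma x in auto)
    finally show ?thesis using xM by (simp add: field_simps)
  qed
  have sumb: "summable (\<lambda>n. b n * x ^ n)"
    by (rule summableI_nonneg_bounded[OF _ bd]) (use x in auto)
  have "summable (\<lambda>n. norm (of_nat (b n) * q ^ n))"
    using sumb by (simp add: norm_mult norm_power x_def)
  then have B: "(\<lambda>n. of_nat (b n) * q ^ n) sums (\<Sum>n. of_nat (b n) * q ^ n)" (is "_ sums ?B")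
    by (rule summable_sums[OF summable_norm_cancel])
  define B where "B = ?B"
  note B = B[folded B_def]
  have qM: "q ^ M \<noteq> 1"
    using xM by (metis norm_one norm_power x_def order_less_irrefl)
  define A where "A = (\<Prod>k<m. (1 + q ^ Suc k) / (1 - q ^ Suc k))"
  have "of_nat (b n) * q ^ n = of_nat (a n) * q ^ n + (if M \<le> n then of_nat (b (n - M)) else 0) * q ^ n" for n
    by (subst b) (simp add: distrib_right)
  then have "(\<lambda>n. of_nat (b n) * q ^ n) sums (A + q ^ M * B)"
    using sums_add[OF sumsa sums_shift_power[OF B, of M]] by (simp only: A_def)
  with B have "B = A + q ^ M * B"
    by (rule sums_unique2)
  then have BA: "B = A / (1 - q ^ M)"
    using qM by (simp add: field_simps)
  have "of_nat (c n) * q ^ n = of_nat (a n) * q ^ n + (if M \<le> n then 2 * of_nat (b (n - M)) else 0) * q ^ n" for n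
    by (subst c) (simp add: distrib_right)
  moreover have "(\<lambda>n. 2 * of_nat (b n) * q ^ n) sums (2 * B)"
    using sums_mult[OF B, of 2] by (simp add: mult.assoc)
  ultimately have "(\<lambda>n. of_nat (c n) * q ^ n) sums (A + q ^ M * (2 * B))"
    using sums_add[OF sumsa sums_shift_power[where f = "\<lambda>n. 2 * of_nat (b n)"]] by (simp only: A_def)
  also have "A + q ^ M * (2 * B) = A * ((1 + q ^ M) / (1 - q ^ M))"
    using qM unfolding BA by (simp add: field_simps)
  finally have 1: "(\<lambda>n. of_nat (c n) * q ^ n) sums (\<Prod>k<Suc m. (1 + q ^ Suc k) / (1 - q ^ Suc k))"
    by (simp add: A_def M_def)
  have "summable (\<lambda>n. 2 * b n * x ^ n)"
    using summable_mult[OF sumb, of 2] by (simp add: mult_ac)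
  then have "summable (\<lambda>n. c n * x ^ n)"
  proof (rule summable_comparison_test'[where N = 0])
    fix n
    have "c n \<le> 2 * b n" using b[of n] c[of n] by auto
    then show "norm (c n * x ^ n) \<le> real (2 * b n) * x ^ n"
      using x by (simp add: mult_right_mono)
  qed
  with 1 show ?case by (simp add: c_def M_def x_def)
qed

section \<open>The logarithm of the infinite product\<close>

text \<open>This is 2 artanh z, a holomorphic logarithm of (1 + z)/(1 - z) on the unit disc.\<close>

definition artanh2 :: "complex \<Rightarrow> complex" where
  "artanh2 z = Ln (1 + z) - Ln (1 - z)"

lemma one_plus_nonzero: "norm z < 1 \<Longrightarrow> 1 + z \<noteq> 0" "norm z < 1 \<Longrightarrow> 1 - z \<noteq> 0" for z :: complex
  by (metis add_eq_0_iff norm_minus_cancel norm_one order_less_irrefl) auto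

lemma exp_artanh2: "norm z < 1 \<Longrightarrow> exp (artanh2 z) = (1 + z) / (1 - z)"
  unfolding artanh2_def using one_plus_nonzero[of z] by (simp add: exp_diff)

text \<open>Even powers cancel between the two logarithmic series and odd ones double; summing the
  difference in consecutive pairs leaves one odd term per pair.\<close>

lemma artanh2_sums:
  assumes "norm z < 1"
  shows "(\<lambda>k. 2 * z ^ (2 * k + 1) / of_nat (2 * k + 1)) sums artanh2 z"
proof -
  have "(\<lambda>n. - ((-z) ^ n) / of_nat n - (- ((- (-z)) ^ n) / of_nat n)) sums (Ln (1 + z) - Ln (1 + (-z)))"
    by (intro sums_diff Ln_series') (use assms in auto)
  from sums_group[OF this, of 2]
  have "(\<lambda>k. sum (\<lambda>n. - ((-z) ^ n) / of_nat n - (- ((- (-z)) ^ n) / of_nat n)) {k * 2..<k * 2 + 2}) sums artanh2 z"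
    by (simp add: artanh2_def)
  moreover have "sum (\<lambda>n. - ((-z) ^ n) / of_nat n - (- ((- (-z)) ^ n) / of_nat n)) {k * 2..<k * 2 + 2} =
      2 * z ^ (2 * k + 1) / of_nat (2 * k + 1)" for k
  proof -
    have "{k * 2..<k * 2 + 2} = {2 * k, 2 * k + 1}" by auto
    then show ?thesis
      by (simp add: add_divide_distrib)
  qed
  ultimately show ?thesis by simp
qed

lemma artanh2_of_real_sums:
  fixes x :: real
  assumes "0 \<le> x" "x < 1"
  shows "(\<lambda>k. 2 * x ^ (2 * k + 1) / real (2 * k + 1)) sums Re (artanh2 (of_real x))"
proof -
  have "2 * of_real x ^ (2 * k + 1) / of_nat (2 * k + 1) =
      complex_of_real (2 * x ^ (2 * k + 1) / real (2 * k + 1))" for k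
    by simp
  then show ?thesis
    using sums_Re[OF artanh2_sums[of "of_real x"]] assms by simp
qed

text \<open>All series coefficients are nonnegative, so the triangle inequality bounds the tail
  after the linear term by its value at \<open>norm z\<close>. The linear term is kept apart because
  it will supply the gain away from the real axis.\<close>

lemma norm_artanh2_diff_le:
  assumes "norm z < 1"
  shows "norm (artanh2 z - 2 * z) \<le> Re (artanh2 (of_real (norm z))) - 2 * norm z"
proof -
  have 1: "(\<lambda>k. 2 * z ^ (2 * Suc k + 1) / of_nat (2 * Suc k + 1)) sums (artanh2 z - 2 * z)"
    by (subst sums_Suc_iff) (use artanh2_sums[OF assms] in simp)
  have 2: "(\<lambda>k. 2 * norm z ^ (2 * Suc k + 1) / real (2 * Suc k + 1)) sums (Re (artanh2 (of_real (norm z))) - 2 * norm z)"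
    by (subst sums_Suc_iff) (use artanh2_of_real_sums[OF _ assms] in simp)
  show ?thesis
    using norm_suminf_le[OF _ sums_summable[OF 2], of "\<lambda>k. 2 * z ^ (2 * Suc k + 1) / of_nat (2 * Suc k + 1)"]
      sums_unique[OF 1] sums_unique[OF 2]
    by (simp add: norm_mult norm_divide norm_power del: of_nat_Suc of_nat_add mult_Suc_right power_Suc)
qed

lemma norm_artanh2_le:
  assumes "norm z < 1"
  shows "norm (artanh2 z) \<le> 2 * norm z / (1 - norm z)"
proof -
  have g: "(\<lambda>k. 2 * norm z * norm z ^ k) sums (2 * norm z / (1 - norm z))"
    using sums_mult[OF geometric_sums[of "norm z"], of "2 * norm z"] assms by simp
  have "norm (2 * z ^ (2 * k + 1) / of_nat (2 * k + 1)) \<le> 2 * norm z * norm z ^ k" for k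
  proof -
    have "norm (2 * z ^ (2 * k + 1) / of_nat (2 * k + 1)) = 2 * norm z * (norm z ^ (2 * k) / real (2 * k + 1))"
      by (simp only: norm_mult norm_divide norm_power norm_of_nat norm_numeral power_add power_one_right) simp
    also have "norm z ^ (2 * k) / real (2 * k + 1) \<le> norm z ^ (2 * k) / 1"
      by (intro divide_left_mono) auto
    also have "norm z ^ (2 * k) / 1 \<le> norm z ^ k"
      using assms by (simp add: power_decreasing)
    finally show ?thesis by (simp add: mult_left_mono)
  qed
  from norm_suminf_le[OF this sums_summable[OF g]] show ?thesis
    using sums_unique[OF g] sums_unique[OF artanh2_sums[OF assms]] by simp
qed

text \<open>Summing logarithms of the factors fixes a branch of the logarithm of the product without
  a choice for the product itself.\<close>

definition log_gf :: "complex \<Rightarrow> complex" where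
  "log_gf q = (\<Sum>k. artanh2 (q ^ Suc k))"

lemma norm_artanh2_power_le:
  assumes "norm q \<le> r" "r < 1"
  shows "norm (artanh2 (q ^ Suc k)) \<le> 2 / (1 - r) * r ^ Suc k"
proof -
  have r: "0 \<le> r" using assms norm_ge_zero[of q] by linarith
  have le: "norm q ^ Suc k \<le> r ^ Suc k" "r ^ Suc k \<le> r ^ 1"
    using assms r power_decreasing[of 1 "Suc k" r] power_mono[of "norm q" r "Suc k"] by simp_all
  have "norm (artanh2 (q ^ Suc k)) \<le> 2 * norm q ^ Suc k / (1 - norm q ^ Suc k)"
    using norm_artanh2_le[of "q ^ Suc k"] le assms by (simp add: norm_power del: power_Suc)
  also have "\<dots> \<le> 2 * r ^ Suc k / (1 - r)"
    by (rule frac_le) (use le assms r in auto)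
  finally show ?thesis by simp
qed

lemma summable_norm_artanh2_power:
  assumes "norm q < 1"
  shows "summable (\<lambda>k. norm (artanh2 (q ^ Suc k)))"
proof (rule summable_comparison_test'[where N = 0])
  have "summable (\<lambda>k. norm q ^ Suc k)"
    by (subst summable_Suc_iff, rule summable_geometric) (use assms in simp)
  then show "summable (\<lambda>k. 2 / (1 - norm q) * norm q ^ Suc k)"
    by (rule summable_mult)
  show "norm (norm (artanh2 (q ^ Suc k))) \<le> 2 / (1 - norm q) * norm q ^ Suc k" for k
    using norm_artanh2_power_le[OF order_refl assms, of k] by simp
qed

lemma log_gf_sums: "norm q < 1 \<Longrightarrow> (\<lambda>k. artanh2 (q ^ Suc k)) sums log_gf q"
  unfolding log_gf_def
  by (rule summable_sums[OF summable_norm_cancel[OF summable_norm_artanh2_power]])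

lemma prod_tendsto_exp_log_gf:
  assumes "norm q < 1"
  shows "(\<lambda>m. \<Prod>k<m. (1 + q ^ Suc k) / (1 - q ^ Suc k)) \<longlonglongrightarrow> exp (log_gf q)"
proof -
  have "(\<lambda>m. exp (\<Sum>k<m. artanh2 (q ^ Suc k))) \<longlonglongrightarrow> exp (log_gf q)"
    using log_gf_sums[OF assms] unfolding sums_def by (rule tendsto_exp)
  moreover have "norm (q ^ Suc k) < 1" for k
    using assms by (simp add: norm_power power_less_one_iff del: power_Suc)
  ultimately show ?thesis
    by (simp add: exp_sum exp_artanh2 del: power_Suc)
qed

text \<open>Below degree N the counts agree with those for parts at most N, so partial sums are
  bounded by the finite products, which converge and hence are bounded.\<close>

lemma summable_overpartitions:
  fixes x :: real
  assumes "0 \<le> x" "x < 1"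
  shows "summable (\<lambda>n. overpartitions n * x ^ n)"
proof -
  let ?P = "\<lambda>m. \<Prod>k<m. (1 + of_real x ^ Suc k) / (1 - of_real x ^ Suc k) :: complex"
  have nx: "norm (of_real x :: complex) < 1" using assms by simp
  obtain K where K: "\<And>m. norm (?P m) \<le> K"
    using convergent_imp_Bseq[OF convergentI[OF prod_tendsto_exp_log_gf[OF nx]]]
    by (meson BseqE)
  show ?thesis
  proof (rule summableI_nonneg_bounded)
    fix N
    have 1: "summable (\<lambda>n. card (bounded_overpartitions N n) * x ^ n)"
      and 2: "(\<lambda>n. of_nat (card (bounded_overpartitions N n)) * of_real x ^ n) sums ?P N"
      using bounded_overpartitions_sums[OF nx, of N] assms by auto
    have "(\<Sum>n<N. overpartitions n * x ^ n) = (\<Sum>n<N. card (bounded_overpartitions N n) * x ^ n)"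
      by (intro sum.cong) (auto simp: card_bounded_eq)
    also have "\<dots> \<le> (\<Sum>n. card (bounded_overpartitions N n) * x ^ n)"
      by (rule sum_le_suminf[OF 1]) (use assms in auto)
    also have "\<dots> \<le> norm (of_real (\<Sum>n. card (bounded_overpartitions N n) * x ^ n) :: complex)"
      by simp
    also have "of_real (\<Sum>n. card (bounded_overpartitions N n) * x ^ n) = ?P N"
      using sums_unique2[OF sums_of_real[OF summable_sums[OF 1]]] 2 by simp
    finally show "(\<Sum>n<N. overpartitions n * x ^ n) \<le> K"
      using K[of N] by linarith
  qed (use assms in auto)
qed

text \<open>Tannery's theorem for m tending to infinity: each coefficient is eventually constant in
  m, and the overpartition series at \<open>norm q\<close> dominates.\<close>

lemma overpartitions_sums:
  assumes "norm q < 1"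
  shows "(\<lambda>n. of_nat (overpartitions n) * q ^ n) sums exp (log_gf q)"
proof -
  let ?a = "\<lambda>n m. of_nat (card (bounded_overpartitions m n)) * q ^ n"
  have sm: "summable (\<lambda>n. overpartitions n * norm q ^ n)"
    by (rule summable_overpartitions) (use assms in auto)
  have bd: "norm (?a n m) \<le> overpartitions n * norm q ^ n" for n m
    using card_bounded_le[of m n] by (simp add: norm_mult norm_power mult_right_mono)
  have lim: "(\<lambda>m. ?a n m) \<longlonglongrightarrow> of_nat (overpartitions n) * q ^ n" for n
    by (rule tendsto_eventually, rule eventually_sequentiallyI[of n]) (simp add: card_bounded_eq)
  have ev: "\<forall>\<^sub>F (n, m) in sequentially \<times>\<^sub>F sequentially. norm (?a n m) \<le> overpartitions n * norm q ^ n"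
    by (rule always_eventually) (use bd in auto)
  have "(\<lambda>m. \<Sum>n. ?a n m) \<longlonglongrightarrow> (\<Sum>n. of_nat (overpartitions n) * q ^ n)"
    by (rule tannerys_theorem[where a = ?a and F = sequentially, OF lim ev sm, THEN conjunct2, THEN conjunct2]) simp
  moreover have "(\<lambda>m. \<Sum>n. ?a n m) = (\<lambda>m. \<Prod>k<m. (1 + q ^ Suc k) / (1 - q ^ Suc k))"
    using bounded_overpartitions_sums[OF assms] by (auto simp: sums_iff simp del: power_Suc)
  ultimately have "(\<Sum>n. of_nat (overpartitions n) * q ^ n) = exp (log_gf q)"
    using LIMSEQ_unique[OF _ prod_tendsto_exp_log_gf[OF assms]] by metis
  moreover have "summable (\<lambda>n. of_nat (overpartitions n) * q ^ n)"
    by (rule summable_norm_cancel) (use sm in \<open>simp add: norm_mult norm_power\<close>)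
  ultimately show ?thesis by (simp add: sums_iff)
qed

text \<open>Only the linear terms of the series of \<^const>\<open>artanh2\<close> are compared with some gain.\<close>

lemma norm_exp_log_gf_le:
  assumes "norm q < 1"
  shows "norm (exp (log_gf q)) \<le> norm (exp (log_gf (of_real (norm q)))) *
           exp (2 * norm q / norm (1 - q) - 2 * norm q / (1 - norm q))"
proof -
  define r where "r = norm q"
  have r: "0 \<le> r" "r < 1" using assms by (auto simp: r_def)
  have pw: "norm (q ^ Suc k) < 1" for k
    using assms by (simp add: norm_power power_less_one_iff del: power_Suc)
  have 1: "(\<lambda>k. Re (artanh2 (q ^ Suc k))) sums Re (log_gf q)"
    by (rule sums_Re[OF log_gf_sums[OF assms]])
  have 2: "(\<lambda>k. Re (artanh2 (of_real r ^ Suc k))) sums Re (log_gf (of_real r))"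
    by (rule sums_Re[OF log_gf_sums]) (use r in auto)
  have 3: "(\<lambda>k. Re (q ^ Suc k)) sums Re (q * (1 / (1 - q)))"
    using sums_Re[OF sums_mult[OF geometric_sums[OF assms], of q]] by simp
  have 4: "(\<lambda>k. r ^ Suc k) sums (r * (1 / (1 - r)))"
    using sums_mult[OF geometric_sums[of r], of r] r by simp
  have "Re (artanh2 (q ^ Suc k)) \<le> Re (artanh2 (of_real r ^ Suc k)) - 2 * r ^ Suc k + 2 * Re (q ^ Suc k)" for k
  proof -
    have "Re (artanh2 (q ^ Suc k) - 2 * q ^ Suc k) \<le> norm (artanh2 (q ^ Suc k) - 2 * q ^ Suc k)"
      by (rule complex_Re_le_cmod)
    also have "\<dots> \<le> Re (artanh2 (of_real r ^ Suc k)) - 2 * r ^ Suc k"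
      using norm_artanh2_diff_le[OF pw[of k]] by (simp add: r_def norm_power norm_mult)
    finally show ?thesis by simp
  qed
  from sums_le[OF this 1 sums_add[OF sums_diff[OF 2 sums_mult[OF 4, of 2]] sums_mult[OF 3, of 2]]]
  have "Re (log_gf q) \<le> Re (log_gf (of_real r)) - 2 * (r * (1 / (1 - r))) + 2 * Re (q * (1 / (1 - q)))" .
  also have "Re (q * (1 / (1 - q))) \<le> norm (q * (1 / (1 - q)))"
    by (rule complex_Re_le_cmod)
  also have "norm (q * (1 / (1 - q))) = r / norm (1 - q)"
    by (simp add: norm_divide r_def)
  finally have "Re (log_gf q) \<le> Re (log_gf (of_real r)) + (2 * r / norm (1 - q) - 2 * r / (1 - r))"
    by simp
  then show ?thesis
    by (simp add: r_def flip: exp_add)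
qed

section \<open>The lattice sum of z / sinh z\<close>

text \<open>Derivatives of a periodic function have mean zero over a period, so on the real line a
  bound for one derivative also bounds the preceding one. The Cauchy bound for derivative m + 1 thus
  descends unchanged to the first derivative.\<close>

lemma periodic_holomorphic_half_diff:
  fixes V :: "complex \<Rightarrow> complex"
  assumes hol: "V holomorphic_on {z. \<bar>Im z\<bar> < R}"
    and per: "\<And>z. \<bar>Im z\<bar> < R \<Longrightarrow> V (z + 1) = V z"
    and bd: "\<And>z. \<bar>Im z\<bar> < R \<Longrightarrow> norm (V z) \<le> B"
    and r: "0 < r" "r < R"
  shows "norm (V (1 / 2) - V 0) \<le> fact (Suc m) * B / r ^ Suc m"
proof -
  define S where "S = {z. \<bar>Im z\<bar> < R}"
  define D where "D = (\<lambda>k. (deriv ^^ k) V)"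
  define b where "b = fact (Suc m) * B / r ^ Suc m"
  have S: "open S" "\<real> \<subseteq> S" "\<And>z. z + 1 \<in> S \<longleftrightarrow> z \<in> S"
    using r unfolding S_def by (auto intro!: open_Collect_less continuous_intros simp: complex_is_Real_iff)
  have der: "(D k has_field_derivative D (Suc k) z) (at z)" if "z \<in> S" for k z
    unfolding D_def funpow.simps o_def using hol that S(1) unfolding S_def[symmetric]
    by (intro holomorphic_derivI[of _ S] holomorphic_higher_deriv)
  have perD: "D k (z + 1) = D k z" if "z \<in> S" for k z
    using that
  proof (induction k arbitrary: z)
    case 0
    then show ?case using per by (simp add: D_def S_def)
  next
    case (Suc k)
    have "((\<lambda>w. D k (w + 1)) has_field_derivative D (Suc k) (z + 1)) (at z)"
      using der[of "z + 1" k] S Suc by (simp add: DERIV_shift)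
    then have "(D k has_field_derivative D (Suc k) (z + 1)) (at z)"
      by (rule has_field_derivative_transform_within_open[OF _ S(1) Suc.prems]) (rule Suc.IH)
    then show ?case
      using der[OF Suc.prems, of k] DERIV_unique by blast
  qed
  \<comment> \<open>The mean value estimate is applied to D k z - z D(k+1)(x) between x and x + 1.
    By periodicity the increment is just -D(k+1)(x), while its derivative D(k+1)(z) - D(k+1)(x) is
    at most c on that interval.\<close>
  have dec: "norm (D (Suc k) x) \<le> c" if c: "\<And>z. z \<in> \<real> \<Longrightarrow> norm (D (Suc (Suc k)) z) \<le> c" and x: "x \<in> \<real>" for k c x
  proof -
    have c0: "0 \<le> c" using c[of 0] norm_ge_zero[of "D (Suc (Suc k)) 0"] by (simp del: norm_ge_zero)
    have "norm ((D k (x + 1) - (x + 1) * D (Suc k) x) - (D k x - x * D (Suc k) x)) \<le> c * norm (x + 1 - x)"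
    proof (rule field_differentiable_bound[where S = "\<real> \<inter> cball x 1"])
      show "convex (\<real> \<inter> cball x 1 :: complex set)"
        by (intro convex_Int convex_cball) (auto simp: convex_def scaleR_conv_of_real)
      fix z assume z: "z \<in> \<real> \<inter> cball x 1"
      show "((\<lambda>z. D k z - z * D (Suc k) x) has_field_derivative D (Suc k) z - D (Suc k) x) (at z within \<real> \<inter> cball x 1)"
        using z S by (auto intro!: derivative_eq_intros has_field_derivative_at_within[OF der])
      have "norm (D (Suc k) z - D (Suc k) x) \<le> c * norm (z - x)"
        by (rule field_differentiable_bound[where S = \<real>, OF _ _ c])
           (use z x S in \<open>auto simp: convex_def scaleR_conv_of_real intro: has_field_derivative_at_within[OF der]\<close>)
      also have "\<dots> \<le> c * 1"
        using z c0 by (intro mult_left_mono) (auto simp: dist_norm norm_minus_commute)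
      finally show "norm (D (Suc k) z - D (Suc k) x) \<le> c" by simp
    qed (use x in \<open>auto simp: dist_norm\<close>)
    then show ?thesis
      using perD[of x k] x S by (auto simp: algebra_simps)
  qed
  have top: "norm (D (Suc m) z) \<le> b" if "z \<in> \<real>" for z
    unfolding D_def b_def
  proof (rule Cauchy_inequality)
    have sub: "cball z r \<subseteq> S"
    proof
      fix w assume "w \<in> cball z r"
      then have "\<bar>Im (z - w)\<bar> \<le> r"
        using abs_Im_le_cmod[of "z - w"] by (simp add: dist_norm)
      then show "w \<in> S" using that r by (auto simp: S_def complex_is_Real_iff)
    qed
    show "V holomorphic_on ball z r" "continuous_on (cball z r) V"
      using hol sub ball_subset_cball[of z r] unfolding S_def[symmetric]
      by (blast intro: holomorphic_on_subset holomorphic_on_imp_continuous_on)+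
    show "norm (V w) \<le> B" if "norm (z - w) = r" for w
      using that sub by (intro bd) (auto simp: S_def dist_norm)
  qed (use r in auto)
  have "norm (D (Suc (m - k)) z) \<le> b" if "z \<in> \<real>" "k \<le> m" for k z
    using that
  proof (induction k arbitrary: z)
    case 0
    then show ?case using top by simp
  next
    case (Suc k)
    have "Suc (m - k) = Suc (Suc (m - Suc k))" using Suc.prems by simp
    then show ?case using dec[of "m - Suc k" b z] Suc by simp
  qed
  from this[of _ m] have D1: "norm (D 1 z) \<le> b" if "z \<in> \<real>" for z
    using that by simp
  have "norm (D 0 (1 / 2) - D 0 0) \<le> b * norm (1 / 2 - 0 :: complex)"
    by (rule field_differentiable_bound[where S = \<real>, OF _ _ D1])
       (use S in \<open>auto simp: convex_def scaleR_conv_of_real intro: has_field_derivative_at_within[OF der[of _ 0, simplified]]\<close>)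
  moreover have "0 \<le> b"
    using D1[of 0] norm_ge_zero[of "D 1 0"] by (simp del: norm_ge_zero)
  ultimately have "norm (D 0 (1 / 2) - D 0 0) \<le> b" by simp
  then show ?thesis
    by (simp only: D_def b_def funpow_0)
qed

section \<open>The function z / sinh z around the real axis\<close>

definition x_sinh :: "complex \<Rightarrow> complex" where
  "x_sinh z = (if z = 0 then 1 else z / sinh z)"

text \<open>The zeros are the points i pi n, and 3 < pi. A sector widened by a strip is the shape
  that s z fills when s has argument at most 45 degrees and z is close to the real line.\<close>

lemma sinh_eq_0_complex:
  fixes w :: complex
  assumes "sinh w = 0" "\<bar>Im w\<bar> < \<bar>Re w\<bar> + 3"
  shows "w = 0"
proof -
  have "exp w = exp (- w)"
    using assms(1) by (simp add: sinh_field_def)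
  then have "exp (2 * w) = 1"
    by (metis exp_add exp_minus_inverse mult_2)
  then obtain n :: int where n: "Re w = 0" "Im w = of_int n * pi"
    by (auto simp: exp_eq_1)
  have "\<bar>real_of_int n\<bar> * pi < 3"
    using assms(2) n by (simp add: abs_mult)
  moreover have "n = 0 \<or> 1 * pi \<le> \<bar>real_of_int n\<bar> * pi"
    by (cases "n = 0") (auto simp del: mult_1)
  ultimately have "n = 0"
    using pi_gt3 by linarith
  with n show ?thesis by (simp add: complex_eq_iff)
qed

lemma x_sinh_minus: "x_sinh (- z) = x_sinh z"
  by (simp add: x_sinh_def)

lemma holomorphic_x_sinh: "x_sinh holomorphic_on {w. \<bar>Im w\<bar> < \<bar>Re w\<bar> + 3}" (is "_ holomorphic_on ?S")
proof -
  have d: "deriv sinh (0 :: complex) = 1"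
    by (rule DERIV_imp_deriv) (auto intro!: derivative_eq_intros)
  have "(\<lambda>z. if z = 0 then deriv sinh 0 else (sinh z - sinh 0) / (z - 0)) holomorphic_on (UNIV :: complex set)"
    by (rule pole_lemma_open) (auto intro!: holomorphic_intros simp: sinh_field_def[abs_def])
  then have "(\<lambda>z::complex. if z = 0 then 1 else sinh z / z) holomorphic_on UNIV"
    unfolding d by (simp cong: if_cong)
  then have "(\<lambda>z. inverse (if z = 0 then 1 else sinh z / z)) holomorphic_on ?S"
    using sinh_eq_0_complex by (intro holomorphic_on_inverse) (auto intro: holomorphic_on_subset)
  moreover have "(\<lambda>z::complex. inverse (if z = 0 then 1 else sinh z / z)) = x_sinh"
    by (auto simp: x_sinh_def)
  ultimately show ?thesis by simp
qed

lemma norm_sinh_ge: "norm (sinh w) \<ge> sinh \<bar>Re w\<bar>" for w :: complex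
proof -
  have "\<bar>norm (exp w) - norm (exp (- w))\<bar> \<le> norm (exp w - exp (- w))"
    by (rule norm_triangle_ineq3)
  moreover have "2 * sinh \<bar>Re w\<bar> \<le> \<bar>exp (Re w) - exp (- Re w)\<bar>"
    by (auto simp: sinh_field_def abs_if)
  ultimately show ?thesis
    by (simp add: sinh_field_def norm_divide)
qed

text \<open>Near the imaginary axis compactness suffices; the width 2 keeps the closed region inside
  the domain of holomorphy, which has width 3. Farther out, \<open>sinh\<close> grows like exp |Re
  w|, and half of this rate absorbs the factor w.\<close>

lemma x_sinh_bound:
  obtains C where "C > 0" "\<And>w. \<bar>Im w\<bar> \<le> \<bar>Re w\<bar> + 2 \<Longrightarrow> norm (x_sinh w) \<le> C * exp (- \<bar>Re w\<bar> / 2)"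
proof -
  define K where "K = {w. \<bar>Im w\<bar> \<le> \<bar>Re w\<bar> + 2} \<inter> {w. \<bar>Re w\<bar> \<le> 1}"
  have "closed K" unfolding K_def
    by (intro closed_Int closed_Collect_le continuous_intros)
  moreover have "norm w \<le> 4" if "w \<in> K" for w
    using that cmod_le[of w] by (auto simp: K_def)
  then have "bounded K" unfolding bounded_iff by blast
  ultimately have "compact K" by (simp add: compact_eq_bounded_closed)
  moreover have "continuous_on K x_sinh"
    by (rule holomorphic_on_imp_continuous_on[OF holomorphic_on_subset[OF holomorphic_x_sinh]]) (auto simp: K_def)
  ultimately have "bounded (x_sinh ` K)"
    using compact_continuous_image compact_imp_bounded by blast
  then obtain M where M: "M > 0" "\<And>w. w \<in> K \<Longrightarrow> norm (x_sinh w) \<le> M"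
    unfolding bounded_pos by blast
  \<comment> \<open>The first entry serves |Re w| \<le> 1. For a = |Re w| > 1, |w| \<le> 4 a and
    |sinh w| \<ge> exp a / 4 give 16 a exp(-a) = 32 (a/2) exp(-a) \<le> 32 exp(-a/2).\<close>
  define C where "C = max (M * exp (1 / 2)) 32"
  show ?thesis
  proof
    show "C > 0" by (simp add: C_def)
    fix w :: complex assume w: "\<bar>Im w\<bar> \<le> \<bar>Re w\<bar> + 2"
    show "norm (x_sinh w) \<le> C * exp (- \<bar>Re w\<bar> / 2)"
    proof (cases "\<bar>Re w\<bar> \<le> 1")
      case True
      then have "norm (x_sinh w) \<le> M * exp (1 / 2) * exp (- 1 / 2)"
        using M(2)[of w] w by (simp add: K_def exp_minus mult.assoc)
      also have "\<dots> \<le> C * exp (- \<bar>Re w\<bar> / 2)"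
        by (intro mult_mono) (use True M in \<open>auto simp: C_def\<close>)
      finally show ?thesis .
    next
      case False
      define a where "a = \<bar>Re w\<bar>"
      have a: "a > 1" using False by (simp add: a_def)
      have "exp (- a) * 2 \<le> exp a"
      proof -
        have "2 \<le> 1 + 2 * a" using a by simp
        also have "\<dots> \<le> exp (2 * a)" by (rule exp_ge_add_one_self)
        also have "\<dots> = exp a * exp a" by (simp flip: exp_add)
        finally show ?thesis by (simp add: exp_minus field_simps)
      qed
      then have sh: "exp a / 4 \<le> sinh a" by (simp add: sinh_field_def)
      have nw: "norm w \<le> 4 * a" using w a cmod_le[of w] by (auto simp: a_def)
      have "norm (sinh w) \<ge> exp a / 4" using norm_sinh_ge[of w] sh by (simp add: a_def)
      then have "norm w / norm (sinh w) \<le> 4 * a / (exp a / 4)"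
        using a nw by (intro frac_le) auto
      then have "norm (x_sinh w) \<le> 4 * a / (exp a / 4)"
        using a by (auto simp: x_sinh_def norm_divide a_def)
      also have "\<dots> = 32 * ((a / 2) * exp (- a))" by (simp add: exp_minus field_simps)
      also have "\<dots> \<le> 32 * (exp (a / 2) * exp (- a))"
        using exp_ge_add_one_self[of "a / 2"] by (intro mult_left_mono mult_right_mono) (linarith, auto)
      also have "\<dots> = 32 * exp (- a / 2)" by (simp flip: exp_add)
      also have "\<dots> \<le> C * exp (- \<bar>Re w\<bar> / 2)" by (simp add: C_def a_def)
      finally show ?thesis .
    qed
  qed
qed

text \<open>The product s Re z satisfies |Im| \<le> |Re|, and s Im z moves each coordinate by at
  most 1. The resulting loss of 1 in |Re (s z)| costs the factor exp(1/2).\<close>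

lemma x_sinh_sector_bound:
  obtains C where "C > 0" "\<And>s z. \<lbrakk>0 < Re s; \<bar>Im s\<bar> \<le> Re s; norm s * \<bar>Im z\<bar> < 1\<rbrakk> \<Longrightarrow>
    \<bar>Im (s * z)\<bar> < \<bar>Re (s * z)\<bar> + 3 \<and> norm (x_sinh (s * z)) \<le> C * exp (- Re s * \<bar>Re z\<bar> / 2)"
proof -
  obtain C where C: "C > 0" "\<And>w. \<bar>Im w\<bar> \<le> \<bar>Re w\<bar> + 2 \<Longrightarrow> norm (x_sinh w) \<le> C * exp (- \<bar>Re w\<bar> / 2)"
    by (rule x_sinh_bound) blast
  show ?thesis
  proof
    show "C * exp (1 / 2) > 0" using C by simp
    fix s z :: complex assume s: "0 < Re s" "\<bar>Im s\<bar> \<le> Re s" and z: "norm s * \<bar>Im z\<bar> < 1"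
    have 1: "\<bar>Im s * Im z\<bar> \<le> 1" "\<bar>Re s * Im z\<bar> \<le> 1"
      using mult_right_mono[OF abs_Im_le_cmod[of s], of "\<bar>Im z\<bar>"]
        mult_right_mono[OF abs_Re_le_cmod[of s], of "\<bar>Im z\<bar>"] z by (auto simp: abs_mult)
    have 2: "\<bar>Im s * Re z\<bar> \<le> Re s * \<bar>Re z\<bar>" "\<bar>Re s * Re z\<bar> = Re s * \<bar>Re z\<bar>"
      using s by (auto simp: abs_mult mult_right_mono)
    have 3: "\<bar>Im (s * z)\<bar> \<le> \<bar>Re (s * z)\<bar> + 2" "Re s * \<bar>Re z\<bar> - 1 \<le> \<bar>Re (s * z)\<bar>"
      using 1 2 by auto
    have "norm (x_sinh (s * z)) \<le> C * exp (- \<bar>Re (s * z)\<bar> / 2)"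
      by (rule C(2)[OF 3(1)])
    also have "\<dots> \<le> C * (exp (1 / 2) * exp (- Re s * \<bar>Re z\<bar> / 2))"
      using C(1) 3(2) by (intro mult_left_mono) (auto simp flip: exp_add)
    finally show "\<bar>Im (s * z)\<bar> < \<bar>Re (s * z)\<bar> + 3 \<and>
        norm (x_sinh (s * z)) \<le> C * exp (1 / 2) * exp (- Re s * \<bar>Re z\<bar> / 2)"
      using 3(1) by simp
  qed
qed

section \<open>Termwise differentiation and interchange of series\<close>

text \<open>For holomorphic terms, a local summable bound on the terms themselves also controls the
  series of derivatives.\<close>

lemma suminf_has_field_derivative:
  fixes f f' :: "nat \<Rightarrow> complex \<Rightarrow> complex"
  assumes S: "open S"
    and der: "\<And>n x. x \<in> S \<Longrightarrow> (f n has_field_derivative f' n x) (at x)"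
    and bd: "\<And>x. x \<in> S \<Longrightarrow> \<exists>d h. 0 < d \<and> summable (h :: nat \<Rightarrow> real) \<and>
       (\<forall>n. \<forall>y\<in>ball x d \<inter> S. norm (f n y) \<le> h n)"
    and x: "x \<in> S"
  shows "((\<lambda>z. \<Sum>n. f n z) has_field_derivative (\<Sum>n. f' n x)) (at x)"
proof -
  have "\<exists>g g'. \<forall>x \<in> S. ((\<lambda>n. f n x) sums g x) \<and> ((\<lambda>n. f' n x) sums g' x) \<and> (g has_field_derivative g' x) (at x)"
  proof (rule series_and_derivative_comparison_local[OF S der])
    fix x assume "x \<in> S"
    from bd[OF this] show "\<exists>d h. 0 < d \<and> summable (h :: nat \<Rightarrow> real) \<and>
       (\<forall>\<^sub>F n in sequentially. \<forall>y\<in>ball x d \<inter> S. norm (f n y) \<le> h n)"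
      using always_eventually by fastforce
  qed
  then obtain g g' where g: "\<And>x. x \<in> S \<Longrightarrow> (\<lambda>n. f n x) sums g x"
      "\<And>x. x \<in> S \<Longrightarrow> (\<lambda>n. f' n x) sums g' x" "\<And>x. x \<in> S \<Longrightarrow> (g has_field_derivative g' x) (at x)"
    by blast
  have "((\<lambda>z. \<Sum>n. f n z) has_field_derivative g' x) (at x)"
    by (rule has_field_derivative_transform_within_open[OF g(3)[OF x] S x]) (use g(1) sums_unique in blast)
  then show ?thesis
    using sums_unique[OF g(2)[OF x]] by simp
qed

text \<open>Fubini for iterated series, obtained by passing to the unordered sum over all pairs,
  where absolute summability can be transposed.\<close>

lemma suminf_swap:
  fixes f :: "nat \<Rightarrow> nat \<Rightarrow> 'a :: banach"
  assumes 1: "\<And>n. summable (\<lambda>k. norm (f n k))" and 2: "summable (\<lambda>n. \<Sum>k. norm (f n k))"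
  shows "(\<Sum>n. \<Sum>k. f n k) = (\<Sum>k. \<Sum>n. f n k)"
    and "summable (\<lambda>k. \<Sum>n. f n k)" "\<And>k. summable (\<lambda>n. norm (f n k))"
proof -
  have inf: "(\<Sum>\<^sub>\<infinity>k. g k) = (\<Sum>k. g k)" if "summable (\<lambda>k. norm (g k))" for g :: "nat \<Rightarrow> 'b :: banach"
    by (rule infsumI[OF norm_summable_imp_has_sum[OF that summable_sums[OF summable_norm_cancel[OF that]]]])
  have abs: "(\<lambda>x. norm (case x of (n, k) \<Rightarrow> f n k)) summable_on (UNIV \<times> UNIV)"
  proof (rule Infinite_Sum.abs_summable_on_Sigma_iff[THEN iffD2], intro conjI ballI)
    show "(\<lambda>y. norm (case (n, y) of (n, k) \<Rightarrow> f n k)) summable_on UNIV" for n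
      using norm_summable_imp_summable_on[of "\<lambda>k. norm (f n k)"] 1[of n] by simp
    have "norm (\<Sum>\<^sub>\<infinity>y. norm (case (n, y) of (n, k) \<Rightarrow> f n k)) = (\<Sum>k. norm (f n k))" for n
      using 1[of n] by (simp add: inf suminf_nonneg)
    then show "(\<lambda>n. norm (\<Sum>\<^sub>\<infinity>y. norm (case (n, y) of (n, k) \<Rightarrow> f n k))) summable_on UNIV"
      using norm_summable_imp_summable_on[of "\<lambda>n. \<Sum>k. norm (f n k)"] 1 2
      by (simp add: suminf_nonneg)
  qed
  then have sm: "(\<lambda>(n, k). f n k) summable_on (UNIV \<times> UNIV)"
    by (rule abs_summable_summable)
  have abs': "(\<lambda>x. norm (case x of (k, n) \<Rightarrow> f n k)) summable_on (UNIV \<times> UNIV)"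
  proof -
    have "(\<lambda>x. norm (case prod.swap x of (n, k) \<Rightarrow> f n k)) summable_on (UNIV \<times> UNIV)"
      using abs summable_on_reindex[of prod.swap "UNIV \<times> UNIV" "\<lambda>x. norm (case x of (n, k) \<Rightarrow> f n k)"]
      by (simp add: o_def product_swap)
    then show ?thesis by (simp add: case_prod_unfold)
  qed
  have c1: "(\<lambda>n. norm (f n k)) summable_on UNIV" for k
    using Infinite_Sum.abs_summable_on_Sigma_iff[THEN iffD1, OF abs'] by simp
  show c: "summable (\<lambda>n. norm (f n k))" for k
    using summable_on_imp_summable[OF c1[of k]] .
  have "(\<lambda>k. norm (\<Sum>\<^sub>\<infinity>n. norm (f n k))) summable_on UNIV"
    using Infinite_Sum.abs_summable_on_Sigma_iff[THEN iffD1, OF abs'] by simp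
  moreover have "norm (\<Sum>\<^sub>\<infinity>n. norm (f n k)) = (\<Sum>n. norm (f n k))" for k
    using c[of k] by (simp add: inf suminf_nonneg)
  ultimately have c2: "summable (\<lambda>k. \<Sum>n. norm (f n k))"
    using summable_on_imp_summable by simp
  have c3: "summable (\<lambda>k. norm (\<Sum>n. f n k))"
    by (rule summable_comparison_test'[OF c2]) (auto intro: summable_norm c)
  then show "summable (\<lambda>k. \<Sum>n. f n k)"
    by (rule summable_norm_cancel)
  have c4: "summable (\<lambda>n. norm (\<Sum>k. f n k))"
    by (rule summable_comparison_test'[OF 2]) (auto intro: summable_norm 1)
  show "(\<Sum>n. \<Sum>k. f n k) = (\<Sum>k. \<Sum>n. f n k)"
    using infsum_swap_banach[OF sm] by (simp add: inf 1 c c3 c4)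
qed

section \<open>One-sided lattice sums and their periodization\<close>

text \<open>At z = 1 the sum runs over the positive multiples of s; this value is -s times the
  logarithmic derivative of the generating function.\<close>

definition x_sinh_sum :: "complex \<Rightarrow> complex \<Rightarrow> complex" where
  "x_sinh_sum s z = (\<Sum>n. x_sinh (s * (of_nat n + z)))"

context
  fixes C :: real and s :: complex
  assumes C: "C > 0" "\<And>s z. \<lbrakk>0 < Re s; \<bar>Im s\<bar> \<le> Re s; norm s * \<bar>Im z\<bar> < 1\<rbrakk> \<Longrightarrow>
      \<bar>Im (s * z)\<bar> < \<bar>Re (s * z)\<bar> + 3 \<and> norm (x_sinh (s * z)) \<le> C * exp (- Re s * \<bar>Re z\<bar> / 2)"
    and s: "0 < Re s" "\<bar>Im s\<bar> \<le> Re s"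
begin

text \<open>Since |n + Re z| \<ge> n - M, a geometric majorant holds uniformly in a half plane, with
  the constant \<open>C\<close> independent of \<open>s\<close>.\<close>

lemma x_sinh_term_bound:
  assumes "norm s * \<bar>Im z\<bar> < 1" "- M \<le> Re z" "M \<ge> 0"
  shows "norm (x_sinh (s * (of_nat n + z))) \<le> C * exp (Re s * M / 2) * exp (- Re s / 2) ^ n"
proof -
  have "norm (x_sinh (s * (of_nat n + z))) \<le> C * exp (- Re s * \<bar>Re (of_nat n + z)\<bar> / 2)"
    using C(2)[OF s, of "of_nat n + z"] assms by simp
  also have "\<dots> \<le> C * exp (- Re s * (real n - M) / 2)"
    using C s assms by (auto intro!: mult_left_mono)
  also have "\<dots> = C * exp (Re s * M / 2) * exp (- Re s / 2) ^ n"
    by (simp flip: exp_of_nat_mult exp_add mult.assoc add: mult.assoc) (simp add: algebra_simps diff_divide_distrib)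
  finally show ?thesis .
qed

lemma summable_exp_neg: "summable (\<lambda>n. c * exp (- Re s / 2) ^ n)"
  using s by (intro summable_mult summable_geometric) auto

lemma summable_x_sinh:
  assumes "norm s * \<bar>Im z\<bar> < 1"
  shows "summable (\<lambda>n. norm (x_sinh (s * (of_nat n + z))))"
  using x_sinh_term_bound[OF assms, of "\<bar>Re z\<bar>"]
  by (intro summable_comparison_test'[OF summable_exp_neg[of "C * exp (Re s * \<bar>Re z\<bar> / 2)"], of 0]) auto

lemma x_sinh_sum_holomorphic: "x_sinh_sum s holomorphic_on {z. norm s * \<bar>Im z\<bar> < 1}" (is "_ holomorphic_on ?S")
proof -
  have op: "open ?S" by (intro open_Collect_less continuous_intros)
  have hol: "(\<lambda>z. x_sinh (s * (of_nat n + z))) holomorphic_on ?S" for n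
  proof -
    have "(x_sinh \<circ> (\<lambda>z. s * (of_nat n + z))) holomorphic_on ?S"
      by (rule holomorphic_on_compose_gen[OF _ holomorphic_x_sinh])
         (use C(2)[OF s, of "of_nat n + _"] in \<open>auto intro!: holomorphic_intros simp del: times_complex.sel\<close>)
    then show ?thesis by (simp add: o_def)
  qed
  have "(x_sinh_sum s has_field_derivative (\<Sum>n. deriv (\<lambda>z. x_sinh (s * (of_nat n + z))) x)) (at x)"
    if "x \<in> ?S" for x
    unfolding x_sinh_sum_def[abs_def]
  proof (rule suminf_has_field_derivative[OF op _ _ that])
    show "((\<lambda>z. x_sinh (s * (of_nat n + z))) has_field_derivative
        deriv (\<lambda>z. x_sinh (s * (of_nat n + z))) y) (at y)" if "y \<in> ?S" for n y
      by (rule holomorphic_derivI[OF hol op that])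
    fix x assume "x \<in> ?S"
    have "- (\<bar>Re x\<bar> + 1) \<le> Re y" if "y \<in> ball x 1" for y
      using that abs_Re_le_cmod[of "x - y"] by (auto simp: dist_norm)
    then have "\<forall>n. \<forall>y\<in>ball x 1 \<inter> ?S. norm (x_sinh (s * (of_nat n + y))) \<le>
        C * exp (Re s * (\<bar>Re x\<bar> + 1) / 2) * exp (- Re s / 2) ^ n"
      by (intro allI ballI x_sinh_term_bound) auto
    then show "\<exists>d h. 0 < d \<and> summable h \<and>
        (\<forall>n. \<forall>y\<in>ball x d \<inter> ?S. norm (x_sinh (s * (of_nat n + y))) \<le> h n)"
      using summable_exp_neg zero_less_one by blast
  qed
  then show ?thesis
    using holomorphic_on_open[OF op] by blast
qed

lemma x_sinh_sum_shift:
  assumes "norm s * \<bar>Im z\<bar> < 1"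
  shows "x_sinh_sum s (z + 1) = x_sinh_sum s z - x_sinh (s * z)"
  using suminf_split_head[OF summable_norm_cancel[OF summable_x_sinh[OF assms]]]
  by (simp add: x_sinh_sum_def algebra_simps)

text \<open>A geometric series of ratio exp(-t) with t = Re s / 2, where 1 - exp(-t) \<ge> t/2
  because t \<le> 1.\<close>

lemma x_sinh_sum_bound:
  assumes "norm s * \<bar>Im z\<bar> < 1" "0 \<le> Re z" "Re s \<le> 1"
  shows "norm (x_sinh_sum s z) \<le> 4 * C / Re s"
proof -
  define t where "t = Re s / 2"
  have t: "0 < t" "t \<le> 1" using s assms by (auto simp: t_def)
  have e: "exp (- t) \<le> 1 / (1 + t)"
    using exp_ge_add_one_self[of t] t by (simp add: exp_minus field_simps)
  have "1 / (1 + t) \<le> 1 - t / 2"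
    using t by (simp add: field_simps)
  with e have e': "t / 2 \<le> 1 - exp (- t)" by linarith
  have g: "(\<lambda>n. C * exp (- t) ^ n) sums (C * (1 / (1 - exp (- t))))"
    by (intro sums_mult geometric_sums) (use t in auto)
  have "norm (x_sinh (s * (of_nat n + z))) \<le> C * exp (- t) ^ n" for n
    using x_sinh_term_bound[OF assms(1), of 0 n] assms by (simp add: t_def)
  from norm_suminf_le[OF this sums_summable[OF g]]
  have "norm (x_sinh_sum s z) \<le> C * (1 / (1 - exp (- t)))"
    using sums_unique[OF g] by (simp add: x_sinh_sum_def)
  also have "\<dots> \<le> C * (1 / (t / 2))"
    using C e' t by (intro mult_left_mono divide_left_mono mult_pos_pos) auto
  finally show ?thesis by (simp add: t_def mult.commute)
qed

text \<open>The function \<^term>\<open>\<lambda>z. x_sinh_sum s z + x_sinh_sum s (1 - z)\<close> is the sum of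
  \<^term>\<open>x_sinh (s * (of_int n + z))\<close> over all integers; it is 1-periodic.\<close>

lemma x_sinh_sum_half_diff:
  assumes "Re s \<le> 1"
  shows "norm (2 * x_sinh_sum s (1 / 2) - (1 + 2 * x_sinh_sum s 1)) \<le> fact (Suc m) * 16 * C * 2 ^ Suc m * norm s ^ m"
proof -
  define V where "V = (\<lambda>z. x_sinh_sum s z + x_sinh_sum s (1 - z))"
  have s0: "s \<noteq> 0" using s by auto
  \<comment> \<open>The strip |Im z| < 1/|s| is as wide as the domain of holomorphy permits. Its
    width grows as s shrinks, and each use of Cauchy's estimate turns this into a power of
    s.\<close>
  define R where "R = 1 / norm s"
  have R: "R > 0" and Riff: "\<bar>t\<bar> < R \<longleftrightarrow> norm s * \<bar>t\<bar> < 1" for t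
    using s0 by (auto simp: R_def field_simps)
  have per: "V (z + 1) = V z" if "\<bar>Im z\<bar> < R" for z
    using x_sinh_sum_shift[of z] x_sinh_sum_shift[of "- z"] that x_sinh_minus[of "s * z"]
    by (simp add: V_def Riff)
  have perZ: "V (z + of_int k) = V z" if "\<bar>Im z\<bar> < R" for z k
  proof (induction k rule: int_induct[of _ 0])
    case (step1 i)
    then show ?case using per[of "z + of_int i"] that by (simp add: algebra_simps)
  next
    case (step2 i)
    then show ?case using per[of "z + of_int (i - 1)"] that by (simp add: algebra_simps)
  qed auto
  have "norm (V (1 / 2) - V 0) \<le> fact (Suc m) * (8 * C / Re s) / (R / 2) ^ Suc m"
  proof (rule periodic_holomorphic_half_diff[where V = V and R = R])
    show "V (z + 1) = V z" if "\<bar>Im z\<bar> < R" for z by (rule per[OF that])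
    have eq: "{z. \<bar>Im z\<bar> < R} = {z. norm s * \<bar>Im z\<bar> < 1}" by (simp add: Riff)
    have "(x_sinh_sum s \<circ> (\<lambda>z. 1 - z)) holomorphic_on {z. norm s * \<bar>Im z\<bar> < 1}"
      by (rule holomorphic_on_compose_gen[OF _ x_sinh_sum_holomorphic]) (auto intro!: holomorphic_intros)
    then show "V holomorphic_on {z. \<bar>Im z\<bar> < R}"
      unfolding V_def eq using x_sinh_sum_holomorphic by (auto intro!: holomorphic_intros simp: o_def)
    fix z assume z: "\<bar>Im z\<bar> < R"
    \<comment> \<open>The one-sided bounds need nonnegative real parts for both z and 1 - z, so the
      argument is first translated into the unit period.\<close>
    define z' where "z' = z + of_int (- \<lfloor>Re z\<rfloor>)"
    have z': "0 \<le> Re z'" "0 \<le> Re (1 - z')" "Im z' = Im z"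
      by (simp_all add: z'_def) linarith
    have "norm (V z') \<le> norm (x_sinh_sum s z') + norm (x_sinh_sum s (1 - z'))"
      unfolding V_def by (rule norm_triangle_ineq)
    also have "\<dots> \<le> 4 * C / Re s + 4 * C / Re s"
      by (intro add_mono x_sinh_sum_bound) (use z' z assms in \<open>auto simp: Riff\<close>)
    finally show "norm (V z) \<le> 8 * C / Re s"
      using perZ[OF z, of "- \<lfloor>Re z\<rfloor>"] by (simp add: z'_def)
  qed (use R in auto)
  \<comment> \<open>At 0 the first half still contains the central lattice point, where
    \<open>x_sinh\<close> equals 1.\<close>
  also have "V 0 = 1 + 2 * x_sinh_sum s 1"
    using x_sinh_sum_shift[of 0] by (simp add: V_def x_sinh_def)
  also have "V (1 / 2) = 2 * x_sinh_sum s (1 / 2)"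
    by (simp add: V_def)
  \<comment> \<open>One of the m + 1 powers of |s| pays for the bound 1/Re s, using |s| \<le> 2 Re s
    in the sector.\<close>
  also have "fact (Suc m) * (8 * C / Re s) / (R / 2) ^ Suc m = fact (Suc m) * 8 * C * 2 ^ Suc m * norm s ^ m * (norm s / Re s)"
    using s s0 by (simp add: R_def power_divide field_simps)
  also have "\<dots> \<le> fact (Suc m) * 8 * C * 2 ^ Suc m * norm s ^ m * 2"
    using C s cmod_le[of s] by (intro mult_left_mono) (auto simp: field_simps)
  finally show ?thesis by (simp add: algebra_simps)
qed

end

lemma x_sinh_sum_sums:
  assumes "0 < Re s" "\<bar>Im s\<bar> \<le> Re s" "Im z = 0"
  shows "(\<lambda>n. x_sinh (s * (of_nat n + z))) sums x_sinh_sum s z"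
proof -
  obtain C where "C > 0" "\<And>s z. \<lbrakk>0 < Re s; \<bar>Im s\<bar> \<le> Re s; norm s * \<bar>Im z\<bar> < 1\<rbrakk> \<Longrightarrow>
      \<bar>Im (s * z)\<bar> < \<bar>Re (s * z)\<bar> + 3 \<and> norm (x_sinh (s * z)) \<le> C * exp (- Re s * \<bar>Re z\<bar> / 2)"
    by (rule x_sinh_sector_bound) blast
  from summable_x_sinh[OF this assms(1,2), of z] show ?thesis
    unfolding x_sinh_sum_def by (intro summable_sums) (rule summable_norm_cancel, simp add: assms)
qed

text \<open>The positive multiples of s/2 split into the half-integral and the integral multiples of
  s.\<close>

lemma x_sinh_sum_halve:
  assumes s: "0 < Re s" "\<bar>Im s\<bar> \<le> Re s"
  shows "x_sinh_sum (s / 2) 1 = x_sinh_sum s (1 / 2) + x_sinh_sum s 1"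
proof -
  let ?f = "\<lambda>n. x_sinh (s / 2 * (of_nat n + 1))"
  have f: "(\<lambda>k. sum ?f {k * 2..<k * 2 + 2}) sums x_sinh_sum (s / 2) 1"
    by (intro sums_group x_sinh_sum_sums) (use s in auto)
  have "sum ?f {k * 2..<k * 2 + 2} = x_sinh (s * (of_nat k + 1 / 2)) + x_sinh (s * (of_nat k + 1))" for k
  proof -
    have "{k * 2..<k * 2 + 2} = {2 * k, 2 * k + 1}" by auto
    then show ?thesis by (simp add: algebra_simps add_divide_distrib)
  qed
  moreover have "(\<lambda>k. x_sinh (s * (of_nat k + 1 / 2)) + x_sinh (s * (of_nat k + 1))) sums
      (x_sinh_sum s (1 / 2) + x_sinh_sum s 1)"
    by (intro sums_add x_sinh_sum_sums) (use s in auto)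
  ultimately show ?thesis
    using f sums_unique2 by (simp only:) blast
qed

section \<open>The limit of the lattice sum at the origin\<close>

lemma x_sinh_real_bound:
  obtains C where "C > 0" "\<And>s t. \<lbrakk>0 < Re s; \<bar>Im s\<bar> \<le> Re s\<rbrakk> \<Longrightarrow> norm (x_sinh (s * of_real t)) \<le> C"
proof -
  obtain C where C: "C > 0" "\<And>s z. \<lbrakk>0 < Re s; \<bar>Im s\<bar> \<le> Re s; norm s * \<bar>Im z\<bar> < 1\<rbrakk> \<Longrightarrow>
      \<bar>Im (s * z)\<bar> < \<bar>Re (s * z)\<bar> + 3 \<and> norm (x_sinh (s * z)) \<le> C * exp (- Re s * \<bar>Re z\<bar> / 2)"
    by (rule x_sinh_sector_bound) blast
  have "norm (x_sinh (s * of_real t)) \<le> C" if "0 < Re s" "\<bar>Im s\<bar> \<le> Re s" for s t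
  proof -
    have "norm (x_sinh (s * of_real t)) \<le> C * exp (- Re s * \<bar>t\<bar> / 2)"
      using C(2)[OF that, of "of_real t"] by simp
    also have "\<dots> \<le> C * 1" using C(1) that by (intro mult_left_mono) auto
    finally show ?thesis by simp
  qed
  with C(1) show ?thesis by (rule that)
qed

lemma x_sinh_eq_exp:
  assumes "Re w > 0"
  shows "x_sinh w = 2 * w * exp (- w) / (1 - exp (- 2 * w))" "x_sinh w ^ 2 = 4 * w ^ 2 * exp (- 2 * w) / (1 - exp (- 2 * w)) ^ 2"
proof -
  have w0: "w \<noteq> 0" using assms by auto
  have "norm (exp (- 2 * w)) < 1" using assms by simp
  then have ne: "1 - exp (- 2 * w) \<noteq> 0"
    by (metis eq_iff_diff_eq_0 norm_one order_less_irrefl)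
  have "sinh w = (1 - exp (- 2 * w)) / (2 * exp (- w))"
  proof -
    have "exp (- 2 * w) = exp (- w) * exp (- w)" by (simp flip: exp_add)
    then show ?thesis by (simp add: sinh_field_def exp_minus field_simps)
  qed
  then show "x_sinh w = 2 * w * exp (- w) / (1 - exp (- 2 * w))"
    using w0 ne by (simp add: x_sinh_def)
  then show "x_sinh w ^ 2 = 4 * w ^ 2 * exp (- 2 * w) / (1 - exp (- 2 * w)) ^ 2"
    by (simp add: power_divide power_mult_distrib flip: exp_of_nat_mult)
qed

text \<open>Expanding 1/sinh geometrically gives a double series; summing it over the multiples of s
  first turns the sums of n x^n into squares of \<open>x_sinh\<close>. In this form the limit at s =
  0 can be taken term by term, since the weights 2/(2j+1)^2 are summable by themselves.\<close>

lemma x_sinh_sum_dual: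
  assumes s: "0 < Re s" "\<bar>Im s\<bar> \<le> Re s"
  shows "s * x_sinh_sum s 1 = (\<Sum>j. 2 / (2 * of_nat j + 1)\<^sup>2 * x_sinh (s * of_real ((2 * real j + 1) / 2)) ^ 2)"
proof -
  define f :: "nat \<Rightarrow> nat \<Rightarrow> complex" where
    "f = (\<lambda>n j. 2 * s\<^sup>2 * of_nat (Suc n) * (exp (- s * of_nat (Suc n)) * exp (- 2 * s * of_nat (Suc n)) ^ j))"
  define g :: "nat \<Rightarrow> real" where "g = (\<lambda>n. 2 * norm s ^ 2 * real (Suc n) * exp (- Re s * real (Suc n)))"
  define h :: "nat \<Rightarrow> real" where "h = (\<lambda>n. exp (- 2 * Re s * real (Suc n)))"
  have nf: "norm (f n j) = g n * h n ^ j" for n j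
    by (simp add: f_def g_def h_def norm_mult norm_power del: of_nat_Suc)
  have h: "0 < h n" "h n < 1" "h n \<le> h 0" for n
    using s by (auto simp: h_def mult_pos_pos)
  have sg: "(\<lambda>j. g n * h n ^ j) sums (g n * (1 / (1 - h n)))" for n
    by (intro sums_mult geometric_sums) (use h[of n] in auto)
  have 1: "summable (\<lambda>j. norm (f n j))" for n
    using sums_summable[OF sg[of n]] by (simp add: nf)
  have g0: "0 \<le> g n" for n by (simp add: g_def)
  have "summable (\<lambda>n. of_nat (Suc n) * exp (- Re s) ^ n)"
    by (rule sums_summable[OF geometric_deriv_sums]) (use s in simp)
  then have "summable (\<lambda>n. 2 * norm s ^ 2 * exp (- Re s) * (of_nat (Suc n) * exp (- Re s) ^ n))"
    by (rule summable_mult)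
  moreover have "2 * norm s ^ 2 * exp (- Re s) * (of_nat (Suc n) * exp (- Re s) ^ n) = g n" for n
  proof -
    have "exp (- Re s * real (Suc n)) = exp (- Re s) * exp (- Re s) ^ n"
      by (simp add: algebra_simps flip: exp_of_nat_mult exp_add)
    then show ?thesis by (simp add: g_def)
  qed
  ultimately have "summable g" by (simp only:)
  then have "summable (\<lambda>n. 1 / (1 - h 0) * g n)" by (rule summable_mult)
  then have 2: "summable (\<lambda>n. \<Sum>j. norm (f n j))"
  proof (rule summable_comparison_test'[where N = 0])
    fix n
    have "g n * (1 / (1 - h n)) \<le> g n * (1 / (1 - h 0))"
      using h[of n] h[of 0] g0[of n] by (intro mult_left_mono divide_left_mono mult_pos_pos) auto
    moreover have "(\<Sum>j. norm (f n j)) = g n * (1 / (1 - h n))"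
      using sums_unique[OF sg[of n]] by (simp add: nf)
    moreover have "0 \<le> g n * (1 / (1 - h n))" using g0[of n] h[of n] by simp
    ultimately show "norm (\<Sum>j. norm (f n j)) \<le> 1 / (1 - h 0) * g n"
      by (simp only: real_norm_def abs_of_nonneg mult.commute)
  qed
  have row: "(\<Sum>j. f n j) = s * x_sinh (s * (of_nat n + 1))" for n
  proof -
    define w where "w = s * of_nat (Suc n)"
    have w: "Re w > 0" using s by (simp add: w_def del: of_nat_Suc)
    have "(\<lambda>j. 2 * s * w * exp (- w) * exp (- 2 * w) ^ j) sums (2 * s * w * exp (- w) * (1 / (1 - exp (- 2 * w))))"
      by (intro sums_mult geometric_sums) (use w in simp)
    moreover have "f n j = 2 * s * w * exp (- w) * exp (- 2 * w) ^ j" for j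
    proof -
      have "- s * of_nat (Suc n) = - w" "- 2 * s * of_nat (Suc n) = - 2 * w"
        by (simp_all add: w_def del: of_nat_Suc)
      then show ?thesis
        unfolding f_def by (simp only:) (simp add: w_def power2_eq_square del: of_nat_Suc)
    qed
    ultimately have "(\<Sum>j. f n j) = 2 * s * w * exp (- w) * (1 / (1 - exp (- 2 * w)))"
      by (simp only: sums_iff)
    also have "\<dots> = s * x_sinh w"
      by (simp add: x_sinh_eq_exp(1)[OF w])
    finally show ?thesis by (simp add: w_def add_ac)
  qed
  have col: "(\<Sum>n. f n j) = 2 / (2 * of_nat j + 1)\<^sup>2 * x_sinh (s * of_real ((2 * real j + 1) / 2)) ^ 2" for j
  proof -
    define w where "w = s * of_real ((2 * real j + 1) / 2)"
    have w: "Re w > 0" using s by (simp add: w_def)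
    have w2: "2 * w = s * (2 * of_nat j + 1)" by (simp add: w_def)
    have nz: "2 * of_nat j + 1 \<noteq> (0 :: complex)"
      using of_nat_neq_0[of "2 * j", where ?'a = complex] by (simp add: add.commute)
    have ex: "exp (- s * of_nat (Suc n)) * exp (- 2 * s * of_nat (Suc n)) ^ j = exp (- 2 * w) ^ Suc n" for n
    proof -
      have w': "- 2 * w = - (s * (2 * of_nat j + 1))" using w2 by simp
      have "exp (- 2 * w) ^ Suc n = exp (of_nat (Suc n) * (- (s * (2 * of_nat j + 1))))"
        unfolding w' by (simp only: exp_of_nat_mult)
      also have "\<dots> = exp (- s * of_nat (Suc n) + of_nat j * (- 2 * s * of_nat (Suc n)))"
        by (simp add: algebra_simps)
      finally show ?thesis by (simp only: exp_add exp_of_nat_mult)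
    qed
    have "(\<lambda>n. 2 * s\<^sup>2 * exp (- 2 * w) * (of_nat (Suc n) * exp (- 2 * w) ^ n)) sums
        (2 * s\<^sup>2 * exp (- 2 * w) * (1 / (1 - exp (- 2 * w))\<^sup>2))"
      by (intro sums_mult geometric_deriv_sums) (use w in simp)
    then have "(\<Sum>n. f n j) = 2 * s\<^sup>2 * exp (- 2 * w) * (1 / (1 - exp (- 2 * w))\<^sup>2)"
      unfolding f_def ex by (simp add: sums_iff mult_ac del: of_nat_Suc)
    also have "s = 2 * w / (2 * of_nat j + 1)"
      using w2 nz by (simp add: field_simps)
    finally show ?thesis
      unfolding x_sinh_eq_exp(2)[OF w, folded w_def] w_def[symmetric]
      by (simp add: power_divide power_mult_distrib mult_ac)
  qed
  have "s * x_sinh_sum s 1 = (\<Sum>n. s * x_sinh (s * (of_nat n + 1)))"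
    unfolding x_sinh_sum_def
    by (rule suminf_mult[symmetric]) (rule sums_summable[OF x_sinh_sum_sums], use s in auto)
  also have "\<dots> = (\<Sum>j. \<Sum>n. f n j)"
    using suminf_swap(1)[OF 1 2] by (simp add: row)
  finally show ?thesis by (simp add: col)
qed

text \<open>The even terms are a quarter of the full sum pi^2/6, which leaves 2 (pi^2/6 -
  pi^2/24).\<close>

lemma odd_inverse_squares_sums: "(\<lambda>j. 2 / (2 * real j + 1)\<^sup>2) sums (pi\<^sup>2 / 4)"
proof -
  have a: "(\<lambda>n. 1 / (real n + 1)\<^sup>2) sums (pi\<^sup>2 / 6)"
    using inverse_squares_sums by (simp add: add_ac)
  have b: "(\<lambda>k. sum (\<lambda>n. 1 / (real n + 1)\<^sup>2) {k * 2..<k * 2 + 2}) sums (pi\<^sup>2 / 6)"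
    by (rule sums_group[OF a]) simp
  have "sum (\<lambda>n. 1 / (real n + 1)\<^sup>2) {k * 2..<k * 2 + 2} = 1 / (2 * real k + 1)\<^sup>2 + 1 / 4 * (1 / (real k + 1)\<^sup>2)" for k
  proof -
    have "{k * 2..<k * 2 + 2} = {2 * k, 2 * k + 1}" by auto
    moreover have "(2 * real k + 2)\<^sup>2 = 4 * (real k + 1)\<^sup>2" by (simp add: power2_eq_square algebra_simps)
    ultimately show ?thesis by (simp add: add_ac)
  qed
  with b have "(\<lambda>k. 1 / (2 * real k + 1)\<^sup>2 + 1 / 4 * (1 / (real k + 1)\<^sup>2)) sums (pi\<^sup>2 / 6)"
    by simp
  from sums_mult[OF sums_diff[OF this sums_mult[OF a, of "1 / 4"]], of 2] show ?thesis
    by simp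
qed

text \<open>Tannery's theorem for the dual series with majorant 2 C^2/(2j+1)^2; each term tends to
  its weight as \<open>x_sinh\<close> is continuous with value 1 at 0.\<close>

lemma x_sinh_sum_tendsto:
  assumes s: "0 < Re s" "\<bar>Im s\<bar> \<le> Re s"
  shows "(\<lambda>i. s / 2 ^ i * (1 + 2 * x_sinh_sum (s / 2 ^ i) 1)) \<longlonglongrightarrow> of_real (pi\<^sup>2 / 2)"
proof -
  define t where "t = (\<lambda>i::nat. s / 2 ^ i)"
  have t: "0 < Re (t i)" "\<bar>Im (t i)\<bar> \<le> Re (t i)" for i
  proof -
    have "t i = s * of_real (1 / 2 ^ i)" by (simp add: t_def)
    then show "0 < Re (t i)" "\<bar>Im (t i)\<bar> \<le> Re (t i)"
      using s by (auto simp: abs_mult divide_right_mono)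
  qed
  have t0: "t \<longlonglongrightarrow> 0"
  proof -
    have "(\<lambda>i. s * (1 / 2) ^ i) \<longlonglongrightarrow> s * 0"
      by (intro tendsto_mult_left LIMSEQ_power_zero) (simp add: norm_divide)
    then show ?thesis by (simp add: t_def power_divide)
  qed
  obtain C where C: "C > 0" "\<And>s t. \<lbrakk>0 < Re s; \<bar>Im s\<bar> \<le> Re s\<rbrakk> \<Longrightarrow> norm (x_sinh (s * of_real t)) \<le> C"
    by (rule x_sinh_real_bound) blast
  let ?a = "\<lambda>j i. 2 / (2 * of_nat j + 1)\<^sup>2 * x_sinh (t i * of_real ((2 * real j + 1) / 2)) ^ 2"
  have no: "norm (2 / (2 * of_nat j + 1)\<^sup>2 :: complex) = 2 / (2 * real j + 1)\<^sup>2" for j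
  proof -
    have "2 / (2 * of_nat j + 1)\<^sup>2 = complex_of_real (2 / (2 * real j + 1)\<^sup>2)" by simp
    then show ?thesis by (simp only: norm_of_real) simp
  qed
  have ev: "\<forall>\<^sub>F (j, i) in sequentially \<times>\<^sub>F sequentially. norm (?a j i) \<le> 2 / (2 * real j + 1)\<^sup>2 * C\<^sup>2"
  proof (rule always_eventually, clarify)
    fix j i
    show "norm (?a j i) \<le> 2 / (2 * real j + 1)\<^sup>2 * C\<^sup>2"
      unfolding norm_mult no norm_power
      by (intro mult_left_mono power_mono C(2) t) auto
  qed
  have "isCont x_sinh 0"
  proof -
    have op: "open {w. \<bar>Im w\<bar> < \<bar>Re w\<bar> + 3}" by (intro open_Collect_less continuous_intros)
    show ?thesis
      by (rule continuous_on_interior[OF holomorphic_on_imp_continuous_on[OF holomorphic_x_sinh]])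
         (simp add: interior_open[OF op])
  qed
  then have lim: "(\<lambda>i. ?a j i) \<longlonglongrightarrow> 2 / (2 * of_nat j + 1)\<^sup>2" for j
  proof -
    have "(\<lambda>i. t i * of_real ((2 * real j + 1) / 2)) \<longlonglongrightarrow> 0 * of_real ((2 * real j + 1) / 2)"
      by (intro tendsto_mult_right t0)
    then have "(\<lambda>i. x_sinh (t i * of_real ((2 * real j + 1) / 2))) \<longlonglongrightarrow> x_sinh 0"
      by (intro isCont_tendsto_compose[OF \<open>isCont x_sinh 0\<close>]) simp
    then have "(\<lambda>i. ?a j i) \<longlonglongrightarrow> 2 / (2 * of_nat j + 1)\<^sup>2 * x_sinh 0 ^ 2"
      by (intro tendsto_intros)
    then show ?thesis by (simp add: x_sinh_def)
  qed
  have sm: "summable (\<lambda>j. 2 / (2 * real j + 1)\<^sup>2 * C\<^sup>2)"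
    by (rule summable_mult2[OF sums_summable[OF odd_inverse_squares_sums]])
  have "(\<lambda>i. \<Sum>j. ?a j i) \<longlonglongrightarrow> (\<Sum>j. 2 / (2 * of_nat j + 1)\<^sup>2)"
    by (rule tannerys_theorem[where a = ?a and F = sequentially, OF lim ev sm, THEN conjunct2, THEN conjunct2]) simp
  also have "(\<Sum>j. 2 / (2 * of_nat j + 1)\<^sup>2) = complex_of_real (pi\<^sup>2 / 4)"
    using sums_of_real[OF odd_inverse_squares_sums, where 'a = complex] by (simp add: sums_iff)
  also have "(\<lambda>i. \<Sum>j. ?a j i) = (\<lambda>i. t i * x_sinh_sum (t i) 1)"
    using x_sinh_sum_dual[OF t] by simp
  finally have "(\<lambda>i. t i + 2 * (t i * x_sinh_sum (t i) 1)) \<longlonglongrightarrow> 0 + 2 * complex_of_real (pi\<^sup>2 / 4)"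
    by (intro tendsto_intros t0)
  then show ?thesis
    by (simp add: t_def algebra_simps)
qed

text \<open>For a(s) = s (1 + 2 \<open>x_sinh_sum s 1\<close>), the halving identity makes a(s/2) -
  a(s) equal to s/2 times the difference of the periodic sum between 1/2 and 0. These increments
  along s/2^i add up to O(|s|^(m+1)), and the limit of a is known.\<close>

lemma x_sinh_sum_asymp:
  obtains K where "K > 0" "\<And>s. \<lbrakk>0 < Re s; \<bar>Im s\<bar> \<le> Re s; Re s \<le> 1\<rbrakk> \<Longrightarrow>
     norm (s * (1 + 2 * x_sinh_sum s 1) - of_real (pi\<^sup>2 / 2)) \<le> K * norm s ^ Suc m"
proof -
  obtain C where C: "C > 0" "\<And>s z. \<lbrakk>0 < Re s; \<bar>Im s\<bar> \<le> Re s; norm s * \<bar>Im z\<bar> < 1\<rbrakk> \<Longrightarrow>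
      \<bar>Im (s * z)\<bar> < \<bar>Re (s * z)\<bar> + 3 \<and> norm (x_sinh (s * z)) \<le> C * exp (- Re s * \<bar>Re z\<bar> / 2)"
    by (rule x_sinh_sector_bound) blast
  define K where "K = fact (Suc m) * 16 * C * 2 ^ Suc m"
  have K: "K > 0" using C by (simp add: K_def)
  have main: "norm (s * (1 + 2 * x_sinh_sum s 1) - of_real (pi\<^sup>2 / 2)) \<le> K * norm s ^ Suc m"
    if s: "0 < Re s" "\<bar>Im s\<bar> \<le> Re s" "Re s \<le> 1" for s
  proof -
    define t where "t = (\<lambda>i::nat. s / 2 ^ i)"
    have t_eq: "t i = s * of_real (1 / 2 ^ i)" for i by (simp add: t_def)
    have le1: "1 / 2 ^ i \<le> (1 :: real)" for i :: nat by simp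
    have t: "0 < Re (t i)" "\<bar>Im (t i)\<bar> \<le> Re (t i)" "Re (t i) \<le> 1" for i
      using s mult_mono[OF s(3) le1[of i]] unfolding t_eq by (auto simp: abs_mult divide_right_mono)
    define a where "a = (\<lambda>i. t i * (1 + 2 * x_sinh_sum (t i) 1))"
    have lim: "a \<longlonglongrightarrow> of_real (pi\<^sup>2 / 2)"
      using x_sinh_sum_tendsto[OF s(1,2)] by (simp add: a_def t_def)
    have step: "norm (a (Suc i) - a i) \<le> K * norm s ^ Suc m * ((1 / 2) ^ i - (1 / 2) ^ Suc i)" for i
    proof -
      have ts: "t (Suc i) = t i / 2" by (simp add: t_def)
      have "a (Suc i) - a i = t i / 2 * (2 * x_sinh_sum (t i) (1 / 2) - (1 + 2 * x_sinh_sum (t i) 1))"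
        unfolding a_def ts x_sinh_sum_halve[OF t(1,2)] by (simp add: field_simps)
      also have "norm \<dots> \<le> norm (t i) / 2 * (K * norm (t i) ^ m)"
        unfolding norm_mult norm_divide norm_numeral K_def
        by (intro mult_left_mono x_sinh_sum_half_diff[OF C t]) auto
      also have "\<dots> = K / 2 * norm (t i) ^ Suc m" by simp
      also have "norm (t i) ^ Suc m = norm s ^ Suc m * (1 / 2 ^ i) ^ Suc m"
        by (simp add: t_eq norm_mult norm_divide norm_power power_mult_distrib power_divide)
      \<comment> \<open>A single factor 2^(-i) out of the available power is kept; it is written as
        a difference so that the increments telescope.\<close>
      also have "K / 2 * (norm s ^ Suc m * (1 / 2 ^ i) ^ Suc m) \<le> K / 2 * (norm s ^ Suc m * (1 / 2 ^ i) ^ 1)"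
        using K le1 by (intro mult_left_mono power_decreasing) auto
      also have "\<dots> = K * norm s ^ Suc m * ((1 / 2) ^ i - (1 / 2) ^ Suc i)"
      proof -
        have "(1 / 2 :: real) ^ i - (1 / 2) ^ Suc i = (1 / 2) * (1 / 2 ^ i) ^ 1"
          by (simp add: power_divide)
        then show ?thesis by simp
      qed
      finally show ?thesis .
    qed
    have tele: "norm (a i - a 0) \<le> K * norm s ^ Suc m * (1 - (1 / 2) ^ i)" for i
    proof (induction i)
      case (Suc i)
      have "norm (a (Suc i) - a 0) \<le> norm (a (Suc i) - a i) + norm (a i - a 0)"
        using norm_triangle_ineq[of "a (Suc i) - a i" "a i - a 0"] by simp
      also have "\<dots> \<le> K * norm s ^ Suc m * ((1 / 2) ^ i - (1 / 2) ^ Suc i) + K * norm s ^ Suc m * (1 - (1 / 2) ^ i)"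
        by (intro add_mono step Suc)
      also have "\<dots> = K * norm s ^ Suc m * (1 - (1 / 2) ^ Suc i)" by (simp only: flip: distrib_left) simp
      finally show ?case .
    qed simp
    have "norm (a i - a 0) \<le> K * norm s ^ Suc m * 1" for i
      by (rule order_trans[OF tele mult_left_mono]) (use K in auto)
    then have "norm (of_real (pi\<^sup>2 / 2) - a 0) \<le> K * norm s ^ Suc m"
      by (intro Lim_norm_ubound[OF _ tendsto_diff[OF lim tendsto_const]]) (auto simp del: power_Suc)
    then show ?thesis
      by (simp add: a_def t_def norm_minus_commute del: power_Suc)
  qed
  from K main show ?thesis by (rule that)
qed

section \<open>The generating function near the dominant singularity\<close>

definition sector :: "complex set" where
  "sector = {s. 0 < Re s \<and> \<bar>Im s\<bar> \<le> Re s \<and> norm s \<le> 1}"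

text \<open>A derivative of size O(|s|^N) on a convex sector forces a limit at the vertex,
  approached at rate |s|^(N+1). The limit along 1/(k+1) is exported as well, because it allows D to
  be shown nonzero.\<close>

lemma sector_limit:
  fixes E E' :: "complex \<Rightarrow> complex"
  assumes der: "\<And>s. s \<in> sector \<Longrightarrow> (E has_field_derivative E' s) (at s)"
    and bd: "\<And>s. s \<in> sector \<Longrightarrow> norm (E' s) \<le> K * norm s ^ N" and K: "K \<ge> 0"
  obtains D where "\<And>s. s \<in> sector \<Longrightarrow> norm (E s - D) \<le> 2 * K * norm s ^ Suc N"
    "(\<lambda>k. E (of_real (1 / real (Suc k)))) \<longlonglongrightarrow> D"
proof -
  \<comment> \<open>Cutting the sector with a disc of radius \<open>\<rho>\<close> keeps it convex
    and bounds the derivative by K \<open>\<rho>\<close>^N on the whole segment.\<close>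
  have lip: "norm (E s - E s') \<le> K * \<rho> ^ N * norm (s - s')"
    if "s \<in> sector" "s' \<in> sector" "norm s \<le> \<rho>" "norm s' \<le> \<rho>" for s s' \<rho>
  proof (rule field_differentiable_bound[where S = "{s. 0 < Re s} \<inter> {s. \<bar>Im s\<bar> \<le> Re s} \<inter> cball 0 1 \<inter> cball 0 \<rho>"])
    have "convex {s. \<bar>Im s\<bar> \<le> Re s}"
    proof (rule convexI)
      fix x y :: complex and u v :: real
      assume xy: "x \<in> {s. \<bar>Im s\<bar> \<le> Re s}" "y \<in> {s. \<bar>Im s\<bar> \<le> Re s}" and uv: "0 \<le> u" "0 \<le> v"
      have "\<bar>u * Im x + v * Im y\<bar> \<le> u * \<bar>Im x\<bar> + v * \<bar>Im y\<bar>"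
        using uv abs_triangle_ineq[of "u * Im x" "v * Im y"] by (simp add: abs_mult)
      also have "\<dots> \<le> u * Re x + v * Re y"
        using uv xy by (intro add_mono mult_left_mono) auto
      finally show "u *\<^sub>R x + v *\<^sub>R y \<in> {s. \<bar>Im s\<bar> \<le> Re s}" by simp
    qed
    then show "convex ({s. 0 < Re s} \<inter> {s. \<bar>Im s\<bar> \<le> Re s} \<inter> cball 0 1 \<inter> cball 0 \<rho>)"
      by (intro convex_Int convex_cball convex_halfspace_Re_gt)
    fix z assume z: "z \<in> {s. 0 < Re s} \<inter> {s. \<bar>Im s\<bar> \<le> Re s} \<inter> cball 0 1 \<inter> cball 0 \<rho>"
    then have zs: "z \<in> sector" by (auto simp: sector_def)
    show "(E has_field_derivative E' z) (at z within {s. 0 < Re s} \<inter> {s. \<bar>Im s\<bar> \<le> Re s} \<inter> cball 0 1 \<inter> cball 0 \<rho>)"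
      by (rule has_field_derivative_at_within[OF der[OF zs]])
    have "K * norm z ^ N \<le> K * \<rho> ^ N"
      using z K by (intro mult_left_mono power_mono) auto
    with bd[OF zs] show "norm (E' z) \<le> K * \<rho> ^ N" by linarith
  qed (use that in \<open>auto simp: sector_def\<close>)
  define p where "p = (\<lambda>k. complex_of_real (1 / real (Suc k)))"
  have np: "norm (p k) = 1 / real (Suc k)" for k
    unfolding p_def norm_of_real by simp
  have p: "p k \<in> sector" for k
    unfolding sector_def mem_Collect_eq np by (simp add: p_def)
  have p0: "p \<longlonglongrightarrow> 0"
    unfolding p_def using tendsto_of_real[OF LIMSEQ_Suc[OF lim_1_over_n], where 'a = complex] by simp
  have "Cauchy (\<lambda>k. E (p k))"
  proof (rule CauchyI)
    fix e :: real assume e: "e > 0"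
    have "Cauchy p" using p0 by (rule LIMSEQ_imp_Cauchy)
    then obtain M where M: "\<And>m n. m \<ge> M \<Longrightarrow> n \<ge> M \<Longrightarrow> norm (p m - p n) < e / (K + 1)"
      using e K CauchyD[of p "e / (K + 1)"] by auto
    have "norm (E (p m) - E (p n)) < e" if "m \<ge> M" "n \<ge> M" for m n
    proof -
      have "norm (E (p m) - E (p n)) \<le> K * norm (p m - p n)"
        using lip[OF p[of m] p[of n], of 1] p[of m] p[of n] by (simp add: sector_def)
      also have "\<dots> \<le> K * (e / (K + 1))"
        using M[OF that] K by (intro mult_left_mono) auto
      also have "\<dots> < e" using e K by (simp add: field_simps)
      finally show ?thesis .
    qed
    then show "\<exists>M. \<forall>m\<ge>M. \<forall>n\<ge>M. norm (E (p m) - E (p n)) < e" by blast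
  qed
  then obtain D where D: "(\<lambda>k. E (p k)) \<longlonglongrightarrow> D"
    using Cauchy_convergent convergent_def by blast
  show ?thesis
  proof
    show "(\<lambda>k. E (of_real (1 / real (Suc k)))) \<longlonglongrightarrow> D" using D by (simp add: p_def)
    fix s assume s: "s \<in> sector"
    have s0: "norm s > 0" using s by (auto simp: sector_def)
    have "\<forall>\<^sub>F k in sequentially. norm (p k) < norm s"
      using order_tendstoD(2)[OF tendsto_norm[OF p0], of "norm s"] s0 by simp
    then have "\<forall>\<^sub>F k in sequentially. norm (E s - E (p k)) \<le> 2 * K * norm s ^ Suc N"
    proof eventually_elim
      case (elim k)
      have "norm (E s - E (p k)) \<le> K * norm s ^ N * norm (s - p k)"
        using elim by (intro lip s p) auto
      also have "\<dots> \<le> K * norm s ^ N * (2 * norm s)"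
        using K elim norm_triangle_ineq4[of s "p k"] by (intro mult_left_mono) auto
      finally show ?case by (simp add: mult_ac)
    qed
    then show "norm (E s - D) \<le> 2 * K * norm s ^ Suc N"
      by (rule Lim_norm_ubound[OF _ tendsto_diff[OF tendsto_const D], rotated]) simp
  qed
qed

lemma artanh2_has_derivative:
  assumes "norm z < 1"
  shows "(artanh2 has_field_derivative 2 / (1 - z\<^sup>2)) (at z)"
proof -
  have "Re (1 + z) > 0" "Re (1 - z) > 0"
    using assms abs_Re_le_cmod[of z] by auto
  then have nr: "1 + z \<notin> \<real>\<^sub>\<le>\<^sub>0" "1 - z \<notin> \<real>\<^sub>\<le>\<^sub>0"
    by (auto simp: complex_nonpos_Reals_iff simp del: one_complex.sel plus_complex.sel minus_complex.sel)
  have "1 - z\<^sup>2 = (1 + z) * (1 - z)" by (simp add: power2_eq_square algebra_simps)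
  moreover have "1 + z \<noteq> 0" "1 - z \<noteq> 0" using one_plus_nonzero[OF assms] by auto
  ultimately have eq: "inverse (1 + z) - - inverse (1 - z) = 2 / (1 - z\<^sup>2)"
    by (simp add: field_simps)
  have "((\<lambda>z. Ln (1 + z) - Ln (1 - z)) has_field_derivative (inverse (1 + z) - - inverse (1 - z))) (at z)"
    using nr by (auto intro!: derivative_eq_intros simp: divide_inverse)
  then show ?thesis
    unfolding eq by (simp add: artanh2_def[abs_def])
qed

text \<open>Termwise, with w = k s for the k-th factor, the derivative is -2 k exp(-w)/(1 - exp(-2
  w)) = -k/sinh w = -(1/s) w/sinh w.\<close>

lemma log_gf_has_derivative:
  assumes s: "0 < Re s" "\<bar>Im s\<bar> \<le> Re s"
  shows "((\<lambda>s. log_gf (exp (- s))) has_field_derivative - (x_sinh_sum s 1 / s)) (at s)"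
proof -
  define S where "S = {s. 0 < Re s}"
  have op: "open S" unfolding S_def by (intro open_Collect_less continuous_intros)
  have "((\<lambda>z. \<Sum>k. artanh2 (exp (- z) ^ Suc k)) has_field_derivative
      (\<Sum>k. - (1 / s) * x_sinh (s * (of_nat k + 1)))) (at s)"
  proof (rule suminf_has_field_derivative[OF op])
    fix k z assume "z \<in> S"
    then have z: "Re z > 0" by (simp add: S_def)
    define w where "w = z * (of_nat k + 1)"
    have w: "Re w > 0" using z by (simp add: w_def add_nonneg_pos)
    have ew: "exp (- z) ^ Suc k = exp (- w)"
      by (simp add: w_def algebra_simps flip: exp_of_nat_mult exp_add)
    have "norm (exp (- z) ^ Suc k) < 1" unfolding ew using w by simp
    note da = artanh2_has_derivative[OF this]
    have dg: "((\<lambda>z. exp (- z) ^ Suc k) has_field_derivative - (of_nat k + 1) * exp (- w)) (at z)"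
      unfolding ew[symmetric] by (rule derivative_eq_intros refl)+ (simp add: algebra_simps)
    have "((\<lambda>z. artanh2 (exp (- z) ^ Suc k)) has_field_derivative
       2 / (1 - (exp (- w))\<^sup>2) * (- (of_nat k + 1) * exp (- w))) (at z)"
      using DERIV_chain2[where f = artanh2 and g = "\<lambda>z. exp (- z) ^ Suc k", OF da dg] unfolding ew .
    also have "2 / (1 - (exp (- w))\<^sup>2) * (- (of_nat k + 1) * exp (- w)) = - (1 / z) * x_sinh w"
    proof -
      have e2: "(exp (- w))\<^sup>2 = exp (- 2 * w)" by (simp flip: exp_of_nat_mult)
      have z0: "z \<noteq> 0" using z by auto
      have "2 / (1 - X) * (- c * e) = - (1 / z) * (2 * (z * c) * e / (1 - X))" for X c e :: complex
        using z0 by (simp add: divide_simps)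
      then show ?thesis
        unfolding x_sinh_eq_exp(1)[OF w] e2 by (simp only: w_def)
    qed
    finally show "((\<lambda>z. artanh2 (exp (- z) ^ Suc k)) has_field_derivative - (1 / z) * x_sinh (z * (of_nat k + 1))) (at z)"
      by (simp only: w_def)
  next
    fix z assume "z \<in> S"
    then have z: "Re z > 0" by (simp add: S_def)
    define r where "r = exp (- Re z / 2)"
    have r: "0 < r" "r < 1" using z by (auto simp: r_def)
    have "norm (artanh2 (exp (- y) ^ Suc k)) \<le> 2 / (1 - r) * r ^ Suc k" if "y \<in> ball z (Re z / 2) \<inter> S" for y k
    proof (rule norm_artanh2_power_le)
      have "Re z / 2 \<le> Re y"
        using that abs_Re_le_cmod[of "z - y"] by (auto simp: dist_norm)
      then show "norm (exp (- y)) \<le> r" by (simp add: r_def)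
    qed (use r in auto)
    moreover have "summable (\<lambda>k. 2 / (1 - r) * r ^ Suc k)"
      by (rule summable_mult, subst summable_Suc_iff, rule summable_geometric) (use r in auto)
    ultimately show "\<exists>d h. 0 < d \<and> summable h \<and> (\<forall>n. \<forall>y\<in>ball z d \<inter> S. norm (artanh2 (exp (- y) ^ Suc n)) \<le> h n)"
      using z by (intro exI[of _ "Re z / 2"] exI[of _ "\<lambda>k. 2 / (1 - r) * r ^ Suc k"]) auto
  qed (use s in \<open>auto simp: S_def\<close>)
  also have "(\<Sum>k. - (1 / s) * x_sinh (s * (of_nat k + 1))) = - (1 / s) * x_sinh_sum s 1"
    unfolding x_sinh_sum_def
    by (rule suminf_mult) (rule sums_summable[OF x_sinh_sum_sums], use s in auto)
  finally show ?thesis by (simp add: log_gf_def[abs_def])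
qed

text \<open>Up to the error term, \<open>x_sinh_sum s 1\<close> is pi^2/(4 s) - 1/2, so the
  derivative is -pi^2/(4 s^2) + 1/(2 s); the two subtracted functions are its antiderivatives. The
  remainder is divided by s^2, hence the lattice estimate is invoked with two more powers.\<close>

lemma log_gf_asymp:
  obtains D K where "K > 0" "\<And>s. s \<in> sector \<Longrightarrow>
    norm (log_gf (exp (- s)) - of_real (pi\<^sup>2 / 4) / s - Ln s / 2 - D) \<le> K * norm s ^ Suc N"
proof -
  obtain K where K: "K > 0" "\<And>s. \<lbrakk>0 < Re s; \<bar>Im s\<bar> \<le> Re s; Re s \<le> 1\<rbrakk> \<Longrightarrow>
     norm (s * (1 + 2 * x_sinh_sum s 1) - of_real (pi\<^sup>2 / 2)) \<le> K * norm s ^ Suc (Suc N)"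
    by (rule x_sinh_sum_asymp) blast
  define E where "E = (\<lambda>s. log_gf (exp (- s)) - of_real (pi\<^sup>2 / 4) / s - Ln s / 2)"
  define E' where "E' = (\<lambda>s. - (s * (1 + 2 * x_sinh_sum s 1) - of_real (pi\<^sup>2 / 2)) / (2 * s\<^sup>2))"
  have d: "(E has_field_derivative E' s) (at s)" if "s \<in> sector" for s
  proof -
    have s: "0 < Re s" "\<bar>Im s\<bar> \<le> Re s" and s0: "s \<noteq> 0" and sr: "s \<notin> \<real>\<^sub>\<le>\<^sub>0"
      using that by (auto simp: sector_def complex_nonpos_Reals_iff)
    show ?thesis
      unfolding E_def
      using s0 sr by (auto intro!: derivative_eq_intros log_gf_has_derivative[OF s]
          simp: E'_def field_simps power2_eq_square)
  qed
  have b: "norm (E' s) \<le> K / 2 * norm s ^ N" if "s \<in> sector" for s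
  proof -
    have s: "0 < Re s" "\<bar>Im s\<bar> \<le> Re s" "Re s \<le> 1" and s0: "s \<noteq> 0"
      using that complex_Re_le_cmod[of s] by (auto simp: sector_def)
    have "norm (E' s) \<le> K * norm s ^ Suc (Suc N) / (2 * (norm s)\<^sup>2)"
      unfolding E'_def norm_divide norm_minus_cancel norm_mult norm_power norm_numeral
      by (rule divide_right_mono[OF K(2)[OF s, unfolded norm_mult]]) simp
    also have "\<dots> = K / 2 * norm s ^ N" using s0 by (simp add: power2_eq_square)
    finally show ?thesis .
  qed
  have K2: "0 \<le> K / 2" using K by simp
  show ?thesis
  proof (rule sector_limit[where E = E and E' = E' and K = "K / 2" and N = N, OF d b K2])
    fix D assume "\<And>s. s \<in> sector \<Longrightarrow> norm (E s - D) \<le> 2 * (K / 2) * norm s ^ Suc N"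
    then have "norm (E s - D) \<le> K * norm s ^ Suc N" if "s \<in> sector" for s
      using that by (simp del: power_Suc)
    with K(1) show thesis
      unfolding E_def by (rule that)
  qed
qed

lemma norm_exp_minus_one_le: "norm (exp z - 1) \<le> norm z * exp (norm z)" for z :: complex
proof -
  have "norm (exp z - exp 0) \<le> exp (norm z) * norm (z - 0)"
  proof (rule field_differentiable_bound[where S = "cball 0 (norm z)" and f' = exp])
    fix w :: complex assume "w \<in> cball 0 (norm z)"
    then show "norm (exp w) \<le> exp (norm z)"
      using norm_exp[of w] order_trans[of "norm (exp w)" "exp (norm w)" "exp (norm z)"] by simp
  qed (auto intro!: derivative_eq_intros)
  then show ?thesis by (simp add: mult.commute)
qed

lemma gf_asymp:
  obtains c K where "c \<noteq> 0" "K > 0" "\<And>s. s \<in> sector \<Longrightarrow>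
    norm (exp (log_gf (exp (- s))) - c * csqrt s * exp (of_real (pi\<^sup>2 / 4) / s)) \<le>
      K * norm s ^ Suc N * norm (csqrt s * exp (of_real (pi\<^sup>2 / 4) / s))"
proof -
  obtain D K where K: "K > 0" "\<And>s. s \<in> sector \<Longrightarrow>
    norm (log_gf (exp (- s)) - of_real (pi\<^sup>2 / 4) / s - Ln s / 2 - D) \<le> K * norm s ^ Suc N"
    by (rule log_gf_asymp) blast
  show ?thesis
  proof
    show "exp D \<noteq> 0" by simp
    show "norm (exp D) * K * exp K > 0" using K by simp
    fix s assume s: "s \<in> sector"
    define d where "d = log_gf (exp (- s)) - of_real (pi\<^sup>2 / 4) / s - Ln s / 2 - D"
    define M where "M = csqrt s * exp (of_real (pi\<^sup>2 / 4) / s)"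
    have d: "norm d \<le> K * norm s ^ Suc N" using K(2)[OF s] by (simp add: d_def)
    have "norm s ^ Suc N \<le> 1" using s by (intro power_le_one) (auto simp: sector_def)
    then have dK: "norm d \<le> K" using d K(1) by (meson mult_left_le order_less_imp_le order_trans)
    have "s \<noteq> 0" using s by (auto simp: sector_def)
    then have cs: "csqrt s = exp (Ln s / 2)" by (rule csqrt_exp_Ln)
    have "log_gf (exp (- s)) = D + Ln s / 2 + of_real (pi\<^sup>2 / 4) / s + d"
      by (simp add: d_def)
    then have "exp (log_gf (exp (- s))) = exp D * M * exp d"
      by (simp only: exp_add M_def cs mult.assoc)
    then have "exp (log_gf (exp (- s))) - exp D * M = exp D * M * (exp d - 1)"
      by (simp add: algebra_simps)
    then have "norm (exp (log_gf (exp (- s))) - exp D * M) = norm (exp D) * norm M * norm (exp d - 1)"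
      by (simp only: norm_mult)
    also have "\<dots> \<le> norm (exp D) * norm M * ((K * norm s ^ Suc N) * exp K)"
    proof (rule mult_left_mono)
      have "norm (exp d - 1) \<le> norm d * exp (norm d)" by (rule norm_exp_minus_one_le)
      also have "\<dots> \<le> (K * norm s ^ Suc N) * exp K"
        using d dK K by (intro mult_mono) auto
      finally show "norm (exp d - 1) \<le> (K * norm s ^ Suc N) * exp K" .
    qed simp
    finally show "norm (exp (log_gf (exp (- s))) - exp D * csqrt s * exp (of_real (pi\<^sup>2 / 4) / s)) \<le>
      norm (exp D) * K * exp K * norm s ^ Suc N * norm (csqrt s * exp (of_real (pi\<^sup>2 / 4) / s))"
      by (simp add: M_def mult_ac)
  qed
qed

section \<open>The comparison sequence\<close>

text \<open>
  With \<open>H(t) = sinh(\<pi> sqrt t) / sqrt t\<close>, \<open>comparison n\<close> is \<open>H'(n)\<close>, given by its power series.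
\<close>

definition comparison_coeff :: "nat \<Rightarrow> real" where
  "comparison_coeff k = real (Suc k) * pi ^ (2 * k + 3) / fact (2 * k + 3)"

definition comparison :: "nat \<Rightarrow> real" where
  "comparison n = (\<Sum>k. comparison_coeff k * real n ^ k)"

lemma cosh_sums_even: "(\<lambda>k. x ^ (2 * k) / fact (2 * k)) sums cosh x" for x :: real
proof -
  have "{k * 2..<k * 2 + 2} = {2 * k, 2 * k + 1}" for k :: nat by auto
  with sums_group[OF cosh_converges[of x], of 2] show ?thesis
    by (simp add: divide_inverse mult.commute)
qed

lemma sinh_sums_odd: "(\<lambda>k. x ^ (2 * k + 1) / fact (2 * k + 1)) sums sinh x" for x :: real
proof -
  have "{k * 2..<k * 2 + 2} = {2 * k, 2 * k + 1}" for k :: nat by auto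
  with sums_group[OF sinh_converges[of x], of 2] show ?thesis
    by (simp add: divide_inverse mult.commute del: fact_Suc)
qed

text \<open>Differentiating sinh(pi sqrt t)/sqrt t gives this closed form. It is verified on
  coefficients through 1/(2k+2)! - 1/(2k+3)! = (2k+2)/(2k+3)!; the terms linear in r cancel.\<close>

lemma comparison_sums:
  assumes "n > 0"
  defines "r \<equiv> pi * sqrt (real n)"
  shows "(\<lambda>k. comparison_coeff k * real n ^ k) sums ((r * cosh r - sinh r) / (2 * sqrt (real n) ^ 3))"
proof -
  define y where "y = sqrt (real n)"
  have y: "y > 0" "y ^ 2 = real n" using assms(1) by (auto simp: y_def)
  have 1: "(\<lambda>k. r ^ (2 * Suc k) / fact (2 * Suc k)) sums (cosh r - 1)"
    by (subst sums_Suc_iff) (use cosh_sums_even[of r] in simp)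
  have 2: "(\<lambda>k. r ^ (2 * Suc k + 1) / fact (2 * Suc k + 1)) sums (sinh r - r)"
    by (subst sums_Suc_iff) (use sinh_sums_odd[of r] in simp)
  have t: "(r * (r ^ (2 * Suc k) / fact (2 * Suc k)) - r ^ (2 * Suc k + 1) / fact (2 * Suc k + 1)) / (2 * y ^ 3) =
      comparison_coeff k * real n ^ k" for k
  proof -
    define F :: real where "F = fact (2 * Suc k)"
    define a where "a = 2 * real k + 3"
    have F: "F > 0" "a > 0" by (simp_all add: F_def a_def del: fact_Suc)
    have f: "fact (2 * Suc k + 1) = a * F"
      by (simp add: F_def a_def algebra_simps)
    have e: "2 * Suc k + 1 = 2 * k + 3" by simp
    have "r * (r ^ (2 * Suc k) / F) - r ^ (2 * Suc k + 1) / (a * F) = r ^ (2 * Suc k + 1) * ((a - 1) / (a * F))"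
      using F by (simp add: field_simps)
    also have "a - 1 = 2 * real (Suc k)" by (simp add: a_def)
    finally have "r * (r ^ (2 * Suc k) / fact (2 * Suc k)) - r ^ (2 * Suc k + 1) / fact (2 * Suc k + 1) =
        r ^ (2 * k + 3) * (2 * real (Suc k) / fact (2 * k + 3))"
      unfolding f[symmetric] F_def[symmetric] e .
    also have "r ^ (2 * k + 3) = pi ^ (2 * k + 3) * (real n ^ k * y ^ 3)"
      using y by (simp add: r_def y_def[symmetric] power_mult_distrib power_add power_mult)
    finally show ?thesis
      using y by (simp only:) (simp add: comparison_coeff_def field_simps del: of_nat_Suc fact_Suc)
  qed
  from sums_divide[OF sums_diff[OF sums_mult[OF 1, of r] 2], of "2 * y ^ 3"]
  have "(\<lambda>k. comparison_coeff k * real n ^ k) sums ((r * (cosh r - 1) - (sinh r - r)) / (2 * y ^ 3))"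
    unfolding t .
  then show ?thesis by (simp add: y_def algebra_simps)
qed

text \<open>
  The Laplace transform of \<open>H\<close> is \<open>daw (\<pi> / sqrt s) / sqrt s\<close>, where \<open>daw v\<close> equals
  \<open>exp (v^2 / 4)\<close> times the integral of \<open>exp (- u^2 / 4)\<close> from 0 to \<open>v\<close> (\<open>gauss_int\<close> below).
\<close>

definition daw_coeff :: "nat \<Rightarrow> real" where
  "daw_coeff j = fact j / fact (2 * j + 1)"

definition daw :: "complex \<Rightarrow> complex" where
  "daw v = (\<Sum>j. of_real (daw_coeff j) * v ^ (2 * j + 1))"

text \<open>The coefficient form of the differential equation daw' = 1 + (v/2) daw.\<close>

lemma daw_coeff_Suc: "(2 * real j + 3) * daw_coeff (Suc j) = daw_coeff j / 2"
proof -
  have "(fact (2 * Suc j + 1) :: real) = (2 * real j + 3) * ((2 * real j + 2) * fact (2 * j + 1))"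
    by (simp add: algebra_simps)
  moreover have "2 * real j + 3 > 0" "2 * real j + 2 > 0" by linarith+
  ultimately show ?thesis
    by (simp add: daw_coeff_def divide_simps del: fact_Suc) (simp add: algebra_simps)
qed

lemma daw_coeff_le: "0 < daw_coeff j" "daw_coeff j \<le> (1 / 4) ^ j / fact j"
proof (induction j)
  case (Suc j)
  case 2
  have "daw_coeff (Suc j) = daw_coeff j / (2 * (2 * real j + 3))"
    using daw_coeff_Suc[of j] by (simp add: field_simps)
  also have "\<dots> \<le> ((1 / 4) ^ j / fact j) / (4 * (real j + 1))"
    using Suc by (intro frac_le) auto
  finally show ?case by (simp add: field_simps)
qed (auto simp: daw_coeff_def)

lemma norm_daw_term_le: "norm (of_real (daw_coeff j) * v ^ (2 * j + 1)) \<le> norm v * ((norm v ^ 2 / 4) ^ j / fact j)" for v :: complex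
proof -
  have "norm (of_real (daw_coeff j) * v ^ (2 * j + 1)) = daw_coeff j * (norm v * (norm v ^ 2) ^ j)"
    using daw_coeff_le(1)[of j] by (simp add: norm_mult norm_power power_mult)
  also have "\<dots> \<le> (1 / 4) ^ j / fact j * (norm v * (norm v ^ 2) ^ j)"
    by (intro mult_right_mono daw_coeff_le) auto
  finally show ?thesis by (simp add: power_divide)
qed

lemma exp_sums_mult: "(\<lambda>j. c * (x ^ j / fact j)) sums (c * exp x)" for c x :: real
  using sums_mult[OF exp_converges[of x], of c] by (simp add: divide_inverse mult_ac)

lemma summable_daw: "summable (\<lambda>j. norm (of_real (daw_coeff j) * v ^ (2 * j + 1)))" for v :: complex
  by (rule summable_comparison_test'[OF sums_summable[OF exp_sums_mult[of "norm v" "norm v ^ 2 / 4"]], of 0])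
     (simp only: real_norm_def abs_norm_cancel norm_daw_term_le)

lemma norm_daw_le: "norm (daw v) \<le> norm v * exp (norm v ^ 2 / 4)"
  using norm_suminf_le[OF norm_daw_term_le sums_summable[OF exp_sums_mult], of v]
    sums_unique[OF exp_sums_mult[of "norm v" "norm v ^ 2 / 4"]]
  by (simp add: daw_def)

lemma daw_has_derivative: "(daw has_field_derivative 1 + v / 2 * daw v) (at v)"
proof -
  have "((\<lambda>v. \<Sum>j. of_real (daw_coeff j) * v ^ (2 * j + 1)) has_field_derivative
      (\<Sum>j. of_real ((2 * real j + 1) * daw_coeff j) * v ^ (2 * j))) (at v)"
  proof (rule suminf_has_field_derivative[of UNIV])
    fix j and v :: complex
    show "((\<lambda>v. of_real (daw_coeff j) * v ^ (2 * j + 1)) has_field_derivative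
        of_real ((2 * real j + 1) * daw_coeff j) * v ^ (2 * j)) (at v)"
      by (rule derivative_eq_intros refl)+ (simp add: algebra_simps)
  next
    fix x :: complex
    define M where "M = norm x + 1"
    have "norm (of_real (daw_coeff j) * y ^ (2 * j + 1)) \<le> M * ((M ^ 2 / 4) ^ j / fact j)"
      if "y \<in> ball x 1 \<inter> UNIV" for j y
    proof -
      have "norm y \<le> M"
        using that norm_triangle_sub[of y x] by (simp add: M_def dist_norm norm_minus_commute)
      then have "norm y * ((norm y ^ 2 / 4) ^ j / fact j) \<le> M * ((M ^ 2 / 4) ^ j / fact j)"
        by (intro mult_mono divide_right_mono power_mono) (auto simp: M_def)
      then show ?thesis by (rule order_trans[OF norm_daw_term_le])
    qed
    then show "\<exists>d h. 0 < d \<and> summable h \<and>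
        (\<forall>n. \<forall>y\<in>ball x d \<inter> UNIV. norm (of_real (daw_coeff n) * y ^ (2 * n + 1)) \<le> h n)"
      by (intro exI[of _ 1] exI[of _ "\<lambda>j. M * ((M ^ 2 / 4) ^ j / fact j)"] conjI
          sums_summable[OF exp_sums_mult] allI ballI) auto
  qed auto
  moreover have "(\<lambda>j. of_real ((2 * real j + 1) * daw_coeff j) * v ^ (2 * j)) sums (1 + v / 2 * daw v)"
  proof -
    have "(\<lambda>j. v / 2 * (of_real (daw_coeff j) * v ^ (2 * j + 1))) sums (v / 2 * daw v)"
      unfolding daw_def by (intro sums_mult summable_sums summable_norm_cancel[OF summable_daw])
    moreover have "v / 2 * (of_real (daw_coeff j) * v ^ (2 * j + 1)) =
        of_real ((2 * real (Suc j) + 1) * daw_coeff (Suc j)) * v ^ (2 * Suc j)" for j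
    proof -
      have e: "(2 * real (Suc j) + 1) * daw_coeff (Suc j) = daw_coeff j / 2"
        using daw_coeff_Suc[of j] by (simp add: algebra_simps)
      show ?thesis unfolding e by simp
    qed
    ultimately have "(\<lambda>j. of_real ((2 * real (Suc j) + 1) * daw_coeff (Suc j)) * v ^ (2 * Suc j)) sums (v / 2 * daw v)"
      by (simp only:)
    then show ?thesis
      by (subst (asm) sums_Suc_iff) (simp add: daw_coeff_def add.commute)
  qed
  ultimately show ?thesis
    using sums_unique by (fastforce simp: daw_def[abs_def])
qed

definition gauss_int :: "complex \<Rightarrow> complex" where
  "gauss_int v = daw v * exp (- (v\<^sup>2 / 4))"

lemma gauss_int_has_derivative: "(gauss_int has_field_derivative exp (- (v\<^sup>2 / 4))) (at v)"
  unfolding gauss_int_def[abs_def]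
  by (rule derivative_eq_intros daw_has_derivative refl | simp)+ (simp add: field_simps power2_eq_square)

text \<open>Together with positivity on the positive axis, this keeps the limit of
  \<open>gauss_int\<close> at infinity away from zero.\<close>

lemma Re_gauss_int_mono:
  assumes "a \<le> b"
  shows "Re (gauss_int (of_real a)) \<le> Re (gauss_int (of_real b))"
proof (rule DERIV_nonneg_imp_nondecreasing[OF assms])
  fix x :: real
  have "((\<lambda>x. gauss_int (of_real x)) has_vector_derivative exp (- ((of_real x)\<^sup>2 / 4))) (at x)"
    by (rule has_vector_derivative_real_field[OF gauss_int_has_derivative])
  then have "((\<lambda>x. Re (gauss_int (of_real x))) has_vector_derivative Re (exp (- ((of_real x)\<^sup>2 / 4)))) (at x)"
    by (rule bounded_linear.has_vector_derivative[OF bounded_linear_Re])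
  moreover have "exp (- ((of_real x)\<^sup>2 / 4)) = complex_of_real (exp (- (x\<^sup>2 / 4)))"
    by (simp flip: exp_of_real)
  ultimately show "\<exists>y. ((\<lambda>x. Re (gauss_int (of_real x))) has_real_derivative y) (at x) \<and> y \<ge> 0"
    by (intro exI[of _ "exp (- (x\<^sup>2 / 4))"]) (simp add: has_real_derivative_iff_has_vector_derivative)
qed

lemma Re_gauss_int_pos:
  assumes "x > 0"
  shows "Re (gauss_int (of_real x)) > 0"
proof -
  have "(\<lambda>j. of_real (daw_coeff j) * of_real x ^ (2 * j + 1)) sums daw (of_real x)"
    unfolding daw_def by (rule summable_sums[OF summable_norm_cancel[OF summable_daw]])
  then have "(\<lambda>j. daw_coeff j * x ^ (2 * j + 1)) sums Re (daw (of_real x))"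
    using sums_Re by (fastforce simp flip: of_real_power of_real_mult)
  then have "Re (daw (of_real x)) > 0"
    using suminf_pos[of "\<lambda>j. daw_coeff j * x ^ (2 * j + 1)"] assms daw_coeff_le(1)
    by (simp add: sums_iff del: power_Suc)
  moreover have "exp (- ((of_real x)\<^sup>2 / 4)) = complex_of_real (exp (- (x\<^sup>2 / 4)))"
    by (simp flip: exp_of_real)
  ultimately show ?thesis by (simp add: gauss_int_def)
qed

lemma Re_inverse_sector:
  assumes "s \<in> sector"
  shows "1 / (2 * norm s) \<le> Re (1 / s)"
proof -
  have s: "0 < Re s" "\<bar>Im s\<bar> \<le> Re s" "norm s > 0" using assms by (auto simp: sector_def)
  have "norm s \<le> 2 * Re s" using cmod_le[of s] s by simp
  then have "(norm s / 2) / (norm s)\<^sup>2 \<le> Re s / (norm s)\<^sup>2"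
    by (intro divide_right_mono) auto
  moreover have "(norm s / 2) / (norm s)\<^sup>2 = 1 / (2 * norm s)"
    using s by (simp add: power2_eq_square)
  moreover have "Re (1 / s) = Re s / (norm s)\<^sup>2"
    by (simp add: Re_divide cmod_power2)
  ultimately show ?thesis by simp
qed

lemma norm_exp_neg_inverse_sector:
  assumes "s \<in> sector"
  shows "norm (exp (- (of_real (pi\<^sup>2 / 4) / s))) \<le> fact m * norm s ^ m"
proof -
  have n: "norm s > 0" using assms by (auto simp: sector_def)
  define y where "y = 1 / norm s"
  have y: "y > 0" using n by (simp add: y_def)
  \<comment> \<open>From pi^2 \<ge> 8, the exponent pi^2/4 Re (1/s) \<ge> pi^2/(8 |s|) is at least
    1/|s|.\<close>
  have "3 * 3 \<le> pi * pi" using pi_gt3 by (intro mult_mono) auto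
  then have "8 \<le> pi\<^sup>2" by (simp add: power2_eq_square)
  then have "y \<le> pi\<^sup>2 / 4 * (1 / (2 * norm s))"
    using n by (simp add: y_def field_simps)
  also have "\<dots> \<le> pi\<^sup>2 / 4 * Re (1 / s)"
    by (intro mult_left_mono Re_inverse_sector assms) auto
  also have "\<dots> = Re (of_real (pi\<^sup>2 / 4) * (1 / s))"
    by (simp only: times_complex.sel Re_complex_of_real Im_complex_of_real)
  also have "of_real (pi\<^sup>2 / 4) * (1 / s) = of_real (pi\<^sup>2 / 4) / s" by simp
  finally have "norm (exp (- (of_real (pi\<^sup>2 / 4) / s))) \<le> exp (- y)" by simp
  also have "exp (- y) \<le> fact m * norm s ^ m"
  proof -
    have "y ^ m / fact m \<le> exp y"
    proof -
      have "sum (\<lambda>j. y ^ j / fact j) {m} \<le> (\<Sum>j. 1 * (y ^ j / fact j))"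
        using sum_le_suminf[OF sums_summable[OF exp_sums_mult[of 1 y]], of "{m}"] y by simp
      then show ?thesis using sums_unique[OF exp_sums_mult[of 1 y]] by simp
    qed
    moreover have "y ^ m * norm s ^ m = 1" using n by (simp add: y_def power_divide)
    ultimately have "1 \<le> exp y * (fact m * norm s ^ m)"
      using mult_right_mono[of "y ^ m / fact m" "exp y" "fact m * norm s ^ m"] by simp
    then show ?thesis by (simp add: exp_minus field_simps)
  qed
  finally show ?thesis .
qed

text \<open>As a function of s, the derivative contains exp(-pi^2/(4 s)), which beats every power of
  s in the sector, so \<open>sector_limit\<close> applies for any N. The limit is the Gaussian
  integral over the half line.\<close>

lemma gauss_int_asymp:
  obtains \<gamma> K where "\<gamma> \<noteq> 0" "K > 0" "\<And>s. s \<in> sector \<Longrightarrow>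
    norm (gauss_int (of_real pi / csqrt s) - \<gamma>) \<le> K * norm s ^ Suc N"
proof -
  define E where "E = (\<lambda>s. gauss_int (of_real pi / csqrt s))"
  define E' where "E' = (\<lambda>s. exp (- (of_real (pi\<^sup>2 / 4) / s)) * (- of_real pi / (2 * s * csqrt s)))"
  have d: "(E has_field_derivative E' s) (at s)" if "s \<in> sector" for s
  proof -
    have s0: "s \<noteq> 0" and sr: "s \<notin> \<real>\<^sub>\<le>\<^sub>0"
      using that by (auto simp: sector_def complex_nonpos_Reals_iff)
    have c2: "csqrt s * csqrt s = s" using power2_csqrt[of s] by (simp add: power2_eq_square)
    have c0: "csqrt s \<noteq> 0" using s0 by simp
    have g: "((\<lambda>s. of_real pi / csqrt s) has_field_derivative (- of_real pi / (2 * s * csqrt s))) (at s)"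
    proof -
      have "((\<lambda>s. of_real pi / csqrt s) has_field_derivative
          (0 * csqrt s - of_real pi * (inverse (2 * csqrt s))) / (csqrt s * csqrt s)) (at s)"
        by (intro DERIV_divide has_field_derivative_csqrt sr c0 DERIV_const)
      moreover have "(0 * csqrt s - of_real pi * (inverse (2 * csqrt s))) / (csqrt s * csqrt s) = - of_real pi / (2 * s * csqrt s)"
        unfolding c2 using s0 c0 by (simp add: field_simps)
      ultimately show ?thesis by simp
    qed
    have "(of_real pi / csqrt s)\<^sup>2 / 4 = of_real (pi\<^sup>2 / 4) / s"
      by (simp add: power_divide)
    from DERIV_chain2[where f = gauss_int and g = "\<lambda>s. of_real pi / csqrt s", OF gauss_int_has_derivative g, unfolded this]
    show ?thesis unfolding E_def E'_def .
  qed
  define K where "K = pi / 2 * fact (N + 2)"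
  have b: "norm (E' s) \<le> K * norm s ^ N" if "s \<in> sector" for s
  proof -
    have n: "0 < norm s" "norm s \<le> 1" using that by (auto simp: sector_def)
    \<comment> \<open>For |s| \<le> 1 the root dominates |s|, so the prefactor costs at most
      |s|^(-2); the exponential is therefore estimated with exponent N + 2.\<close>
    have sq: "norm s \<le> norm (csqrt s)"
    proof -
      have "norm s \<le> sqrt (norm s)"
        using n real_le_rsqrt[of "norm s" "norm s"] mult_left_le[of "norm s" "norm s"] by (simp add: power2_eq_square)
      then show ?thesis by (simp add: norm_csqrt)
    qed
    have "norm (E' s) = norm (exp (- (of_real (pi\<^sup>2 / 4) / s))) * (pi / (2 * norm s * norm (csqrt s)))"
      unfolding E'_def norm_mult norm_divide by (simp add: norm_mult)
    also have "\<dots> \<le> (fact (N + 2) * norm s ^ (N + 2)) * (pi / (2 * norm s * norm s))"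
      using n sq by (intro mult_mono norm_exp_neg_inverse_sector that divide_left_mono mult_left_mono mult_pos_pos) auto
    also have "\<dots> = K * norm s ^ N"
      using n by (simp add: K_def power_add power2_eq_square field_simps)
    finally show ?thesis .
  qed
  have K: "K > 0" by (simp add: K_def)
  show ?thesis
  proof (rule sector_limit[where E = E and E' = E' and K = K and N = N, OF d b])
    show "0 \<le> K" using K by simp
    fix D assume D: "\<And>s. s \<in> sector \<Longrightarrow> norm (E s - D) \<le> 2 * K * norm s ^ Suc N"
      and lim: "(\<lambda>k. E (of_real (1 / real (Suc k)))) \<longlonglongrightarrow> D"
    \<comment> \<open>At s = 1/(k+1) the argument is pi sqrt(k+1) \<ge> pi, so monotonicity bounds
      the limit below by a positive number.\<close>
    have "Re (gauss_int (of_real pi)) \<le> Re (E (of_real (1 / real (Suc k))))" for k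
    proof -
      have "csqrt (of_real (1 / real (Suc k))) = of_real (sqrt (1 / real (Suc k)))"
        by (rule of_real_sqrt[symmetric]) auto
      then have "E (of_real (1 / real (Suc k))) = gauss_int (of_real (pi * sqrt (real (Suc k))))"
        unfolding E_def by (simp add: real_sqrt_divide del: of_nat_Suc)
      then show ?thesis
        using Re_gauss_int_mono[of pi "pi * sqrt (real (Suc k))"] by simp
    qed
    then have "Re (gauss_int (of_real pi)) \<le> Re D"
      by (intro LIMSEQ_le_const[OF tendsto_Re[OF lim]]) blast
    then have "D \<noteq> 0" using Re_gauss_int_pos[OF pi_gt_zero] by auto
    moreover have "2 * K > 0" using K by simp
    ultimately show thesis using D unfolding E_def by (rule that)
  qed
qed

section \<open>From sums over n to the Laplace transform\<close>

lemma higher_deriv_eqI: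
  fixes F :: "nat \<Rightarrow> complex \<Rightarrow> complex"
  assumes S: "open S" and f: "\<And>z. z \<in> S \<Longrightarrow> f z = F 0 z"
    and der: "\<And>k z. z \<in> S \<Longrightarrow> (F k has_field_derivative F (Suc k) z) (at z)"
    and z: "z \<in> S"
  shows "(deriv ^^ k) f z = F k z"
  using z
proof (induction k arbitrary: z)
  case 0
  then show ?case by (simp add: f)
next
  case (Suc k)
  have "((deriv ^^ k) f has_field_derivative F (Suc k) z) (at z)"
    by (rule has_field_derivative_transform_within_open[OF der[OF Suc.prems] S Suc.prems]) (simp add: Suc.IH)
  then show ?case by (simp add: DERIV_imp_deriv)
qed

lemma higher_deriv_one_over:
  fixes s :: complex
  assumes "s \<noteq> 0"
  shows "(deriv ^^ k) (\<lambda>s. 1 / s) s = (- 1) ^ k * fact k / s ^ Suc k"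
proof (rule higher_deriv_eqI[where S = "- {0}" and F = "\<lambda>k s. (- 1) ^ k * fact k / s ^ Suc k"])
  fix k and z :: complex assume z: "z \<in> - {0}"
  have "((\<lambda>s. (- 1) ^ k * fact k / s ^ Suc k) has_field_derivative
      (0 * z ^ Suc k - (- 1) ^ k * fact k * (of_nat (Suc k) * z ^ k)) / (z ^ Suc k * z ^ Suc k)) (at z)"
  proof (intro DERIV_divide DERIV_const)
    show "((\<lambda>s. s ^ Suc k) has_field_derivative of_nat (Suc k) * z ^ k) (at z)"
      by (rule derivative_eq_intros refl)+ simp
  qed (use z in simp)
  also have "(0 * z ^ Suc k - (- 1) ^ k * fact k * (of_nat (Suc k) * z ^ k)) / (z ^ Suc k * z ^ Suc k) =
      (- 1) ^ Suc k * fact (Suc k) / z ^ Suc (Suc k)"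
    using z by (simp add: field_simps)
  finally show "((\<lambda>s. (- 1) ^ k * fact k / s ^ Suc k) has_field_derivative (- 1) ^ Suc k * fact (Suc k) / z ^ Suc (Suc k)) (at z)" .
qed (use assms in auto)

lemma summable_power_geometric:
  fixes r :: real
  assumes "0 < r" "r < 1"
  shows "summable (\<lambda>n. real n ^ k * r ^ n)"
proof -
  \<comment> \<open>Chosen so that exp e times r is sqrt r: half of the geometric decay absorbs the
    polynomial factor.\<close>
  define e where "e = - ln r / 2"
  have e: "e > 0" "exp e * r < 1"
  proof -
    show "e > 0" using assms by (simp add: e_def)
    have "exp e * r = exp (e + ln r)" using assms by (simp add: exp_add)
    also have "e + ln r = ln r / 2" by (simp add: e_def)
    finally show "exp e * r < 1" using assms by simp
  qed
  have le: "real n ^ k * r ^ n \<le> (fact k / e ^ k) * (exp e * r) ^ n" for n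
  proof -
    have "sum (\<lambda>j. (e * n) ^ j / fact j) {k} \<le> (\<Sum>j. 1 * ((e * n) ^ j / fact j))"
      using sum_le_suminf[OF sums_summable[OF exp_sums_mult[of 1 "e * n"]], of "{k}"] e by simp
    then have "(e * n) ^ k / fact k \<le> exp (e * n)"
      using sums_unique[OF exp_sums_mult[of 1 "e * n"]] by simp
    then have "real n ^ k \<le> fact k / e ^ k * exp (e * n)"
      using e by (simp add: field_simps power_mult_distrib)
    then have "real n ^ k * r ^ n \<le> fact k / e ^ k * exp (e * n) * r ^ n"
      using assms by (intro mult_right_mono) auto
    also have "exp (e * n) = exp e ^ n" by (simp add: mult.commute flip: exp_of_nat_mult)
    finally show ?thesis by (simp add: power_mult_distrib)
  qed
  have "summable (\<lambda>n. (fact k / e ^ k) * (exp e * r) ^ n)"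
    using e assms by (intro summable_mult summable_geometric) auto
  then show ?thesis
  proof (rule summable_comparison_test'[where N = 0])
    show "norm (real n ^ k * r ^ n) \<le> (fact k / e ^ k) * (exp e * r) ^ n" for n
      using le[of n] assms by simp
  qed
qed

text \<open>Links the sums of n^k exp(-n s), which arise from the power series of H', to derivatives
  of one function with a simple pole at 0.\<close>

lemma higher_deriv_geometric:
  assumes "Re s > 0"
  shows "(deriv ^^ k) (\<lambda>s. 1 / (1 - exp (- s))) s = (\<Sum>n. (- of_nat n) ^ k * exp (- s) ^ n)"
proof (rule higher_deriv_eqI[where S = "{s. Re s > 0}" and F = "\<lambda>k s. \<Sum>n. (- of_nat n) ^ k * exp (- s) ^ n"])
  show op: "open {s. Re s > 0}" by (intro open_Collect_less continuous_intros)
  show "1 / (1 - exp (- z)) = (\<Sum>n. (- of_nat n) ^ 0 * exp (- z) ^ n)" if "z \<in> {s. Re s > 0}" for z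
    using geometric_sums[of "exp (- z)"] that by (simp add: sums_iff)
  fix k z assume z: "z \<in> {s. Re s > 0}"
  show "((\<lambda>s. \<Sum>n. (- of_nat n) ^ k * exp (- s) ^ n) has_field_derivative (\<Sum>n. (- of_nat n) ^ Suc k * exp (- z) ^ n)) (at z)"
  proof (rule suminf_has_field_derivative[OF op _ _ z])
    fix n and w :: complex
    show "((\<lambda>s. (- of_nat n) ^ k * exp (- s) ^ n) has_field_derivative (- of_nat n) ^ Suc k * exp (- w) ^ n) (at w)"
      unfolding exp_of_nat_mult[symmetric]
      by (rule derivative_eq_intros refl)+ (simp add: algebra_simps)
  next
    fix x assume "x \<in> {s. Re s > 0}"
    then have x: "Re x > 0" by simp
    define r where "r = exp (- Re x / 2)"
    have r: "0 < r" "r < 1" using x by (auto simp: r_def)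
    have "norm ((- of_nat n) ^ k * exp (- y) ^ n) \<le> real n ^ k * r ^ n" if "y \<in> ball x (Re x / 2) \<inter> {s. Re s > 0}" for y n
    proof -
      have "Re x / 2 \<le> Re y"
        using that abs_Re_le_cmod[of "x - y"] by (auto simp: dist_norm)
      then have "norm (exp (- y)) \<le> r" by (simp add: r_def)
      then show ?thesis
        unfolding norm_mult norm_power norm_minus_cancel norm_of_nat
        by (intro mult_left_mono power_mono) auto
    qed
    then show "\<exists>d h. 0 < d \<and> summable h \<and> (\<forall>n. \<forall>y\<in>ball x d \<inter> {s. Re s > 0}. norm ((- of_nat n) ^ k * exp (- y) ^ n) \<le> h n)"
      using x summable_power_geometric[OF r, of k]
      by (intro exI[of _ "Re x / 2"] exI[of _ "\<lambda>n. real n ^ k * r ^ n"]) auto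
  qed
qed (use assms in auto)

text \<open>Without its pole at 0 the function is holomorphic up to |Im s| < 2 pi. Cauchy's
  inequality on unit discs around the points of |Im s| \<le> pi then gives k! times a bound
  independent of k and s.\<close>

lemma geometric_minus_pole_deriv_bound:
  obtains B where "B > 0" "\<And>k s. \<lbrakk>0 < Re s; Re s \<le> 1; \<bar>Im s\<bar> \<le> pi\<rbrakk> \<Longrightarrow>
    norm ((deriv ^^ k) (\<lambda>s. 1 / (1 - exp (- s))) s - (- 1) ^ k * fact k / s ^ Suc k) \<le> fact k * B"
proof -
  \<comment> \<open>The other poles are the nonzero multiples of 2 pi i, and 6 < 2 pi.\<close>
  define S where "S = {s. \<bar>Im s\<bar> < 6}"
  have opS: "open S" unfolding S_def by (intro open_Collect_less continuous_intros)
  define h :: "complex \<Rightarrow> complex" where "h = (\<lambda>s. if s = 0 then 1 else (1 - exp (- s)) / s)"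
  have "deriv (\<lambda>s. - exp (- s)) (0 :: complex) = 1"
    by (rule DERIV_imp_deriv) (auto intro!: derivative_eq_intros)
  moreover have "(\<lambda>s. if s = 0 then deriv (\<lambda>s. - exp (- s)) 0 else ((- exp (- s)) - (- exp (- 0))) / (s - 0)) holomorphic_on (UNIV :: complex set)"
    by (rule pole_lemma_open[where f = "\<lambda>s. - exp (- s)"]) (auto intro!: holomorphic_intros)
  ultimately have hol_h: "h holomorphic_on UNIV"
    by (simp add: h_def cong: if_cong)
  have h0: "h s \<noteq> 0" if "s \<in> S" for s
  proof
    assume "h s = 0"
    then have "exp (- s) = 1" "s \<noteq> 0" by (auto simp: h_def split: if_splits)
    then obtain n :: int where n: "Re s = 0" "- Im s = of_int (2 * n) * pi"
      by (auto simp: exp_eq_1)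
    then have "\<bar>Im s\<bar> = 2 * \<bar>real_of_int n\<bar> * pi"
    proof -
      have "\<bar>Im s\<bar> = \<bar>of_int (2 * n) * pi\<bar>" using n(2) by simp
      then show ?thesis by (simp add: abs_mult)
    qed
    moreover have "n \<noteq> 0" using n \<open>s \<noteq> 0\<close> by (auto simp: complex_eq_iff)
    then have "1 \<le> \<bar>real_of_int n\<bar>" by linarith
    then have "1 * pi \<le> \<bar>real_of_int n\<bar> * pi" by (intro mult_right_mono) auto
    moreover have "\<bar>Im s\<bar> < 6" using that by (simp add: S_def)
    ultimately show False using pi_gt3 by linarith
  qed
  define j where "j = (\<lambda>s. 1 / h s)"
  have hol_j: "j holomorphic_on S"
    unfolding j_def using h0 by (intro holomorphic_intros holomorphic_on_subset[OF hol_h]) auto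
  \<comment> \<open>Here j is s/(1 - exp(-s)) with j(0) = 1, so its difference quotient at 0 is
    exactly the function with the pole removed.\<close>
  define \<psi> where "\<psi> = (\<lambda>s. if s = 0 then deriv j 0 else (j s - j 0) / (s - 0))"
  have hol_psi: "\<psi> holomorphic_on S"
    unfolding \<psi>_def by (rule pole_lemma_open[OF hol_j opS])
  have psi_eq: "\<psi> s = 1 / (1 - exp (- s)) - 1 / s" if "s \<noteq> 0" for s
  proof -
    have "\<psi> s = (s / (1 - exp (- s)) - 1) / s"
      using that by (simp add: \<psi>_def j_def h_def)
    also have "\<dots> = 1 / (1 - exp (- s)) - 1 / s"
      using that by (simp add: diff_divide_distrib)
    finally show ?thesis .
  qed
  \<comment> \<open>The box contains all unit discs centred in the relevant rectangle, as pi + 1 <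
    5, and lies inside the strip of half-width 6.\<close>
  define K where "K = cbox (Complex (-2) (-5)) (Complex 2 5)"
  have K: "s \<in> K \<longleftrightarrow> \<bar>Re s\<bar> \<le> 2 \<and> \<bar>Im s\<bar> \<le> 5" for s
    by (auto simp: K_def in_cbox_complex_iff)
  have "bounded (\<psi> ` K)"
  proof (rule compact_imp_bounded[OF compact_continuous_image])
    show "continuous_on K \<psi>"
      by (rule holomorphic_on_imp_continuous_on[OF holomorphic_on_subset[OF hol_psi]]) (auto simp: K S_def)
  qed (simp add: K_def)
  then obtain B where B: "B > 0" "\<And>s. s \<in> K \<Longrightarrow> norm (\<psi> s) \<le> B"
    unfolding bounded_pos by blast
  have main: "norm ((deriv ^^ k) (\<lambda>s. 1 / (1 - exp (- s))) s - (- 1) ^ k * fact k / s ^ Suc k) \<le> fact k * B"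
    if s: "0 < Re s" "Re s \<le> 1" "\<bar>Im s\<bar> \<le> pi" for k s
  proof -
    define P where "P = {s. 0 < Re s}"
    have opP: "open P" unfolding P_def by (intro open_Collect_less continuous_intros)
    have sP: "s \<in> P" "s \<noteq> 0" using s by (auto simp: P_def)
    have sub: "cball s 1 \<subseteq> K"
    proof
      fix w assume "w \<in> cball s 1"
      then have "\<bar>Re (s - w)\<bar> \<le> 1" "\<bar>Im (s - w)\<bar> \<le> 1"
        using abs_Re_le_cmod[of "s - w"] abs_Im_le_cmod[of "s - w"] by (auto simp: dist_norm)
      then show "w \<in> K" using s pi_less_4 by (auto simp: K)
    qed
    have subS: "K \<subseteq> S" by (auto simp: K S_def)
    have ne: "1 - exp (- z) \<noteq> 0" if "z \<in> P" for z
    proof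
      assume "1 - exp (- z) = 0"
      then have "norm (exp (- z)) = 1" by simp
      then show False using that by (simp add: P_def)
    qed
    have "(deriv ^^ k) \<psi> s = (deriv ^^ k) (\<lambda>s. 1 / (1 - exp (- s)) - 1 / s) s"
    proof (rule higher_deriv_cong_ev[OF _ refl])
      have "\<forall>\<^sub>F x in nhds s. x \<in> P" using opP sP by (intro eventually_nhds_in_open) auto
      then show "\<forall>\<^sub>F x in nhds s. \<psi> x = 1 / (1 - exp (- x)) - 1 / x"
        by eventually_elim (auto simp: P_def intro!: psi_eq)
    qed
    also have "\<dots> = (deriv ^^ k) (\<lambda>s. 1 / (1 - exp (- s))) s - (deriv ^^ k) (\<lambda>s. 1 / s) s"
    proof (rule higher_deriv_diff[OF _ _ opP sP(1)])
      show "(\<lambda>s. 1 / (1 - exp (- s))) holomorphic_on P"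
        using ne by (intro holomorphic_intros) auto
      show "(\<lambda>s. 1 / s) holomorphic_on P"
        by (intro holomorphic_intros) (auto simp: P_def)
    qed
    finally have eq: "(deriv ^^ k) (\<lambda>s. 1 / (1 - exp (- s))) s - (- 1) ^ k * fact k / s ^ Suc k = (deriv ^^ k) \<psi> s"
      using higher_deriv_one_over[OF sP(2), of k] by simp
    have "norm ((deriv ^^ k) \<psi> s) \<le> fact k * B / 1 ^ k"
    proof (rule Cauchy_inequality)
      have hol: "\<psi> holomorphic_on cball s 1"
        by (rule holomorphic_on_subset[OF hol_psi]) (use sub subS in blast)
      show "\<psi> holomorphic_on ball s 1"
        by (rule holomorphic_on_subset[OF hol ball_subset_cball])
      show "continuous_on (cball s 1) \<psi>"
        by (rule holomorphic_on_imp_continuous_on[OF hol])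
      show "norm (\<psi> w) \<le> B" if "norm (s - w) = 1" for w
        using that sub by (intro B) (auto simp: dist_norm)
    qed auto
    then show ?thesis unfolding eq by simp
  qed
  from B(1) main show ?thesis by (rule that)
qed

lemma comparison_coeff_pos: "comparison_coeff k > 0"
  by (simp add: comparison_coeff_def)

lemma comparison_coeff_fact: "comparison_coeff k * fact k = daw_coeff (Suc k) * pi ^ (2 * Suc k + 1)"
proof -
  have "2 * Suc k + 1 = 2 * k + 3" by simp
  then show ?thesis
    by (simp only: comparison_coeff_def daw_coeff_def fact_Suc) simp
qed

lemma summable_comparison_coeff: "summable (\<lambda>k. comparison_coeff k * real n ^ k)"
proof (cases "n = 0")
  case True
  have "summable (\<lambda>k. if k = 0 then comparison_coeff k else 0)" by (rule summable_single)
  then show ?thesis using True by (simp add: power_0_left if_distrib cong: if_cong)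
next
  case False
  then show ?thesis using comparison_sums[of n] by (simp add: sums_iff)
qed

text \<open>Since t^k has Laplace transform k!/s^(k+1), the left side is the transform of H'. Only
  odd powers of pi/sqrt s occur, so the outer root leaves integral powers of s. The subtracted term
  pi is H(0).\<close>

lemma daw_inverse_csqrt_sums:
  assumes "s \<noteq> 0"
  shows "(\<lambda>k. of_real (comparison_coeff k * fact k) / s ^ Suc k) sums (csqrt s * daw (of_real pi / csqrt s) - of_real pi)"
proof -
  define v where "v = of_real pi / csqrt s"
  have c0: "csqrt s \<noteq> 0" using assms by simp
  have t: "csqrt s * (of_real (daw_coeff j) * v ^ (2 * j + 1)) = of_real (daw_coeff j * pi ^ (2 * j + 1)) / s ^ j" for j
  proof -
    have "v ^ (2 * j + 1) = of_real pi ^ (2 * j + 1) / (s ^ j * csqrt s)"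
      unfolding v_def power_divide by (simp add: power_mult)
    then show ?thesis using c0 by simp
  qed
  have "(\<lambda>j. csqrt s * (of_real (daw_coeff j) * v ^ (2 * j + 1))) sums (csqrt s * daw v)"
    unfolding daw_def by (intro sums_mult summable_sums summable_norm_cancel[OF summable_daw])
  then have "(\<lambda>j. of_real (daw_coeff j * pi ^ (2 * j + 1)) / s ^ j) sums (csqrt s * daw v)"
    by (simp only: t)
  then have "(\<lambda>j. of_real (daw_coeff (Suc j) * pi ^ (2 * Suc j + 1)) / s ^ Suc j) sums (csqrt s * daw v - of_real pi)"
    by (subst sums_Suc_iff) (simp add: daw_coeff_def)
  then show ?thesis by (simp only: comparison_coeff_fact v_def)
qed

text \<open>Summing the power series of H' over n row by row, each n^k contributes k!/s^(k+1) with
  an error of at most k! B. The numbers \<open>A k\<close> remain summable because H' has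
  coefficients decaying like 1/(2k)!, so the total error is bounded.\<close>

lemma comparison_gf:
  obtains B where "B > 0" "\<And>s. \<lbrakk>0 < Re s; Re s \<le> 1; \<bar>Im s\<bar> \<le> pi\<rbrakk> \<Longrightarrow>
     summable (\<lambda>n. of_real (comparison n) * exp (- s) ^ n) \<and>
     norm ((\<Sum>n. of_real (comparison n) * exp (- s) ^ n) - csqrt s * daw (of_real pi / csqrt s)) \<le> B"
proof -
  obtain B where B: "B > 0" "\<And>k s. \<lbrakk>0 < Re s; Re s \<le> 1; \<bar>Im s\<bar> \<le> pi\<rbrakk> \<Longrightarrow>
    norm ((deriv ^^ k) (\<lambda>s. 1 / (1 - exp (- s))) s - (- 1) ^ k * fact k / s ^ Suc k) \<le> fact k * B"
    by (rule geometric_minus_pole_deriv_bound) blast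
  define A where "A = (\<lambda>k. comparison_coeff k * fact k)"
  have A0: "A k > 0" for k using comparison_coeff_pos[of k] by (simp add: A_def)
  have sA: "summable (\<lambda>k. A k / x ^ Suc k)" if "x > 0" for x
  proof -
    have "summable (\<lambda>k. of_real (A k) / complex_of_real x ^ Suc k)"
      using daw_inverse_csqrt_sums[of "of_real x"] that unfolding A_def by (simp add: sums_iff)
    then have "summable (\<lambda>k. complex_of_real (A k / x ^ Suc k))" by simp
    then show ?thesis by (simp only: summable_of_real_iff)
  qed
  have sA1: "summable A" using sA[of 1] by simp
  define D :: "nat \<Rightarrow> complex \<Rightarrow> complex" where "D = (\<lambda>k s. (deriv ^^ k) (\<lambda>s. 1 / (1 - exp (- s))) s)"
  have sumpow: "(\<lambda>n. of_nat n ^ k * exp (- s) ^ n) sums ((- 1) ^ k * D k s)" if "Re s > 0" for s k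
  proof -
    have "summable (\<lambda>n. norm ((- of_nat n) ^ k * exp (- s) ^ n))"
      using summable_power_geometric[of "exp (- Re s)" k] that
      by (simp add: norm_mult norm_power)
    then have "(\<lambda>n. (- of_nat n) ^ k * exp (- s) ^ n) sums D k s"
      unfolding D_def higher_deriv_geometric[OF that] by (rule summable_sums[OF summable_norm_cancel])
    from sums_mult[OF this, of "(- 1) ^ k"]
    have "(\<lambda>n. (- 1) ^ k * ((- of_nat n) ^ k * exp (- s) ^ n)) sums ((- 1) ^ k * D k s)" .
    moreover have "(- 1) ^ k * ((- of_nat n) ^ k * exp (- s) ^ n) = of_nat n ^ k * exp (- s) ^ n" for n
    proof -
      have "(- 1) ^ k * (- of_nat n) ^ k = ((- 1) * (- of_nat n) :: complex) ^ k"
        by (rule power_mult_distrib[symmetric])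
      then show ?thesis by (simp flip: mult.assoc)
    qed
    ultimately show ?thesis by (simp only:)
  qed
  \<comment> \<open>The extra pi covers the value H(0) that separates the transform of H' from
    \<open>csqrt s * daw (of_real pi / csqrt s)\<close>.\<close>
  define B' where "B' = (\<Sum>k. A k * B) + pi"
  have "0 \<le> (\<Sum>k. A k * B)"
    using A0 B(1) by (intro suminf_nonneg summable_mult2 sA1) (auto intro: less_imp_le)
  then have B'0: "B' > 0" using pi_gt_zero unfolding B'_def by linarith
  have main: "summable (\<lambda>n. of_real (comparison n) * exp (- s) ^ n) \<and>
     norm ((\<Sum>n. of_real (comparison n) * exp (- s) ^ n) - csqrt s * daw (of_real pi / csqrt s)) \<le> B'"
    if s: "0 < Re s" "Re s \<le> 1" "\<bar>Im s\<bar> \<le> pi" for s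
  proof -
    define x where "x = Re s"
    have x: "0 < x" "x \<le> 1" using s by (auto simp: x_def)
    define f :: "nat \<Rightarrow> nat \<Rightarrow> complex" where "f = (\<lambda>k n. of_real (comparison_coeff k) * (of_nat n ^ k * exp (- s) ^ n))"
    have nf: "norm (f k n) = comparison_coeff k * (real n ^ k * exp (- x) ^ n)" for k n
      using comparison_coeff_pos[of k] by (simp add: f_def norm_mult norm_power x_def)
    have 1: "summable (\<lambda>n. norm (f k n))" for k
      unfolding nf using x by (intro summable_mult summable_power_geometric) auto
    \<comment> \<open>Absolute values turn each row into the same sum at the real point x, so the
      pole estimate also yields the absolute convergence needed for the interchange.\<close>
    have e: "(\<Sum>n. real n ^ k * exp (- x) ^ n) \<le> fact k / x ^ Suc k + fact k * B" for k
    proof -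
      have sm: "summable (\<lambda>n. real n ^ k * exp (- x) ^ n)"
        using x by (intro summable_power_geometric) auto
      have "(\<lambda>n. of_nat n ^ k * exp (- complex_of_real x) ^ n) sums ((- 1) ^ k * D k (of_real x))"
        by (rule sumpow) (use x in simp)
      then have "(\<lambda>n. complex_of_real (real n ^ k * exp (- x) ^ n)) sums ((- 1) ^ k * D k (of_real x))"
        by (simp flip: exp_of_real)
      with sums_of_real[OF summable_sums[OF sm]]
      have "complex_of_real (\<Sum>n. real n ^ k * exp (- x) ^ n) = (- 1) ^ k * D k (of_real x)"
        by (rule sums_unique2)
      then have "norm (complex_of_real (\<Sum>n. real n ^ k * exp (- x) ^ n)) = norm (D k (of_real x))"
        by (simp only: norm_mult norm_power norm_minus_cancel norm_one power_one mult_1)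
      moreover have "norm (D k (of_real x)) \<le> norm ((- 1) ^ k * fact k / complex_of_real x ^ Suc k) +
          norm (D k (of_real x) - (- 1) ^ k * fact k / complex_of_real x ^ Suc k)"
        by (rule norm_triangle_sub)
      moreover have "norm (D k (of_real x) - (- 1) ^ k * fact k / complex_of_real x ^ Suc k) \<le> fact k * B"
        unfolding D_def by (rule B(2)) (use x in auto)
      moreover have "norm ((- 1) ^ k * fact k / complex_of_real x ^ Suc k) = fact k / x ^ Suc k"
        unfolding norm_divide norm_mult norm_power norm_minus_cancel norm_one norm_of_real norm_fact
        using x by simp
      ultimately show ?thesis by simp
    qed
    have "summable (\<lambda>k. A k / x ^ Suc k + A k * B)"
      using x by (intro summable_add sA summable_mult2 sA1)
    then have 2: "summable (\<lambda>k. \<Sum>n. norm (f k n))"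
    proof (rule summable_comparison_test'[where N = 0])
      fix k
      have "(\<Sum>n. norm (f k n)) = comparison_coeff k * (\<Sum>n. real n ^ k * exp (- x) ^ n)"
        unfolding nf using x by (intro suminf_mult summable_power_geometric) auto
      also have "\<dots> \<le> comparison_coeff k * (fact k / x ^ Suc k + fact k * B)"
        using comparison_coeff_pos[of k] by (intro mult_left_mono e) auto
      also have "\<dots> = A k / x ^ Suc k + A k * B" by (simp add: A_def algebra_simps)
      finally have "(\<Sum>n. norm (f k n)) \<le> A k / x ^ Suc k + A k * B" .
      moreover have "0 \<le> (\<Sum>n. norm (f k n))" by (intro suminf_nonneg 1) auto
      ultimately show "norm (\<Sum>n. norm (f k n)) \<le> A k / x ^ Suc k + A k * B" by simp
    qed
    have col: "(\<Sum>k. f k n) = of_real (comparison n) * exp (- s) ^ n" for n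
    proof -
      have "(\<lambda>k. complex_of_real (comparison_coeff k * real n ^ k) * exp (- s) ^ n) sums (of_real (comparison n) * exp (- s) ^ n)"
        unfolding comparison_def by (intro sums_mult2 sums_of_real summable_sums summable_comparison_coeff)
      then show ?thesis by (simp add: sums_iff f_def mult.assoc)
    qed
    have row: "(\<Sum>n. f k n) = of_real (comparison_coeff k) * ((- 1) ^ k * D k s)" for k
      unfolding f_def by (rule sums_unique[symmetric], intro sums_mult sumpow) (use s in simp)
    have sw: "(\<Sum>k. \<Sum>n. f k n) = (\<Sum>n. \<Sum>k. f k n)" "summable (\<lambda>n. \<Sum>k. f k n)"
      by (rule suminf_swap[OF 1 2])+
    have s0: "s \<noteq> 0" using s by auto
    have main: "(\<lambda>k. of_real (A k) / s ^ Suc k) sums (csqrt s * daw (of_real pi / csqrt s) - of_real pi)"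
      unfolding A_def by (rule daw_inverse_csqrt_sums[OF s0])
    define R where "R = (\<lambda>k. of_real (comparison_coeff k) * ((- 1) ^ k * D k s) - of_real (A k) / s ^ Suc k)"
    have R: "norm (R k) \<le> A k * B" for k
    proof -
      have "R k = of_real (comparison_coeff k) * ((- 1) ^ k * (D k s - (- 1) ^ k * fact k / s ^ Suc k))"
      proof -
        have "(- 1) ^ k * (- 1) ^ k = ((- 1) * (- 1) :: complex) ^ k"
          by (rule power_mult_distrib[symmetric])
        then have "(- 1) ^ k * ((- 1) ^ k * fact k / s ^ Suc k) = fact k / s ^ Suc k"
          by (simp add: times_divide_eq_right[symmetric] del: times_divide_eq_right flip: mult.assoc)
        then show ?thesis by (simp only: right_diff_distrib R_def A_def) simp
      qed
      also have "norm \<dots> = comparison_coeff k * norm (D k s - (- 1) ^ k * fact k / s ^ Suc k)"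
        using comparison_coeff_pos[of k] by (simp add: norm_mult norm_power)
      also have "\<dots> \<le> comparison_coeff k * (fact k * B)"
        unfolding D_def using comparison_coeff_pos[of k] by (intro mult_left_mono B s) auto
      finally show ?thesis by (simp add: A_def)
    qed
    have sAB: "summable (\<lambda>k. A k * B)" by (rule summable_mult2[OF sA1])
    have sR: "summable R" by (rule summable_comparison_test'[OF sAB, of 0]) (rule R)
    have nR: "norm (\<Sum>k. R k) \<le> (\<Sum>k. A k * B)" by (rule norm_suminf_le[OF R sAB])
    have "(\<lambda>k. R k + of_real (A k) / s ^ Suc k) sums ((\<Sum>k. R k) + (csqrt s * daw (of_real pi / csqrt s) - of_real pi))"
      by (intro sums_add summable_sums[OF sR] main)
    then have "(\<Sum>k. \<Sum>n. f k n) = (\<Sum>k. R k) + (csqrt s * daw (of_real pi / csqrt s) - of_real pi)"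
      unfolding row by (simp add: sums_iff R_def)
    then have "(\<Sum>n. of_real (comparison n) * exp (- s) ^ n) - csqrt s * daw (of_real pi / csqrt s) = (\<Sum>k. R k) - of_real pi"
      unfolding sw(1) col by simp
    also have "norm \<dots> \<le> norm (\<Sum>k. R k) + norm (complex_of_real pi)"
      by (rule norm_triangle_ineq4)
    also have "\<dots> \<le> B'" using nR by (simp add: B'_def)
    finally show ?thesis using sw(2) unfolding col by simp
  qed
  from B'0 main show ?thesis by (rule that)
qed

section \<open>Comparison of the coefficients\<close>

lemma power_series_coeff_bound:
  fixes a :: "nat \<Rightarrow> complex"
  assumes sums: "\<And>q. norm q < 1 \<Longrightarrow> (\<lambda>n. a n * q ^ n) sums f q"
    and \<rho>: "0 < \<rho>" "\<rho> < 1" and M: "\<And>q. norm q = \<rho> \<Longrightarrow> norm (f q) \<le> M"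
  shows "norm (a n) \<le> M / \<rho> ^ n"
proof -
  have hol: "f holomorphic_on ball 0 1"
    by (rule power_series_holomorphic[where a = a]) (use sums in simp)
  have "\<forall>\<^sub>F u in nhds 0. u \<in> ball (0 :: complex) 1"
    by (rule eventually_nhds_in_open) auto
  then have "\<forall>\<^sub>F u in nhds 0. (\<lambda>n. fps_nth (Abs_fps a) n * u ^ n) sums f u"
    by eventually_elim (simp add: sums)
  then have "f has_fps_expansion Abs_fps a" by (rule has_fps_expansionI)
  from fps_nth_fps_expansion[OF this, of n] have an: "a n = (deriv ^^ n) f 0 / fact n" by simp
  have "norm ((deriv ^^ n) f 0) \<le> fact n * M / \<rho> ^ n"
  proof (rule Cauchy_inequality)
    have "cball (0 :: complex) \<rho> \<subseteq> ball 0 1" using \<rho> by auto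
    then have hol': "f holomorphic_on cball 0 \<rho>" by (rule holomorphic_on_subset[OF hol])
    show "f holomorphic_on ball 0 \<rho>" by (rule holomorphic_on_subset[OF hol' ball_subset_cball])
    show "continuous_on (cball 0 \<rho>) f" by (rule holomorphic_on_imp_continuous_on[OF hol'])
  qed (use \<rho> M in auto)
  then show ?thesis
    unfolding an norm_divide norm_fact by (simp add: field_simps)
qed

lemma exp_neg_le_power6:
  fixes y :: real
  assumes "y > 0"
  shows "exp (- y) \<le> 720 / y ^ 6"
proof -
  have "sum (\<lambda>j. y ^ j / fact j) {6} \<le> (\<Sum>j. 1 * (y ^ j / fact j))"
    using sum_le_suminf[OF sums_summable[OF exp_sums_mult[of 1 y]], of "{6}"] assms by simp
  then have "y ^ 6 / 720 \<le> exp y"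
    using sums_unique[OF exp_sums_mult[of 1 y]] by (simp add: fact_numeral)
  then show ?thesis using assms by (simp add: exp_minus field_simps)
qed

text \<open>With \<open>\<rho>\<close> = exp(-Re s), |1 - exp(-s)|^2 = (1 - \<open>\<rho>\<close>)^2
  + 2 \<open>\<rho>\<close> (1 - cos(Im s)). Here 2 \<open>\<rho>\<close> \<ge> 1, and the cosine
  term is at least (2/5)(1 - \<open>\<rho>\<close>)^2; finally (11/10)^2 < 7/5.\<close>

lemma one_minus_exp_bound:
  assumes x: "0 < Re s" "Re s \<le> 1 / 2" and y: "Re s \<le> \<bar>Im s\<bar>" "\<bar>Im s\<bar> \<le> pi"
  shows "11 / 10 * (1 - exp (- Re s)) \<le> norm (1 - exp (- s))"
proof -
  define x where "x = Re s"
  define \<rho> where "\<rho> = exp (- x)"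
  have x0: "0 < x" "x \<le> 1 / 2" using x by (auto simp: x_def)
  have \<rho>: "1 - x \<le> \<rho>" "0 < \<rho>" "\<rho> < 1" using exp_ge_add_one_self[of "- x"] x0 by (auto simp: \<rho>_def)
  have "(norm (1 - exp (- s)))\<^sup>2 = (1 - \<rho> * cos (Im s))\<^sup>2 + (\<rho> * sin (Im s))\<^sup>2"
    by (simp add: cmod_power2 Re_exp Im_exp \<rho>_def x_def)
  also have "\<dots> = (1 - \<rho>)\<^sup>2 + 2 * \<rho> * (1 - cos (Im s))"
  proof -
    have "(1 - \<rho> * u)\<^sup>2 + (\<rho> * v)\<^sup>2 = (1 - \<rho>)\<^sup>2 + 2 * \<rho> * (1 - u) + \<rho>\<^sup>2 * (u\<^sup>2 + v\<^sup>2 - 1)" for u v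
      by (simp add: power2_eq_square algebra_simps)
    then show ?thesis by simp
  qed
  finally have eq: "(norm (1 - exp (- s)))\<^sup>2 = (1 - \<rho>)\<^sup>2 + 2 * \<rho> * (1 - cos (Im s))" .
  have "cos \<bar>Im s\<bar> \<le> cos x"
    using x0 y by (intro cos_monotone_0_pi_le) (auto simp: x_def)
  then have c: "1 - cos x \<le> 1 - cos (Im s)" by simp
  \<comment> \<open>From 1 - cos x = 2 sin^2(x/2) and sin t \<ge> (9/10) t for t \<le> 1/4 comes the
    factor 81/200, which exceeds 2/5.\<close>
  define t where "t = x / 2"
  have t: "0 < t" "t \<le> 1 / 4" using x0 by (auto simp: t_def)
  have "t ^ 3 \<le> t * (1 / 16)"
    using mult_mono[of t "1/4" t "1/4"] t by (simp add: power3_eq_cube)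
  moreover have "\<bar>sin t - t\<bar> \<le> t ^ 3 / 6"
    using Maclaurin_sin_bound[of t 3] t by (simp add: sin_coeff_def eval_nat_numeral)
  ultimately have st: "9 / 10 * t \<le> sin t" using t by linarith
  have "2 * (9 / 10 * t)\<^sup>2 \<le> 2 * (sin t)\<^sup>2"
    using st t by (intro mult_left_mono power_mono) auto
  also have "\<dots> = 1 - cos x"
    using cos_double_sin[of t] by (simp add: t_def)
  finally have "81 / 200 * x\<^sup>2 \<le> 1 - cos x"
    by (simp add: t_def power2_eq_square)
  then have cc: "2 / 5 * x\<^sup>2 \<le> 1 - cos x"
    using zero_le_power2[of x] by linarith
  have "(1 - \<rho>)\<^sup>2 \<le> x\<^sup>2" using \<rho> by (intro power_mono) auto
  have "(11 / 10 * b)\<^sup>2 \<le> b\<^sup>2 + 2 / 5 * b\<^sup>2" for b :: real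
    by (simp add: power2_eq_square)
  then have "(11 / 10 * (1 - \<rho>))\<^sup>2 \<le> (1 - \<rho>)\<^sup>2 + 2 / 5 * (1 - \<rho>)\<^sup>2" .
  also have "2 / 5 * (1 - \<rho>)\<^sup>2 \<le> 2 / 5 * x\<^sup>2"
    using \<open>(1 - \<rho>)\<^sup>2 \<le> x\<^sup>2\<close> by simp
  also have "2 / 5 * x\<^sup>2 \<le> 1 - cos (Im s)" using c cc by linarith
  also have "1 - cos (Im s) \<le> 2 * \<rho> * (1 - cos (Im s))"
    using \<rho> x0 mult_right_mono[of 1 "2 * \<rho>" "1 - cos (Im s)"] by simp
  finally have "(11 / 10 * (1 - \<rho>))\<^sup>2 \<le> (norm (1 - exp (- s)))\<^sup>2"
    using eq by simp
  then show ?thesis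
    unfolding \<rho>_def x_def by (rule power2_le_imp_le) simp
qed

text \<open>In the sector both functions are multiples of sqrt s exp(a/s) up to relative error
  |s|^6, and \<kappa> makes the leading terms cancel. Outside, each is separately of size exp((a -
  1/11)/Re s), which is smaller than any power of Re s times exp(a/Re s).\<close>

lemma gf_difference_bound:
  obtains \<kappa> K where "\<kappa> \<noteq> 0" "K > 0" "\<And>s. \<lbrakk>0 < Re s; Re s \<le> 1 / 2; \<bar>Im s\<bar> \<le> pi\<rbrakk> \<Longrightarrow>
     norm (exp (log_gf (exp (- s))) - \<kappa> * (\<Sum>n. of_real (comparison n) * exp (- s) ^ n)) \<le>
       K * Re s ^ 6 * exp (pi\<^sup>2 / 4 / Re s)"
proof -
  define a where "a = pi\<^sup>2 / 4"
  have "3 * 3 \<le> pi * pi" using pi_gt3 by (intro mult_mono) auto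
  then have a: "a \<ge> 2" by (simp add: a_def power2_eq_square)
  obtain c K1 where K1: "c \<noteq> 0" "K1 > 0" "\<And>s. s \<in> sector \<Longrightarrow>
    norm (exp (log_gf (exp (- s))) - c * csqrt s * exp (of_real (pi\<^sup>2 / 4) / s)) \<le>
      K1 * norm s ^ Suc 5 * norm (csqrt s * exp (of_real (pi\<^sup>2 / 4) / s))"
    by (rule gf_asymp) blast
  obtain \<gamma> K2 where K2: "\<gamma> \<noteq> 0" "K2 > 0" "\<And>s. s \<in> sector \<Longrightarrow>
    norm (gauss_int (of_real pi / csqrt s) - \<gamma>) \<le> K2 * norm s ^ Suc 5"
    by (rule gauss_int_asymp) blast
  obtain B where B: "B > 0" "\<And>s. \<lbrakk>0 < Re s; Re s \<le> 1; \<bar>Im s\<bar> \<le> pi\<rbrakk> \<Longrightarrow>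
     summable (\<lambda>n. of_real (comparison n) * exp (- s) ^ n) \<and>
     norm ((\<Sum>n. of_real (comparison n) * exp (- s) ^ n) - csqrt s * daw (of_real pi / csqrt s)) \<le> B"
    by (rule comparison_gf) blast
  \<comment> \<open>The generating functions have leading coefficients c and \<gamma>; this is the
    ratio that matches them.\<close>
  define \<kappa> where "\<kappa> = c / \<gamma>"
  define k where "k = norm \<kappa>"
  have \<kappa>0: "\<kappa> \<noteq> 0" using K1 K2 by (simp add: \<kappa>_def)
  then have k0: "k > 0" by (simp add: k_def)
  define q6 where "q6 = (\<lambda>x. x ^ 6 * exp (a / x))"
  \<comment> \<open>A fixed gain in the exponent is exchanged for the sixth power, through exp(-y)
    \<le> 6!/y^6 with y = \<delta>/x.\<close>
  have absorb: "exp ((a - \<delta>) / x) \<le> 720 / \<delta> ^ 6 * q6 x" if "x > 0" "\<delta> > 0" for x \<delta>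
  proof -
    have "exp ((a - \<delta>) / x) = exp (a / x) * exp (- (\<delta> / x))"
      by (simp add: diff_divide_distrib flip: exp_add)
    also have "\<dots> \<le> exp (a / x) * (720 / (\<delta> / x) ^ 6)"
      using that by (intro mult_left_mono exp_neg_le_power6) auto
    also have "\<dots> = 720 / \<delta> ^ 6 * q6 x" by (simp add: q6_def power_divide)
    finally show ?thesis .
  qed
  have one: "1 \<le> 720 * q6 x" if "x > 0" for x
  proof -
    have "1 \<le> exp ((a - 1) / x)" using a that by simp
    also have "\<dots> \<le> 720 * q6 x" using absorb[OF that, of 1] by simp
    finally show ?thesis .
  qed
  define M where "M = (\<lambda>s. csqrt s * exp (of_real a / s))"
  have nM: "norm (M s) \<le> exp (a / Re s)" if "s \<in> sector" for s
  proof -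
    have s: "0 < Re s" "norm s \<le> 1" using that by (auto simp: sector_def)
    have "norm (csqrt s) \<le> 1" using s by (simp add: norm_csqrt)
    moreover have "Re (of_real a / s) \<le> a / Re s"
    proof -
      have "Re (of_real a / s) \<le> norm (of_real a / s)" by (rule complex_Re_le_cmod)
      also have "\<dots> = a / norm s" using a by (simp add: norm_divide)
      also have "\<dots> \<le> a / Re s"
        using s a complex_Re_le_cmod[of s] by (intro divide_left_mono mult_pos_pos) auto
      finally show ?thesis .
    qed
    ultimately have "norm (csqrt s) * exp (Re (of_real a / s)) \<le> 1 * exp (a / Re s)"
      by (intro mult_mono) auto
    then show ?thesis by (simp add: M_def norm_mult)
  qed
  \<comment> \<open>For v = pi/sqrt s the exponent v^2/4 is a/s, so the growth of \<open>daw\<close>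
    is exactly the exponential in M and only the convergent Gaussian integral remains.\<close>
  have csd: "csqrt s * daw (of_real pi / csqrt s) = M s * gauss_int (of_real pi / csqrt s)" for s
  proof -
    have "(of_real pi / csqrt s)\<^sup>2 / 4 = of_real a / s" by (simp add: a_def power_divide)
    then show ?thesis
      by (simp add: gauss_int_def M_def exp_minus)
  qed
  define C :: "complex \<Rightarrow> complex" where "C = (\<lambda>s. \<Sum>n. of_real (comparison n) * exp (- s) ^ n)"
  define G :: "complex \<Rightarrow> complex" where "G = (\<lambda>s. exp (log_gf (exp (- s))))"
  define L1 where "L1 = (K1 + k * K2) * 64 + k * B * 720"
  define L2 where "L2 = (norm c + K1) * (720 / (1 / 11) ^ 6) + k * (B * 720 + pi * (720 / (1 / 11) ^ 6))"
  have pos: "K1 + k * K2 > 0" "L1 > 0" "L2 > 0"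
    using K1 K2 B k0 by (auto simp: L1_def L2_def intro!: add_pos_pos mult_pos_pos add_nonneg_pos)
  have q60: "q6 x > 0" if "x > 0" for x using that by (simp add: q6_def)
  have in_sec: "norm (G s - \<kappa> * C s) \<le> L1 * q6 (Re s)"
    if s: "0 < Re s" "Re s \<le> 1 / 2" "\<bar>Im s\<bar> \<le> Re s" for s
  proof -
    define x where "x = Re s"
    have x: "0 < x" "x \<le> 1 / 2" using s by (auto simp: x_def)
    have ns: "norm s \<le> 2 * x" using cmod_le[of s] s by (auto simp: x_def)
    have sec: "s \<in> sector" using s ns x by (auto simp: sector_def)
    have n6: "norm s ^ Suc 5 \<le> 64 * x ^ 6"
      using power_mono[OF ns, of 6] by (simp add: power_mult_distrib)
    define g where "g = gauss_int (of_real pi / csqrt s)"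
    have e: "G s - \<kappa> * C s = (G s - c * M s) - \<kappa> * M s * (g - \<gamma>) - \<kappa> * (C s - M s * g)"
    proof -
      have "c = \<kappa> * \<gamma>" using K2(1) by (simp add: \<kappa>_def)
      then show ?thesis by (simp only:) (simp add: algebra_simps)
    qed
    have "norm (G s - \<kappa> * C s) \<le> norm (G s - c * M s) + norm (\<kappa> * M s * (g - \<gamma>)) + norm (\<kappa> * (C s - M s * g))"
      unfolding e by (intro order_trans[OF norm_triangle_ineq4] add_right_mono norm_triangle_ineq4)
    also have "norm (G s - c * M s) \<le> K1 * norm s ^ Suc 5 * norm (M s)"
      using K1(3)[OF sec] by (simp add: G_def M_def a_def mult.assoc)
    also have "norm (\<kappa> * M s * (g - \<gamma>)) \<le> k * norm (M s) * (K2 * norm s ^ Suc 5)"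
      unfolding norm_mult k_def g_def by (intro mult_left_mono K2(3) sec) auto
    also have "norm (\<kappa> * (C s - M s * g)) \<le> k * B"
    proof -
      have "norm (C s - M s * g) \<le> B"
        using B(2)[of s] s pi_gt3 unfolding C_def g_def csd by auto
      then show ?thesis unfolding norm_mult k_def by (intro mult_left_mono) auto
    qed
    also have "K1 * norm s ^ Suc 5 * norm (M s) + k * norm (M s) * (K2 * norm s ^ Suc 5) =
        (K1 + k * K2) * (norm s ^ Suc 5 * norm (M s))"
      by (simp add: algebra_simps)
    also have "\<dots> \<le> (K1 + k * K2) * (64 * x ^ 6 * exp (a / x))"
      using n6 nM[OF sec] pos x by (intro mult_left_mono mult_mono) (auto simp: x_def)
    also have "k * B \<le> k * B * (720 * q6 x)"
      using one[OF x(1)] k0 B(1) mult_left_mono[of 1 "720 * q6 x" "k * B"] by simp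
    finally show ?thesis
      by (simp add: L1_def x_def q6_def algebra_simps)
  qed
  have off_sec: "norm (G s - \<kappa> * C s) \<le> L2 * q6 (Re s)"
    if s: "0 < Re s" "Re s \<le> 1 / 2" "Re s \<le> \<bar>Im s\<bar>" "\<bar>Im s\<bar> \<le> pi" for s
  proof -
    define x where "x = Re s"
    have x: "0 < x" "x \<le> 1 / 2" using s by (auto simp: x_def)
    define \<rho> where "\<rho> = exp (- x)"
    have \<rho>: "1 - x \<le> \<rho>" "0 < \<rho>" "\<rho> < 1" using exp_ge_add_one_self[of "- x"] x by (auto simp: \<rho>_def)
    have n\<rho>: "norm (exp (- s)) = \<rho>" by (simp add: \<rho>_def x_def)
    have sec: "complex_of_real x \<in> sector" using x by (auto simp: sector_def)
    have Gx: "norm (G (of_real x)) \<le> (norm c + K1) * exp (a / x)"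
    proof -
      have n1: "norm (complex_of_real x) ^ Suc 5 \<le> 1" using x by (intro power_le_one) auto
      have "norm (G (of_real x)) \<le> norm (c * M (of_real x)) + norm (G (of_real x) - c * M (of_real x))"
        by (rule norm_triangle_sub)
      also have "norm (G (of_real x) - c * M (of_real x)) \<le> K1 * norm (complex_of_real x) ^ Suc 5 * norm (M (of_real x))"
        using K1(3)[OF sec] by (simp add: G_def M_def a_def mult.assoc)
      also have "\<dots> \<le> K1 * 1 * norm (M (of_real x))"
        using n1 K1 by (intro mult_right_mono mult_left_mono) auto
      finally have "norm (G (of_real x)) \<le> (norm c + K1) * norm (M (of_real x))"
        by (simp add: norm_mult algebra_simps)
      also have "\<dots> \<le> (norm c + K1) * exp (a / x)"
        using nM[OF sec] K1 by (intro mult_left_mono) auto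
      finally show ?thesis .
    qed
    have "norm (G s) \<le> norm (G (of_real x)) * exp (2 * \<rho> / norm (1 - exp (- s)) - 2 * \<rho> / (1 - \<rho>))"
    proof -
      have "complex_of_real \<rho> = exp (- complex_of_real x)" by (simp add: \<rho>_def flip: exp_of_real)
      then show ?thesis
        using norm_exp_log_gf_le[of "exp (- s)"] \<rho> unfolding n\<rho> G_def by simp
    qed
    also have "\<dots> \<le> ((norm c + K1) * exp (a / x)) * exp (- ((1 / 11) / x))"
    proof (intro mult_mono Gx)
      \<comment> \<open>The factor 11/10 turns the difference of linear terms into -(1/11) 2
        \<open>\<rho>\<close>/(1 - \<open>\<rho>\<close>), and 2 \<open>\<rho>\<close>/(1 -
        \<open>\<rho>\<close>) \<ge> 1/x because 2 \<open>\<rho>\<close> \<ge> 1 and 1 -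
        \<open>\<rho>\<close> \<le> x.\<close>
      have "2 * \<rho> / norm (1 - exp (- s)) \<le> 2 * \<rho> / (11 / 10 * (1 - \<rho>))"
        using one_minus_exp_bound[OF s] \<rho>
        by (intro divide_left_mono mult_pos_pos) (auto simp: \<rho>_def x_def intro: less_le_trans[rotated])
      also have "\<dots> - 2 * \<rho> / (1 - \<rho>) = - (1 / 11) * (2 * \<rho> / (1 - \<rho>))"
      proof -
        have *: "2 * \<rho> / (11 / 10 * b) - 2 * \<rho> / b = - (1 / 11) * (2 * \<rho> / b)" if "b \<noteq> 0" for b
          using that by (simp add: field_simps)
        show ?thesis by (rule *) (use \<rho> in simp)
      qed
      finally have "2 * \<rho> / norm (1 - exp (- s)) - 2 * \<rho> / (1 - \<rho>) \<le> - (1 / 11) * (2 * \<rho> / (1 - \<rho>))" by simp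
      moreover have "1 / x \<le> 2 * \<rho> / (1 - \<rho>)"
        using \<rho> x by (intro frac_le) auto
      then have "(1 / 11) * (1 / x) \<le> (1 / 11) * (2 * \<rho> / (1 - \<rho>))"
        by (intro mult_left_mono) auto
      moreover have "(1 / 11) / x = (1 / 11) * (1 / x)" by simp
      ultimately have "2 * \<rho> / norm (1 - exp (- s)) - 2 * \<rho> / (1 - \<rho>) \<le> - ((1 / 11) / x)"
        by linarith
      then show "exp (2 * \<rho> / norm (1 - exp (- s)) - 2 * \<rho> / (1 - \<rho>)) \<le> exp (- ((1 / 11) / x))"
        by simp
    qed (use K1 in auto)
    also have "\<dots> = (norm c + K1) * exp ((a - 1 / 11) / x)"
      by (simp add: diff_divide_distrib mult.assoc flip: exp_add)
    also have "\<dots> \<le> (norm c + K1) * (720 / (1 / 11) ^ 6 * q6 x)"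
      using K1 x by (intro mult_left_mono absorb) auto
    finally have nG: "norm (G s) \<le> (norm c + K1) * (720 / (1 / 11) ^ 6 * q6 x)" .
    have s0: "s \<noteq> 0" using s by auto
    \<comment> \<open>Off the sector |s| \<ge> sqrt 2 x, and 7/5 < sqrt 2. So a/|s| \<le> (5/7) a/x,
      which is below (a - 1/11)/x since a \<ge> 2.\<close>
    have ns: "7 / 5 * x \<le> norm s"
    proof -
      have "x\<^sup>2 \<le> (Im s)\<^sup>2" using s by (intro abs_le_square_iff[THEN iffD1]) (auto simp: x_def)
      moreover have "(7 / 5 * x)\<^sup>2 = 49 / 25 * x\<^sup>2" by (simp add: power2_eq_square)
      moreover have "(norm s)\<^sup>2 = x\<^sup>2 + (Im s)\<^sup>2" by (simp add: cmod_power2 x_def)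
      ultimately have "(7 / 5 * x)\<^sup>2 \<le> (norm s)\<^sup>2"
        using zero_le_power2[of x] by linarith
      then show ?thesis by (rule power2_le_imp_le) simp
    qed
    have "norm (csqrt s * daw (of_real pi / csqrt s)) \<le> pi * exp (a / norm s)"
    proof -
      have n0: "norm (csqrt s) > 0" using s0 by simp
      have "norm (daw (of_real pi / csqrt s)) \<le> norm (of_real pi / csqrt s) * exp ((norm (of_real pi / csqrt s))\<^sup>2 / 4)"
        by (rule norm_daw_le)
      also have "(norm (of_real pi / csqrt s))\<^sup>2 / 4 = a / norm s"
        by (simp add: norm_divide power_divide norm_csqrt a_def)
      also have "norm (of_real pi / csqrt s) = pi / norm (csqrt s)" by (simp add: norm_divide)
      finally have "norm (csqrt s) * norm (daw (of_real pi / csqrt s)) \<le> norm (csqrt s) * (pi / norm (csqrt s) * exp (a / norm s))"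
        by (intro mult_left_mono) auto
      then show ?thesis using n0 by (simp add: norm_mult)
    qed
    also have "a / norm s \<le> (a - 1 / 11) / x"
    proof -
      have "a / norm s \<le> a / (7 / 5 * x)"
        using ns x a by (intro divide_left_mono mult_pos_pos) (auto intro: less_le_trans[rotated])
      also have "\<dots> = (a * (5 / 7)) / x" by simp
      also have "\<dots> \<le> (a - 1 / 11) / x" using x a by (intro divide_right_mono) auto
      finally show ?thesis .
    qed
    also have "exp ((a - 1 / 11) / x) \<le> 720 / (1 / 11) ^ 6 * q6 x"
      using x by (intro absorb) auto
    finally have nd: "norm (csqrt s * daw (of_real pi / csqrt s)) \<le> pi * (720 / (1 / 11) ^ 6 * q6 x)"
      by simp
    have "norm (C s) \<le> norm (csqrt s * daw (of_real pi / csqrt s)) + norm (C s - csqrt s * daw (of_real pi / csqrt s))"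
      by (rule norm_triangle_sub)
    also have "norm (C s - csqrt s * daw (of_real pi / csqrt s)) \<le> B"
      using B(2)[of s] s unfolding C_def by auto
    also have "B \<le> B * (720 * q6 x)"
      using one[OF x(1)] B(1) mult_left_mono[of 1 "720 * q6 x" B] by simp
    finally have nC: "norm (C s) \<le> pi * (720 / (1 / 11) ^ 6 * q6 x) + B * (720 * q6 x)"
      using nd by simp
    have "norm (G s - \<kappa> * C s) \<le> norm (G s) + k * norm (C s)"
      using norm_triangle_ineq4[of "G s" "\<kappa> * C s"] by (simp add: norm_mult k_def)
    also have "\<dots> \<le> (norm c + K1) * (720 / (1 / 11) ^ 6 * q6 x) + k * (pi * (720 / (1 / 11) ^ 6 * q6 x) + B * (720 * q6 x))"
      using nG nC k0 by (intro add_mono mult_left_mono) auto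
    also have "\<dots> = L2 * q6 x" unfolding L2_def by (simp only: distrib_left distrib_right mult_ac)
    finally show ?thesis by (simp add: x_def)
  qed
  show ?thesis
  proof (rule that[of \<kappa> "L1 + L2"])
    show "\<kappa> \<noteq> 0" by (rule \<kappa>0)
    show "L1 + L2 > 0" using pos by simp
    fix s assume s: "0 < Re s" "Re s \<le> 1 / 2" "\<bar>Im s\<bar> \<le> pi"
    have "norm (G s - \<kappa> * C s) \<le> (L1 + L2) * q6 (Re s)"
    proof (cases "\<bar>Im s\<bar> \<le> Re s")
      case True
      have "0 \<le> L2 * q6 (Re s)" using pos(3) q60[OF s(1)] by simp
      then show ?thesis using in_sec[OF s(1,2) True] unfolding distrib_right by linarith
    next
      case False
      have "0 \<le> L1 * q6 (Re s)" using pos(2) q60[OF s(1)] by simp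
      moreover have "norm (G s - \<kappa> * C s) \<le> L2 * q6 (Re s)"
        by (rule off_sec[OF s(1,2) _ s(3)]) (use False in simp)
      ultimately show ?thesis unfolding distrib_right by linarith
    qed
    then show "norm (exp (log_gf (exp (- s))) - \<kappa> * (\<Sum>n. of_real (comparison n) * exp (- s) ^ n)) \<le>
       (L1 + L2) * Re s ^ 6 * exp (pi\<^sup>2 / 4 / Re s)"
      by (simp add: G_def C_def q6_def a_def mult.assoc)
  qed
qed

lemma comparison_nonneg: "comparison n \<ge> 0"
  unfolding comparison_def
  by (intro suminf_nonneg summable_comparison_coeff mult_nonneg_nonneg less_imp_le[OF comparison_coeff_pos]) simp

lemma summable_comparison:
  assumes "norm q < 1"
  shows "summable (\<lambda>n. of_real (comparison n) * q ^ n :: complex)"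
proof -
  obtain B where B: "\<And>s. \<lbrakk>0 < Re s; Re s \<le> 1; \<bar>Im s\<bar> \<le> pi\<rbrakk> \<Longrightarrow>
     summable (\<lambda>n. of_real (comparison n) * exp (- s) ^ n) \<and>
     norm ((\<Sum>n. of_real (comparison n) * exp (- s) ^ n) - csqrt s * daw (of_real pi / csqrt s)) \<le> B"
    by (rule comparison_gf) blast
  have "max (norm q) (exp (- 1)) < 1" using assms by simp
  then obtain r where r: "max (norm q) (exp (- 1)) < r" "r < 1" using dense by blast
  define x where "x = - ln r"
  have r0: "r > 0" using r(1) exp_gt_zero[of "- 1 :: real"] by linarith
  have "ln (exp (- 1)) < ln r" using r r0 by (subst ln_less_cancel_iff) auto
  then have x: "0 < x" "x \<le> 1" using r r0 by (auto simp: x_def)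
  have "exp (- complex_of_real x) = of_real (exp (- x))"
    by (simp flip: exp_of_real)
  also have "exp (- x) = r" using r0 by (simp add: x_def)
  finally have "exp (- complex_of_real x) = of_real r" .
  with B[of "of_real x"] x have "summable (\<lambda>n. of_real (comparison n) * complex_of_real r ^ n)"
    by simp
  then show ?thesis
    by (rule powser_inside) (use r r0 in simp)
qed

text \<open>Cauchy's inequality for the difference on |q| = exp(-x). The choice x = pi/(2 sqrt n)
  minimizes pi^2/(4 x) + n x, with minimum pi sqrt n.\<close>

lemma overpartitions_comparison_bound:
  obtains k K where "k > 0" "K > 0" "\<And>n. n \<ge> 16 \<Longrightarrow>
    \<bar>real (overpartitions n) - k * comparison n\<bar> \<le> K * exp (pi * sqrt (real n)) / real n ^ 3"
proof -
  obtain \<kappa> K where K: "\<kappa> \<noteq> 0" "K > 0" "\<And>s. \<lbrakk>0 < Re s; Re s \<le> 1 / 2; \<bar>Im s\<bar> \<le> pi\<rbrakk> \<Longrightarrow>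
     norm (exp (log_gf (exp (- s))) - \<kappa> * (\<Sum>n. of_real (comparison n) * exp (- s) ^ n)) \<le>
       K * Re s ^ 6 * exp (pi\<^sup>2 / 4 / Re s)"
    by (rule gf_difference_bound) blast
  define a where "a = (\<lambda>n. of_nat (overpartitions n) - \<kappa> * of_real (comparison n))"
  define f where "f = (\<lambda>q. exp (log_gf q) - \<kappa> * (\<Sum>n. of_real (comparison n) * q ^ n))"
  have sums: "(\<lambda>n. a n * q ^ n) sums f q" if "norm q < 1" for q
  proof -
    have "(\<lambda>n. of_nat (overpartitions n) * q ^ n - \<kappa> * (of_real (comparison n) * q ^ n)) sums f q"
      unfolding f_def by (intro sums_diff sums_mult overpartitions_sums summable_sums summable_comparison that)
    then show ?thesis by (simp add: a_def algebra_simps)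
  qed
  have bound: "\<bar>real (overpartitions n) - norm \<kappa> * comparison n\<bar> \<le> K * (pi / 2) ^ 6 * exp (pi * sqrt (real n)) / real n ^ 3"
    if n: "n \<ge> 16" for n
  proof -
    define y where "y = sqrt (real n)"
    \<comment> \<open>This is where n \<ge> 16 enters: with pi < 4 it gives x \<le> 1/2, the range
      of the generating function estimate.\<close>
    have "sqrt 16 \<le> y" unfolding y_def using n by (intro real_sqrt_le_mono) simp
    then have y4: "y \<ge> 4" by simp
    have y2: "y * y = real n" by (simp add: y_def)
    define x where "x = pi / (2 * y)"
    have x: "0 < x" "x \<le> 1 / 2"
      using y4 pi_less_4 by (auto simp: x_def field_simps)
    have "norm (a n) \<le> (K * x ^ 6 * exp (pi\<^sup>2 / 4 / x)) / exp (- x) ^ n"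
    proof (rule power_series_coeff_bound[OF sums])
      fix q :: complex assume q: "norm q = exp (- x)"
      define s where "s = - Ln q"
      have q0: "q \<noteq> 0" using q by auto
      have s: "exp (- s) = q" "Re s = x" "\<bar>Im s\<bar> \<le> pi"
        using q0 q Im_Ln_le_pi[OF q0] mpi_less_Im_Ln[OF q0] by (auto simp: s_def)
      show "norm (f q) \<le> K * x ^ 6 * exp (pi\<^sup>2 / 4 / x)"
        using K(3)[of s] s x by (simp add: f_def)
    qed (use x in auto)
    also have "(K * x ^ 6 * exp (pi\<^sup>2 / 4 / x)) / exp (- x) ^ n = K * x ^ 6 * (exp (pi\<^sup>2 / 4 / x) * exp (real n * x))"
    proof -
      have "exp (- x) ^ n = exp (real n * (- x))" by (simp only: exp_of_nat_mult)
      also have "\<dots> = inverse (exp (real n * x))" by (simp add: exp_minus)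
      finally show ?thesis by (simp only: divide_inverse inverse_inverse_eq mult.assoc)
    qed
    also have "exp (pi\<^sup>2 / 4 / x) * exp (real n * x) = exp (pi * y)"
    proof -
      have "pi\<^sup>2 / 4 / x + real n * x = pi * y"
        using y4 by (simp add: x_def power2_eq_square flip: y2)
      then show ?thesis by (simp flip: exp_add)
    qed
    also have "x ^ 6 = (pi / 2) ^ 6 / real n ^ 3"
    proof -
      have "y ^ 6 = real n ^ 3" unfolding y2[symmetric] by (simp add: eval_nat_numeral)
      then show ?thesis by (simp add: x_def power_divide power_mult_distrib)
    qed
    finally have na: "norm (a n) \<le> K * (pi / 2) ^ 6 * exp (pi * y) / real n ^ 3" by simp
    \<comment> \<open>The constant \<kappa> is only known to be complex and nonzero. Both sequences
      are nonnegative, so the reverse triangle inequality replaces it by its modulus.\<close>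
    have "\<bar>norm (complex_of_nat (overpartitions n)) - norm (\<kappa> * of_real (comparison n))\<bar> \<le> norm (a n)"
      unfolding a_def by (rule norm_triangle_ineq3)
    with na show ?thesis
      using comparison_nonneg[of n] by (simp add: norm_mult y_def)
  qed
  show ?thesis
    by (rule that[of "norm \<kappa>" "K * (pi / 2) ^ 6"]) (use K bound in auto)
qed

section \<open>Logarithms and second differences\<close>

text \<open>The part of H'(n) carried by the growing exponential. Its last factor is kept exactly,
  because a relative change of order n^(-1/2) exceeds the admissible error o(n^(-3/2)).\<close>

definition main_term :: "nat \<Rightarrow> real" where
  "main_term n = pi / 4 * exp (pi * sqrt (real n)) / real n * (1 - 1 / (pi * sqrt (real n)))"

lemma comparison_eq_main_term:
  assumes "n > 0"
  defines "r \<equiv> pi * sqrt (real n)"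
  shows "comparison n = main_term n + pi / 4 * exp (- r) / real n * (1 + 1 / r)"
proof -
  define y where "y = sqrt (real n)"
  have y: "y > 0" "y * y = real n" using assms by (auto simp: y_def)
  have "comparison n = (r * cosh r - sinh r) / (2 * y ^ 3)"
    using comparison_sums[OF assms(1)] by (simp add: sums_iff comparison_def r_def y_def)
  also have "r * cosh r - sinh r = ((r - 1) * exp r + (r + 1) * exp (- r)) / 2"
    by (simp add: cosh_field_def sinh_field_def field_simps)
  finally have "comparison n = ((r - 1) * exp r + (r + 1) * exp (- r)) / (4 * y ^ 3)" by simp
  also have "\<dots> = pi / 4 * exp r / (y * y) * (1 - 1 / (pi * y)) + pi / 4 * exp (- r) / (y * y) * (1 + 1 / (pi * y))"
    using y(1) unfolding r_def y_def[symmetric] by (simp add: field_simps power3_eq_cube)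
  finally show ?thesis unfolding main_term_def y(2) r_def y_def by simp
qed

lemma main_factor_pos:
  assumes "n > 0"
  shows "1 - 1 / (pi * sqrt (real n)) > 0"
proof -
  have "1 * 1 < pi * sqrt (real n)"
    using pi_gt3 assms by (intro mult_less_le_imp_less) auto
  then show ?thesis by simp
qed

lemma main_term_pos: "n > 0 \<Longrightarrow> main_term n > 0"
  unfolding main_term_def by (intro mult_pos_pos divide_pos_pos main_factor_pos) auto

text \<open>The relative error is O(n^(-2)), and |ln(1 + R)| \<le> 2 |R| for |R| \<le> 1/2 carries
  it over to the logarithm, well within the order n^(-3/2) that is needed.\<close>

lemma overpartitions_asymp:
  obtains k where "k > 0" "eventually (\<lambda>n. overpartitions n > 0) sequentially"
    "(\<lambda>n. real n powr (3 / 2) * (ln (real (overpartitions n)) - ln k - ln (main_term n))) \<longlonglongrightarrow> 0"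
proof -
  obtain k K where K: "k > 0" "K > 0" "\<And>n. n \<ge> 16 \<Longrightarrow>
    \<bar>real (overpartitions n) - k * comparison n\<bar> \<le> K * exp (pi * sqrt (real n)) / real n ^ 3"
    by (rule overpartitions_comparison_bound) blast
  define R where "R = (\<lambda>n. real (overpartitions n) / (k * main_term n) - 1)"
  \<comment> \<open>The first summand is the Cauchy error relative to the main term, the second the
    decaying exponential of H'; the prefactor undoes the last factor of
    \<open>main_term\<close>.\<close>
  define h where "h = (\<lambda>n::nat. 1 / (1 - 1 / (pi * sqrt (real n))) *
     (4 * K / (pi * k) / real n ^ 2 + exp (- 2 * (pi * sqrt (real n))) * (1 + 1 / (pi * sqrt (real n)))))"
  have Rh: "\<bar>R n\<bar> \<le> h n" if n: "n \<ge> 16" for n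
  proof -
    define r where "r = pi * sqrt (real n)"
    define m where "m = main_term n"
    have m: "m > 0" using main_term_pos[of n] n by (simp add: m_def)
    define d where "d = pi / 4 * exp (- r) / real n * (1 + 1 / r)"
    have r: "r > 0" using n by (simp add: r_def)
    have d0: "d \<ge> 0" using r by (simp add: d_def)
    have c: "comparison n = m + d" using comparison_eq_main_term[of n] n by (simp add: m_def d_def r_def)
    have me: "m = pi / 4 * exp r / real n * (1 - 1 / r)" by (simp add: m_def main_term_def r_def)
    have f0: "1 - 1 / r > 0" using main_factor_pos[of n] n by (simp add: r_def)
    have "R n = (real (overpartitions n) - k * comparison n) / (k * m) + d / m"
      using K m unfolding R_def m_def[symmetric] c by (simp add: field_simps)
    also have "\<bar>\<dots>\<bar> \<le> \<bar>(real (overpartitions n) - k * comparison n) / (k * m)\<bar> + \<bar>d / m\<bar>"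
      by (rule abs_triangle_ineq)
    also have "\<dots> = \<bar>real (overpartitions n) - k * comparison n\<bar> / (k * m) + d / m"
      using K m d0 by (simp add: abs_divide)
    also have "\<dots> \<le> (K * exp r / real n ^ 3) / (k * m) + d / m"
      using K(3)[OF n] K(1) m by (intro add_right_mono divide_right_mono) (auto simp: r_def)
    also have "(K * exp r / real n ^ 3) / (k * m) = 1 / (1 - 1 / r) * (4 * K / (pi * k) / real n ^ 2)"
      using n K(1) unfolding me by (simp add: power2_eq_square power3_eq_cube mult_ac)
    also have "d / m = 1 / (1 - 1 / r) * (exp (- 2 * r) * (1 + 1 / r))"
    proof -
      have "exp (- 2 * r) = exp (- r) / exp r" by (simp flip: exp_diff)
      then show ?thesis unfolding d_def me using n by simp
    qed
    finally show ?thesis by (simp add: h_def r_def distrib_left)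
  qed
  have h: "(\<lambda>n. real n powr (3 / 2) * h n) \<longlonglongrightarrow> 0"
    unfolding h_def by real_asymp
  have h0: "h \<longlonglongrightarrow> 0"
    unfolding h_def by real_asymp
  have ev: "\<forall>\<^sub>F n in sequentially. \<bar>R n\<bar> \<le> h n \<and> h n < 1 / 2 \<and> n > 0"
  proof -
    have "\<forall>\<^sub>F n in sequentially. h n < 1 / 2" by (rule order_tendstoD(2)[OF h0]) simp
    then show ?thesis using eventually_ge_at_top[of 16]
    proof eventually_elim
      case (elim n)
      then show ?case using Rh[of n] by simp
    qed
  qed
  show ?thesis
  proof (rule that[OF K(1)])
    show "\<forall>\<^sub>F n in sequentially. overpartitions n > 0"
      using ev
    proof eventually_elim
      case (elim n)
      then have "R n > - 1" by linarith
      then show ?case unfolding R_def by (cases "overpartitions n = 0") auto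
    qed
    show "(\<lambda>n. real n powr (3 / 2) * (ln (real (overpartitions n)) - ln k - ln (main_term n))) \<longlonglongrightarrow> 0"
    proof (rule Lim_null_comparison)
      show "(\<lambda>n. 2 * (real n powr (3 / 2) * h n)) \<longlonglongrightarrow> 0"
        using tendsto_mult_right_zero[OF h] by simp
      show "\<forall>\<^sub>F n in sequentially. norm (real n powr (3 / 2) * (ln (real (overpartitions n)) - ln k - ln (main_term n))) \<le>
          2 * (real n powr (3 / 2) * h n)"
        using ev
      proof eventually_elim
        case (elim n)
        have m: "main_term n > 0" using elim main_term_pos by simp
        have R: "R n > - 1" using elim by linarith
        then have p: "real (overpartitions n) > 0" unfolding R_def by (cases "overpartitions n = 0") auto
        have "ln (1 + R n) = ln (real (overpartitions n)) - ln (k * main_term n)"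
          unfolding R_def using p K(1) m by (simp add: ln_div)
        also have "ln (k * main_term n) = ln k + ln (main_term n)"
          using K(1) m by (simp add: ln_mult)
        finally have e: "ln (real (overpartitions n)) - ln k - ln (main_term n) = ln (1 + R n)" by simp
        have half: "\<bar>R n\<bar> \<le> 1 / 2" using elim by linarith
        have "\<bar>ln (1 + R n) - R n\<bar> \<le> 2 * (R n)\<^sup>2"
          by (rule abs_ln_one_plus_x_minus_x_bound[OF half])
        also have "2 * (R n)\<^sup>2 \<le> \<bar>R n\<bar>"
        proof -
          have "2 * (R n)\<^sup>2 = 2 * \<bar>R n\<bar> * \<bar>R n\<bar>" by (simp add: power2_eq_square mult.assoc)
          also have "\<dots> \<le> 2 * \<bar>R n\<bar> * (1 / 2)" using half by (intro mult_left_mono) auto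
          finally show ?thesis by simp
        qed
        finally have "\<bar>ln (1 + R n)\<bar> \<le> 2 * h n" using elim by linarith
        then show ?case
          unfolding e using mult_left_mono[of "\<bar>ln (1 + R n)\<bar>" "2 * h n" "real n powr (3 / 2)"]
          by (simp add: abs_mult)
      qed
    qed
  qed
qed

text \<open>By linearity the four summands are treated apart, with c and \<beta> taken out. Only
  sqrt(n)/n contributes at order n^(-5/2).\<close>

lemma second_difference_smooth:
  fixes c \<beta> :: real
  defines "S \<equiv> (\<lambda>n::nat. (c + pi * sqrt (real n) - \<beta> * ln (real n) + ln (1 - 1 / (pi * sqrt (real n)))) / real n)"
  shows "(\<lambda>n. real n powr (5 / 2) * (S (n + 2) - 2 * S (n + 1) + S n)) \<longlonglongrightarrow> 3 * pi / 4"
proof -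
  define \<Delta> where "\<Delta> = (\<lambda>f n. real n powr (5 / 2) * (f (n + 2) - 2 * f (n + 1) + f n :: real))"
  have "\<Delta> (\<lambda>n::nat. 1 / real n) \<longlonglongrightarrow> 0"
    unfolding \<Delta>_def by real_asymp
  moreover have "\<Delta> (\<lambda>n::nat. sqrt (real n) / real n) \<longlonglongrightarrow> 3 / 4"
    unfolding \<Delta>_def by real_asymp
  moreover have "\<Delta> (\<lambda>n::nat. ln (real n) / real n) \<longlonglongrightarrow> 0"
    unfolding \<Delta>_def by real_asymp
  moreover have "\<Delta> (\<lambda>n::nat. ln (1 - 1 / (pi * sqrt (real n))) / real n) \<longlonglongrightarrow> 0"
    unfolding \<Delta>_def by real_asymp
  ultimately have "(\<lambda>n. c * \<Delta> (\<lambda>n::nat. 1 / real n) n + pi * \<Delta> (\<lambda>n::nat. sqrt (real n) / real n) n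
      - \<beta> * \<Delta> (\<lambda>n::nat. ln (real n) / real n) n + \<Delta> (\<lambda>n::nat. ln (1 - 1 / (pi * sqrt (real n))) / real n) n)
      \<longlonglongrightarrow> c * 0 + pi * (3 / 4) - \<beta> * 0 + 0"
    by (intro tendsto_intros)
  moreover have "c * \<Delta> (\<lambda>n::nat. 1 / real n) n + pi * \<Delta> (\<lambda>n::nat. sqrt (real n) / real n) n
      - \<beta> * \<Delta> (\<lambda>n::nat. ln (real n) / real n) n + \<Delta> (\<lambda>n::nat. ln (1 - 1 / (pi * sqrt (real n))) / real n) n
      = real n powr (5 / 2) * (S (n + 2) - 2 * S (n + 1) + S n)" for n
    unfolding \<Delta>_def S_def add_divide_distrib diff_divide_distrib by (simp add: algebra_simps)
  ultimately show ?thesis by (simp add: mult.commute)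
qed

text \<open>Each error term of the second difference vanishes by itself: n^(5/2)/(n + j) is
  asymptotic to (n + j)^(3/2).\<close>

lemma shifted_error_tendsto:
  fixes d :: "nat \<Rightarrow> real"
  assumes "(\<lambda>n. real n powr (3 / 2) * d n) \<longlonglongrightarrow> 0"
  shows "(\<lambda>n. real n powr (5 / 2) * (d (n + j) / real (n + j))) \<longlonglongrightarrow> 0"
proof -
  have 1: "(\<lambda>n. real (n + j) powr (3 / 2) * d (n + j)) \<longlonglongrightarrow> 0"
    using LIMSEQ_ignore_initial_segment[OF assms, of j] by simp
  have 2: "(\<lambda>n. (real n / real (n + j)) powr (5 / 2)) \<longlonglongrightarrow> 1"
    by real_asymp
  have "(\<lambda>n. (real n / real (n + j)) powr (5 / 2) * (real (n + j) powr (3 / 2) * d (n + j))) \<longlonglongrightarrow> 1 * 0"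
    by (rule tendsto_mult[OF 2 1])
  moreover have "\<forall>\<^sub>F n in sequentially. (real n / real (n + j)) powr (5 / 2) * (real (n + j) powr (3 / 2) * d (n + j)) =
      real n powr (5 / 2) * (d (n + j) / real (n + j))"
    using eventually_gt_at_top[of 0]
  proof eventually_elim
    case (elim n)
    define N where "N = real (n + j)"
    have N: "N > 0" using elim by (simp add: N_def)
    have "N powr (5 / 2) = N powr (3 / 2) * N powr 1" using powr_add[of N "3 / 2" 1] by simp
    then have "(real n / N) powr (5 / 2) * (N powr (3 / 2) * d (n + j)) = real n powr (5 / 2) * (d (n + j) / N)"
      using N by (simp add: powr_divide)
    then show ?case by (simp add: N_def)
  qed
  ultimately show ?thesis
    by (simp add: filterlim_cong)
qed

theorem corollary1p5:
  fixes \<alpha> :: real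
  assumes "\<alpha> \<ge> 0"
  shows "(\<lambda>n. real n powr (5 / 2) * (forward_difference ^^ 2) (\<lambda>m. ln (r_seq \<alpha> m)) n)
           \<longlonglongrightarrow> 3 * pi / 4"
proof -
  obtain k where k: "k > 0" "eventually (\<lambda>n. overpartitions n > 0) sequentially"
    "(\<lambda>n. real n powr (3 / 2) * (ln (real (overpartitions n)) - ln k - ln (main_term n))) \<longlonglongrightarrow> 0"
    by (rule overpartitions_asymp) blast
  define d where "d = (\<lambda>n. ln (real (overpartitions n)) - ln k - ln (main_term n))"
  \<comment> \<open>The smooth part of the logarithm. In the coefficient 1 + \<alpha>, the 1 is the
    factor 1/n of \<open>main_term\<close> and \<alpha> comes from the normalization in
    \<open>r_seq\<close>.\<close>
  define S where "S = (\<lambda>n::nat. (ln k + ln (pi / 4) + pi * sqrt (real n) - (1 + \<alpha>) * ln (real n) +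
      ln (1 - 1 / (pi * sqrt (real n)))) / real n)"
  have d: "(\<lambda>n. real n powr (3 / 2) * d n) \<longlonglongrightarrow> 0" using k(3) by (simp add: d_def)
  have eq: "ln (r_seq \<alpha> n) = S n + d n / real n" if n: "n > 0" "overpartitions n > 0" for n
  proof -
    have m: "1 - 1 / (pi * sqrt (real n)) > 0"
      by (rule main_factor_pos[OF n(1)])
    have "ln (main_term n) = ln (pi / 4) + pi * sqrt (real n) - ln (real n) + ln (1 - 1 / (pi * sqrt (real n)))"
      unfolding main_term_def using m n by (simp add: ln_mult ln_div)
    moreover have "ln (r_seq \<alpha> n) = (ln (real (overpartitions n)) - \<alpha> * ln (real n)) / real n"
      unfolding r_seq_def using n by (simp add: ln_root ln_div ln_powr)
    ultimately show ?thesis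
      by (simp add: S_def d_def algebra_simps flip: add_divide_distrib)
  qed
  obtain N where N: "\<And>n. n \<ge> N \<Longrightarrow> overpartitions n > 0"
    using k(2) by (auto simp: eventually_sequentially)
  have "(\<lambda>n. real n powr (5 / 2) * (S (n + 2) - 2 * S (n + 1) + S n) +
      (real n powr (5 / 2) * (d (n + 2) / real (n + 2)) - 2 * (real n powr (5 / 2) * (d (n + 1) / real (n + 1))) +
       real n powr (5 / 2) * (d (n + 0) / real (n + 0)))) \<longlonglongrightarrow> 3 * pi / 4 + (0 - 2 * 0 + 0)"
    unfolding S_def
    by (intro tendsto_add tendsto_diff tendsto_mult_left second_difference_smooth shifted_error_tendsto[OF d])
  moreover have "\<forall>\<^sub>F n in sequentially.
      real n powr (5 / 2) * (S (n + 2) - 2 * S (n + 1) + S n) +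
      (real n powr (5 / 2) * (d (n + 2) / real (n + 2)) - 2 * (real n powr (5 / 2) * (d (n + 1) / real (n + 1))) +
       real n powr (5 / 2) * (d (n + 0) / real (n + 0))) =
      real n powr (5 / 2) * (forward_difference ^^ 2) (\<lambda>m. ln (r_seq \<alpha> m)) n"
    \<comment> \<open>From here on n and all three counts are positive, so the logarithms split as
      intended.\<close>
    using eventually_ge_at_top[of "max N 1"]
  proof eventually_elim
    case (elim n)
    then have "ln (r_seq \<alpha> n) = S n + d n / real n"
      "ln (r_seq \<alpha> (n + 1)) = S (n + 1) + d (n + 1) / real (n + 1)"
      "ln (r_seq \<alpha> (n + 2)) = S (n + 2) + d (n + 2) / real (n + 2)"
      by (intro eq N; simp)+
    then show ?case
      unfolding forward_difference_2 by (simp only: add_0_right) (simp add: algebra_simps)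
  qed
  ultimately have "(\<lambda>n. real n powr (5 / 2) * (forward_difference ^^ 2) (\<lambda>m. ln (r_seq \<alpha> m)) n)
      \<longlonglongrightarrow> 3 * pi / 4 + (0 - 2 * 0 + 0)"
    by (rule Lim_transform_eventually)
  then show ?thesis by simp
qed

end
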